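(* Let $R>0$, let $S^2=\{(x,y,z)\in\mathbb R^3: x^2+y^2+z^2=R^2\}$ carry the Riemannian metric induced from $\mathbb R^3$, and let the magnetic field form be $F=\frac12\sin\theta\,d\theta\wedge d\phi$ in spherical coordinates $(\theta,\phi)$. For $N\in\mathbb N=\{1,2,\dots\}$ let $H_N=\Delta^{L^N}$ be the magnetic Laplacian on sections of $L^N$, where $L\to S^2$ is the Hermitian line bundle with Hermitian connection described in the context, and for $\varphi\in\mathcal S(\mathbb R)$ let $Y_N(\varphi)=\operatorname{tr}\varphi\left(\frac1N H_N\right)$. Then for every $\varphi\in\mathcal S(\mathbb R)$ there is an asymptotic expansion $$Y_N(\varphi)\sim\sum_{j=0}^\infty f_j(\varphi)N^{1-j},\qquad N\to\infty,$$ with coefficients $f_j(\varphi)$ independent of $N$, the first two of which are $$f_0(\varphi)=\frac{i}{4\pi}\left\langle\frac{1}{\sin\frac{1}{2R^2}(t+i0)},\hat\varphi(t)\right\rangle,$$ $$f_1(\varphi)=\frac{1}{4\pi}\left\langle\left[R^2\frac{d^2}{dt^2}+\frac{1}{4R^2}\right]\frac{t}{\sin\frac{1}{2R^2}(t+i0)},\hat\varphi(t)\right\rangle .$$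
   Context: Spherical coordinates: $x=R\sin\theta\cos\phi$, $y=R\sin\theta\sin\phi$, $z=R\cos\theta$, $\theta\in(0,\pi)$, $\phi\in(0,2\pi)$; the metric is $R^2(d\theta^2+\sin^2\theta\,d\phi^2)$. $L$ is the Hermitian line bundle associated with the Hopf bundle $S^3\to S^2$ and the character $\chi:S^1\to S^1$, $\chi(u)=u$, endowed with a Hermitian connection $\nabla^L$ whose curvature $R^L$ satisfies $F=iR^L$ (orientation conventions for the Hopf bundle being such that this is possible, i.e. $L$ has degree $\frac1{2\pi}\int_{S^2}F=1$ with respect to the orientation $d\theta\wedge d\phi$; this determines $(L,\nabla^L)$ up to isomorphism). $L^N=L^{\otimes N}$ carries the induced Hermitian structure and connection, and $\Delta^{L^N}=(\nabla^{L^N})^*\nabla^{L^N}$. It is self-adjoint in $L^2(S^2,L^N)$ with discrete spectrum; if $\nu_{N,j}$, $j=0,1,2,\dots$, are its eigenvalues counted with multiplicity, then $Y_N(\varphi)=\operatorname{tr}\varphi(\frac1N H_N)=\sum_{j\ge0}\varphi\left(\frac1N\nu_{N,j}\right)$. The asymptotic expansion means that for every $K\in\mathbb N$, $Y_N(\varphi)-\sum_{j=0}^{K-1}f_j(\varphi)N^{1-j}=\mathcal O(N^{1-K})$ as $N\to\infty$. Fourier transform: $\hat\varphi(k)=\int_{\mathbb R}\varphi(\lambda)e^{-ik\lambda}\,d\lambda$. For $c>0$ the distribution $\frac{1}{\sin c(t+i0)}\in\mathcal S'(\mathbb R)$ is defined by $\left\langle\frac{1}{\sin c(t+i0)},\psi\right\rangle=\lim_{\varepsilon\to0+}\int_{\mathbb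 R}\frac{\psi(t)}{\sin c(t+i\varepsilon)}\,dt$, $\psi\in\mathcal S(\mathbb R)$. The distribution $\frac{t}{\sin c(t+i0)}$ is its product with the function $t$; the differential operator in $f_1$ is applied to this product in the sense of distributions. *)

theory Defs
  imports "HOL-Analysis.Analysis" "HOL-Library.Function_Algebras" "HOL-Library.Landau_Symbols"
begin

section \<open>Smooth functions\<close>

fun k_times_differentiable_on ::
    "nat \<Rightarrow> ('a::euclidean_space \<Rightarrow> 'b::euclidean_space) \<Rightarrow> 'a set \<Rightarrow> bool" where
  "k_times_differentiable_on 0 f U \<longleftrightarrow> continuous_on U f"
| "k_times_differentiable_on (Suc k) f U \<longleftrightarrow>
     (\<forall>x\<in>U. f differentiable (at x)) \<and>
     (\<forall>v. k_times_differentiable_on k (\<lambda>x. frechet_derivative f (at x) v) U)"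

text \<open>Smooth functions on an embedded submanifold \<open>M\<close> are the restrictions to \<open>M\<close> of smooth
  functions on open neighbourhoods of \<open>M\<close>.\<close>

definition smooth_on ::
    "'a::euclidean_space set \<Rightarrow> ('a \<Rightarrow> 'b::euclidean_space) \<Rightarrow> bool" where
  "smooth_on M f \<longleftrightarrow>
     (\<exists>U g. open U \<and> M \<subseteq> U \<and> (\<forall>k. k_times_differentiable_on k g U) \<and> (\<forall>x\<in>M. g x = f x))"

section \<open>The round sphere of radius \<open>R\<close>\<close>

definition spherical :: "real \<Rightarrow> real \<Rightarrow> real \<Rightarrow> real^3" where
  "spherical R \<theta> \<phi> = vector [R * sin \<theta> * cos \<phi>, R * sin \<theta> * sin \<phi>, R * cos \<theta>]"

definition tangent_space :: "real^3 \<Rightarrow> (real^3) set" where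
  "tangent_space x = {v. v \<bullet> x = 0}"

definition vector_field :: "real \<Rightarrow> (real^3 \<Rightarrow> real^3) \<Rightarrow> bool" where
  "vector_field R X \<longleftrightarrow>
     smooth_on (sphere 0 R) X \<and> (\<forall>x\<in>sphere 0 R. X x \<in> tangent_space x)"

text \<open>The differential at \<open>x\<close> of a function \<open>h\<close> on the sphere through \<open>x\<close>, applied to a
  tangent vector \<open>v\<close>.  It is computed from the extension of \<open>h\<close> that is constant along rays
  from the origin, so that only the values of \<open>h\<close> on the sphere are used.\<close>

definition sphere_deriv :: "(real^3 \<Rightarrow> 'b::real_normed_vector) \<Rightarrow> real^3 \<Rightarrow> real^3 \<Rightarrow> 'b" where
  "sphere_deriv h x v = frechet_derivative (\<lambda>y. h ((norm x / norm y) *\<^sub>R y)) (at x) v"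

definition lie_bracket :: "(real^3 \<Rightarrow> real^3) \<Rightarrow> (real^3 \<Rightarrow> real^3) \<Rightarrow> real^3 \<Rightarrow> real^3" where
  "lie_bracket X Y x = sphere_deriv Y x (X x) - sphere_deriv X x (Y x)"

text \<open>Integration against the Riemannian volume \<open>R\<^sup>2 sin \<theta> d\<theta> d\<phi>\<close>.\<close>

definition sphere_integral :: "real \<Rightarrow> (real^3 \<Rightarrow> complex) \<Rightarrow> complex" where
  "sphere_integral R h =
     (LINT q:{0<..<pi} \<times> {0<..<2 * pi}|lborel.
        complex_of_real (R^2 * sin (fst q)) * h (spherical R (fst q) (snd q)))"

definition tangent_onb :: "real^3 \<Rightarrow> (real^3) set" where
  "tangent_onb x =
     (SOME B. pairwise orthogonal B \<and> (\<forall>b\<in>B. norm b = 1) \<and> span B = tangent_space x)"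

text \<open>The magnetic field form \<open>F\<close>, written without coordinates: it is \<open>1/(2R\<^sup>2)\<close> times the area
  form \<open>(v, w) \<mapsto> (x/R) \<bullet> (v \<times> w)\<close>.  The lemma below identifies it with
  \<open>(1/2) sin \<theta> d\<theta> \<and> d\<phi>\<close>.\<close>

definition magnetic_form :: "real \<Rightarrow> real^3 \<Rightarrow> real^3 \<Rightarrow> real^3 \<Rightarrow> real" where
  "magnetic_form R x v w = (x \<bullet> cross3 v w) / (2 * R^3)"

lemma vector_3_eq_axis:
  "vector [a, b, c] = a *\<^sub>R axis 1 1 + b *\<^sub>R axis 2 1 + c *\<^sub>R (axis 3 1 :: real^3)"
  by (simp add: vec_eq_iff forall_3 axis_def)

lemma magnetic_form_spherical:
  assumes "R \<noteq> 0"
  shows "magnetic_form R (spherical R \<theta> \<phi>)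
           (vector_derivative (\<lambda>t. spherical R t \<phi>) (at \<theta>))
           (vector_derivative (\<lambda>t. spherical R \<theta> t) (at \<phi>)) = sin \<theta> / 2"
proof -
  have 1: "((\<lambda>t. spherical R t \<phi>) has_vector_derivative
      vector [R * cos \<theta> * cos \<phi>, R * cos \<theta> * sin \<phi>, - (R * sin \<theta>)]) (at \<theta>)"
    unfolding spherical_def vector_3_eq_axis
    by (auto intro!: derivative_eq_intros simp: mult_ac has_real_derivative_iff_has_vector_derivative[symmetric])
  have 2: "((\<lambda>t. spherical R \<theta> t) has_vector_derivative
      vector [- (R * sin \<theta> * sin \<phi>), R * sin \<theta> * cos \<phi>, 0]) (at \<phi>)"
    unfolding spherical_def vector_3_eq_axis
    by (auto intro!: derivative_eq_intros simp: mult_ac has_real_derivative_iff_has_vector_derivative[symmetric])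
  have "spherical R \<theta> \<phi> \<bullet>
      cross3 (vector [R * cos \<theta> * cos \<phi>, R * cos \<theta> * sin \<phi>, - (R * sin \<theta>)])
             (vector [- (R * sin \<theta> * sin \<phi>), R * sin \<theta> * cos \<phi>, 0])
      = R^3 * sin \<theta> * ((sin \<theta>)^2 + (cos \<theta>)^2) * ((sin \<phi>)^2 + (cos \<phi>)^2)"
    by (simp only: spherical_def cross3_def inner_vec_def sum_3 vector_3 inner_real_def)
       (simp only: minus_mult_minus mult_zero_right diff_0 minus_minus ring_distribs power2_eq_square power3_eq_cube, algebra)
  then show ?thesis
    using assms
    by (simp add: magnetic_form_def vector_derivative_at[OF 1] vector_derivative_at[OF 2])
qed

section \<open>The Hopf bundle and its associated line bundles\<close>

abbreviation S3 :: "(complex \<times> complex) set" where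
  "S3 \<equiv> sphere 0 1"

definition hopf :: "real \<Rightarrow> complex \<times> complex \<Rightarrow> real^3" where
  "hopf R p = R *\<^sub>R vector [2 * Re (fst p * cnj (snd p)), 2 * Im (fst p * cnj (snd p)),
                         (cmod (fst p))^2 - (cmod (snd p))^2]"

definition circle_act :: "complex \<times> complex \<Rightarrow> complex \<Rightarrow> complex \<times> complex" where
  "circle_act p u = (fst p * u, snd p * u)"

type_synonym bundle_section = "complex \<times> complex \<Rightarrow> complex"
type_synonym bundle_form = "complex \<times> complex \<Rightarrow> real^3 \<Rightarrow> complex"

text \<open>Smooth sections of the line bundle \<open>L\<^sup>N = S\<^sup>3 \<times>\<^bsub>\<chi>\<^sup>N\<^esub> \<complex>\<close>, \<open>\<chi>(u) = u\<close>, are identified as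
  usual with the smooth functions \<open>s\<close> on \<open>S\<^sup>3\<close> such that \<open>s(p u) = \<chi>(u)\<^sup>-\<^sup>N s(p)\<close>; the tensor
  product of sections then becomes the product of functions.  With this choice of
  \<^const>\<open>hopf\<close>, \<open>L\<close> has degree 1 with respect to the orientation \<open>d\<theta> \<and> d\<phi>\<close>
  (exchanging \<open>p\<^sub>1\<close> and \<open>p\<^sub>2\<close> in the first two components would give degree -1).
  Functions are set to \<open>0\<close> outside \<open>S\<^sup>3\<close>, so that equality of sections is equality of
  functions.\<close>

definition sections :: "nat \<Rightarrow> bundle_section set" where
  "sections N = {s. smooth_on S3 s \<and> (\<forall>p. p \<notin> S3 \<longrightarrow> s p = 0) \<and>
     (\<forall>p\<in>S3. \<forall>u. cmod u = 1 \<longrightarrow> s (circle_act p u) = inverse (u ^ N) * s p)}"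

text \<open>Fibrewise expressions do not depend on the chosen point of the fibre of the Hopf map.\<close>

definition fibre_point :: "real \<Rightarrow> real^3 \<Rightarrow> complex \<times> complex" where
  "fibre_point R x = (SOME p. p \<in> S3 \<and> hopf R p = x)"

definition herm :: "real \<Rightarrow> bundle_section \<Rightarrow> bundle_section \<Rightarrow> real^3 \<Rightarrow> complex" where
  "herm R s t x = s (fibre_point R x) * cnj (t (fibre_point R x))"

definition herm_form :: "real \<Rightarrow> bundle_form \<Rightarrow> bundle_form \<Rightarrow> real^3 \<Rightarrow> complex" where
  "herm_form R \<alpha> \<beta> x =
     (\<Sum>e\<in>tangent_onb x. \<alpha> (fibre_point R x) e * cnj (\<beta> (fibre_point R x) e))"

section \<open>Connections\<close>

text \<open>A connection \<open>D\<close> sends a section \<open>s\<close> of the bundle to a bundle-valued 1-form; \<open>D s p v\<close> is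
  the derivative of \<open>s\<close> in the direction of the tangent vector \<open>v\<close> at \<open>hopf R p\<close>, expressed in
  the frame \<open>p\<close>.\<close>

type_synonym connection = "bundle_section \<Rightarrow> bundle_form"

definition covariant_deriv ::
    "real \<Rightarrow> connection \<Rightarrow> (real^3 \<Rightarrow> real^3) \<Rightarrow> bundle_section \<Rightarrow> bundle_section" where
  "covariant_deriv R D X s = (\<lambda>p. if p \<in> S3 then D s p (X (hopf R p)) else 0)"

definition hermitian_connection :: "real \<Rightarrow> nat \<Rightarrow> connection \<Rightarrow> bool" where
  "hermitian_connection R N D \<longleftrightarrow>
     (\<forall>s\<in>sections N. \<forall>p\<in>S3.
        \<forall>v\<in>tangent_space (hopf R p). \<forall>w\<in>tangent_space (hopf R p). \<forall>a b.
          D s p (a *\<^sub>R v + b *\<^sub>R w) = of_real a * D s p v + of_real b * D s p w) \<and>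
     (\<forall>s\<in>sections N. \<forall>X. vector_field R X \<longrightarrow> covariant_deriv R D X s \<in> sections N) \<and>
     (\<forall>s\<in>sections N. \<forall>t\<in>sections N. \<forall>p\<in>S3. \<forall>v\<in>tangent_space (hopf R p).
        D (\<lambda>q. s q + t q) p v = D s p v + D t p v) \<and>
     (\<forall>s\<in>sections N. \<forall>h. smooth_on (sphere 0 R) h \<longrightarrow>
        (\<forall>p\<in>S3. \<forall>v\<in>tangent_space (hopf R p).
           D (\<lambda>q. h (hopf R q) * s q) p v
             = sphere_deriv h (hopf R p) v * s p + h (hopf R p) * D s p v)) \<and>
     (\<forall>s\<in>sections N. \<forall>t\<in>sections N. \<forall>p\<in>S3. \<forall>v\<in>tangent_space (hopf R p).
        sphere_deriv (herm R s t) (hopf R p) v = D s p v * cnj (t p) + s p * cnj (D t p v))"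

definition curvature ::
    "real \<Rightarrow> connection \<Rightarrow> (real^3 \<Rightarrow> real^3) \<Rightarrow> (real^3 \<Rightarrow> real^3) \<Rightarrow> bundle_section \<Rightarrow> bundle_section"
  where
  "curvature R D X Y s = (\<lambda>p.
     covariant_deriv R D X (covariant_deriv R D Y s) p
     - covariant_deriv R D Y (covariant_deriv R D X s) p
     - covariant_deriv R D (lie_bracket X Y) s p)"

text \<open>The condition \<open>F = i R\<^sup>L\<close>.\<close>

definition has_magnetic_curvature :: "real \<Rightarrow> connection \<Rightarrow> bool" where
  "has_magnetic_curvature R D \<longleftrightarrow>
     (\<forall>X Y s. vector_field R X \<longrightarrow> vector_field R Y \<longrightarrow> s \<in> sections 1 \<longrightarrow>
        (\<forall>p\<in>S3. complex_of_real (magnetic_form R (hopf R p) (X (hopf R p)) (Y (hopf R p))) * s p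
                  = \<i> * curvature R D X Y s p))"

text \<open>\<open>DN\<close> is the connection induced by the connection \<open>D\<close> of \<open>L\<close> on the tensor power \<open>L\<^sup>N\<close>; it is
  determined by the Leibniz rule on decomposable sections \<open>s\<^sub>0 \<otimes> \<dots> \<otimes> s\<^sub>N\<^sub>-\<^sub>1\<close>.\<close>

definition induced_connection :: "real \<Rightarrow> connection \<Rightarrow> nat \<Rightarrow> connection \<Rightarrow> bool" where
  "induced_connection R D N DN \<longleftrightarrow>
     hermitian_connection R N DN \<and>
     (\<forall>s. (\<forall>i<N. s i \<in> sections 1) \<longrightarrow>
        (\<forall>p\<in>S3. \<forall>v\<in>tangent_space (hopf R p).
           DN (\<lambda>q. \<Prod>i<N. s i q) p v = (\<Sum>i<N. D (s i) p v * (\<Prod>j\<in>{..<N} - {i}. s j p))))"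

section \<open>The magnetic Laplacian and the trace of its functions\<close>

text \<open>The graph of \<open>\<Delta> = D\<^sup>* D\<close>: \<open>t = D\<^sup>* (D s)\<close>, where \<open>D\<^sup>*\<close> is the formal adjoint of \<open>D\<close> with
  respect to the \<open>L\<^sup>2\<close> inner products.\<close>

definition magnetic_laplacian ::
    "real \<Rightarrow> nat \<Rightarrow> connection \<Rightarrow> bundle_section \<Rightarrow> bundle_section \<Rightarrow> bool" where
  "magnetic_laplacian R N D s t \<longleftrightarrow>
     s \<in> sections N \<and> t \<in> sections N \<and>
     (\<forall>v\<in>sections N.
        sphere_integral R (herm R t v) = sphere_integral R (herm_form R (D s) (D v)))"

definition eigenspace :: "real \<Rightarrow> nat \<Rightarrow> connection \<Rightarrow> real \<Rightarrow> bundle_section set" where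
  "eigenspace R N D \<nu> = {s. magnetic_laplacian R N D s (\<lambda>p. of_real \<nu> * s p)}"

definition eigenvalues :: "real \<Rightarrow> nat \<Rightarrow> connection \<Rightarrow> real set" where
  "eigenvalues R N D = {\<nu>. \<exists>s\<in>eigenspace R N D \<nu>. s \<noteq> 0}"

definition eigen_multiplicity :: "real \<Rightarrow> nat \<Rightarrow> connection \<Rightarrow> real \<Rightarrow> nat" where
  "eigen_multiplicity R N D \<nu> =
     vector_space.dim (\<lambda>(c::complex) (s::bundle_section) p. c * s p) (eigenspace R N D \<nu>)"

text \<open>\<open>tr \<phi>(H\<^sub>N / N)\<close>, where \<open>D\<close> is the connection on \<open>L\<^sup>N\<close>.\<close>

definition trace_Y :: "real \<Rightarrow> nat \<Rightarrow> connection \<Rightarrow> (real \<Rightarrow> complex) \<Rightarrow> complex" where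
  "trace_Y R N D \<phi> =
     (\<Sum>\<^sub>\<infinity>\<nu>\<in>eigenvalues R N D. of_nat (eigen_multiplicity R N D \<nu>) * \<phi> (\<nu> / real N))"

section \<open>Schwartz functions and tempered distributions on the line\<close>

definition vderiv :: "(real \<Rightarrow> complex) \<Rightarrow> real \<Rightarrow> complex" where
  "vderiv f = (\<lambda>t. vector_derivative f (at t))"

definition schwartz :: "(real \<Rightarrow> complex) \<Rightarrow> bool" where
  "schwartz f \<longleftrightarrow>
     (\<forall>n t. (vderiv ^^ n) f differentiable (at t)) \<and>
     (\<forall>m n. bounded (range (\<lambda>t. t ^ m *\<^sub>R (vderiv ^^ n) f t)))"

definition fourier :: "(real \<Rightarrow> complex) \<Rightarrow> real \<Rightarrow> complex" where
  "fourier \<phi> k = (LINT x|lborel. \<phi> x * exp (- (\<i> * of_real k * of_real x)))"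

text \<open>A distribution is given by its values on Schwartz functions; its values on other functions
  are irrelevant.\<close>

type_synonym distribution = "(real \<Rightarrow> complex) \<Rightarrow> complex"

definition dist_mult :: "(real \<Rightarrow> complex) \<Rightarrow> distribution \<Rightarrow> distribution" where
  "dist_mult g T = (\<lambda>\<psi>. T (\<lambda>t. g t * \<psi> t))"

definition dist_deriv :: "distribution \<Rightarrow> distribution" where
  "dist_deriv T = (\<lambda>\<psi>. - T (vderiv \<psi>))"

text \<open>The distribution \<open>1 / sin c(t + i0)\<close>.\<close>

definition inv_sin_dist :: "real \<Rightarrow> distribution" where
  "inv_sin_dist c = (\<lambda>\<psi>. Lim (at_right 0)
     (\<lambda>\<epsilon>. LINT t|lborel. \<psi> t / sin (of_real c * (of_real t + \<i> * of_real \<epsilon>))))"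

end

theory Submission
  imports Defs "HOL-Probability.Probability"
begin

text \<open>The curvature fixes \<open>\<nabla>\<^sup>L\<close> up to a closed one-form, which extends homogeneously to
  \<open>\<real>\<^sup>3 - {0}\<close> and is exact there; exponentiating a primitive gives a gauge transformation to the standard
  connection.  Sections of \<open>L\<^sup>N\<close> are then combinations of the monomials
  \<open>p\<^sub>1\<^sup>a p\<^sub>2\<^sup>b cnj p\<^sub>1\<^sup>c cnj p\<^sub>2\<^sup>d\<close> with \<open>c + d = N + a + b\<close>, and the Laplacian
  is \<open>R\<^sup>-\<^sup>2\<close> times the sum of the squared covariant derivatives along the rotation fields.  These
  lift to linear fields, so that the Laplacian acts on the span of the monomials, triangularly with respect
  to \<open>j = a + b\<close> and with diagonal entries \<open>(j (j + 1) + N (2 j + 1) / 2) / R\<^sup>2\<close>; each occurs with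
  multiplicity \<open>N + 2 j + 1\<close>, and there is no other eigenvalue by Stone--Weierstrass.  Thus
  \<open>Y\<^sub>N(\<phi>) = \<Sum>j. (N + 2 j + 1) \<phi>((2 j + 1) / (2 R\<^sup>2) + j (j + 1) / (N R\<^sup>2))\<close>, and
  Taylor's formula at \<open>(2 j + 1) / (2 R\<^sup>2)\<close> yields the expansion.  Since
  \<open>1 / sin c(t + i0) = - 2 \<i> (\<Sum>j. exp (\<i> (2 j + 1) c t))\<close>, Fourier inversion turns the first two
  coefficients into the stated distributions.\<close>

section \<open>Calculus of smooth functions\<close>

text \<open>The connection is given only by axioms: on \<open>L\<close> by metric compatibility and
  curvature, on the powers by the Leibniz rule for products of sections of \<open>L\<close>. All its
  values are therefore generated from those on the two sections \<open>c1\<close> and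
  \<open>c2\<close>, the conjugate coordinates of the 3-sphere, by multiplication with functions of
  the base point. These functions are extended to be constant along rays, so that every derivative
  becomes a Frechet derivative in punctured space; the first cohomology of that space vanishes,
  which is why the curvature leaves only a gauge freedom. Completeness of the spectrum uses no
  elliptic theory: an eigensection is paired with the monomials, symmetry of the Laplacian turns
  triangularity into a recurrence for these numbers, and the recurrence kills all of them unless the
  eigenvalue is a diagonal entry. In the final sum the displacement \<open>mu j / N\<close> is not
  uniformly small in \<open>j\<close>, as it grows like the square of \<open>lam j\<close>; the
  Taylor remainders are controlled only through the rapid decay of the derivatives.\<close>

definition smooth_in :: "'a::euclidean_space set \<Rightarrow> ('a \<Rightarrow> 'b::euclidean_space) \<Rightarrow> bool" where
  "smooth_in U f \<longleftrightarrow> (\<forall>k. k_times_differentiable_on k f U)"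

lemma smooth_inI: "(\<And>k. k_times_differentiable_on k f U) \<Longrightarrow> smooth_in U f"
  and smooth_inD: "smooth_in U f \<Longrightarrow> k_times_differentiable_on k f U"
  by (simp_all add: smooth_in_def)

lemma frechet_derivative_cong_open:
  assumes "open U" "x \<in> U" "\<And>y. y \<in> U \<Longrightarrow> f y = g y" "f differentiable (at x)"
  shows "g differentiable (at x)" "frechet_derivative g (at x) = frechet_derivative f (at x)"
proof -
  have "(f has_derivative frechet_derivative f (at x)) (at x)"
    using assms(4) frechet_derivative_works by blast
  then have "(g has_derivative frechet_derivative f (at x)) (at x)"
    using has_derivative_transform_within_open[OF _ assms(1,2)] assms(3) by blast
  then show "g differentiable (at x)" "frechet_derivative g (at x) = frechet_derivative f (at x)"
    by (auto simp: differentiable_def frechet_derivative_at[symmetric])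
qed

lemma ktd_cong:
  assumes "open U" "\<And>x. x \<in> U \<Longrightarrow> f x = g x" "k_times_differentiable_on k f U"
  shows "k_times_differentiable_on k g U"
  using assms(2,3)
proof (induction k arbitrary: f g)
  case 0
  then show ?case using continuous_on_cong[of U U f g] by auto
next
  case (Suc k)
  have *: "g differentiable (at x)" "frechet_derivative g (at x) = frechet_derivative f (at x)"
    if "x \<in> U" for x
    using frechet_derivative_cong_open[OF assms(1) that, of f g] Suc.prems that by auto
  show ?case
    unfolding k_times_differentiable_on.simps
  proof (intro conjI allI ballI)
    fix v
    show "k_times_differentiable_on k (\<lambda>x. frechet_derivative g (at x) v) U"
      by (rule Suc.IH[of "\<lambda>x. frechet_derivative f (at x) v"]) (use * Suc.prems in auto)
  qed (use * in auto)
qed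

lemma ktd_subset:
  "k_times_differentiable_on k f U \<Longrightarrow> V \<subseteq> U \<Longrightarrow> k_times_differentiable_on k f V"
  by (induction k arbitrary: f) (auto intro: continuous_on_subset)

lemma ktd_local:
  assumes "\<And>x. x \<in> U \<Longrightarrow> \<exists>V. open V \<and> x \<in> V \<and> k_times_differentiable_on k f V"
  shows "k_times_differentiable_on k f U"
  using assms
proof (induction k arbitrary: f)
  case 0
  have "isCont f x" if "x \<in> U" for x
    using 0[OF that] by (auto simp: continuous_on_eq_continuous_at)
  then show ?case by (simp add: continuous_at_imp_continuous_on)
next
  case (Suc k)
  show ?case
    unfolding k_times_differentiable_on.simps
  proof (intro conjI allI ballI)
    fix v
    show "k_times_differentiable_on k (\<lambda>x. frechet_derivative f (at x) v) U"
    proof (rule Suc.IH)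
      fix x assume "x \<in> U"
      then obtain V where "open V" "x \<in> V" "k_times_differentiable_on (Suc k) f V"
        using Suc.prems by blast
      then show "\<exists>V. open V \<and> x \<in> V \<and>
          k_times_differentiable_on k (\<lambda>x. frechet_derivative f (at x) v) V"
        by (intro exI[of _ V]) auto
    qed
  next
    fix x assume "x \<in> U"
    then obtain V where "x \<in> V" "k_times_differentiable_on (Suc k) f V"
      using Suc.prems by blast
    then show "f differentiable (at x)" by auto
  qed
qed

lemma ktd_SucD: "k_times_differentiable_on (Suc k) f U \<Longrightarrow> k_times_differentiable_on k f U"
proof (induction k arbitrary: f)
  case 0
  then show ?case
    by (auto intro!: continuous_at_imp_continuous_on differentiable_imp_continuous_within)
qed auto

lemma ktd_const: "k_times_differentiable_on k (\<lambda>x. c) U"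
  by (induction k arbitrary: c) auto

lemma ktd_bounded_linear:
  assumes "bounded_linear f"
  shows "k_times_differentiable_on k f U"
proof (cases k)
  case 0
  then show ?thesis using assms by (simp add: linear_continuous_on)
next
  case (Suc j)
  have "(f has_derivative f) (at x)" for x
    using assms by (rule bounded_linear_imp_has_derivative)
  then have "f differentiable (at x)" "frechet_derivative f (at x) = f" for x
    by (auto simp: differentiable_def frechet_derivative_at[symmetric])
  then show ?thesis using Suc by (simp add: ktd_const)
qed

lemma ktd_add:
  assumes "open U" "k_times_differentiable_on k f U" "k_times_differentiable_on k g U"
  shows "k_times_differentiable_on k (\<lambda>x. f x + g x) U"
  using assms(2,3)
proof (induction k arbitrary: f g)
  case 0
  then show ?case by (auto intro: continuous_intros)
next
  case (Suc k)
  have d: "((\<lambda>x. f x + g x) has_derivative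
       (\<lambda>v. frechet_derivative f (at x) v + frechet_derivative g (at x) v)) (at x)"
    if "x \<in> U" for x
    by (rule has_derivative_add) (use Suc.prems that in \<open>auto simp flip: frechet_derivative_works\<close>)
  show ?case unfolding k_times_differentiable_on.simps
  proof (intro conjI allI ballI)
    fix v
    show "k_times_differentiable_on k (\<lambda>x. frechet_derivative (\<lambda>x. f x + g x) (at x) v) U"
      by (rule ktd_cong[OF \<open>open U\<close>, of "\<lambda>x. frechet_derivative f (at x) v + frechet_derivative g (at x) v"])
         (use Suc in \<open>auto simp: frechet_derivative_at[OF d, symmetric]\<close>)
  qed (use Suc.prems in auto)
qed

lemma ktd_bilinear:
  assumes "bounded_bilinear h" "open U"
    and "k_times_differentiable_on k f U" "k_times_differentiable_on k g U"
  shows "k_times_differentiable_on k (\<lambda>x. h (f x) (g x)) U"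
proof -
  interpret bounded_bilinear h by fact
  show ?thesis
    using assms(3,4)
  proof (induction k arbitrary: f g)
    case 0
    then show ?case by (auto intro: continuous_on)
  next
    case (Suc k)
    have d: "((\<lambda>x. h (f x) (g x)) has_derivative
         (\<lambda>v. h (f x) (frechet_derivative g (at x) v) + h (frechet_derivative f (at x) v) (g x))) (at x)"
      if "x \<in> U" for x
      by (rule FDERIV) (use Suc.prems that in \<open>auto simp flip: frechet_derivative_works\<close>)
    \<comment> \<open>The product rule leaves one factor undifferentiated, so the induction
      hypothesis is applied to \<open>f\<close> and \<open>g\<close> themselves at the lower
      order.\<close>
    have k: "k_times_differentiable_on k f U" "k_times_differentiable_on k g U"
      using Suc.prems by (auto simp del: k_times_differentiable_on.simps intro: ktd_SucD)
    show ?case unfolding k_times_differentiable_on.simps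
    proof (intro conjI allI ballI)
      fix v
      have "k_times_differentiable_on k (\<lambda>x. h (f x) (frechet_derivative g (at x) v)
              + h (frechet_derivative f (at x) v) (g x)) U"
        by (intro ktd_add \<open>open U\<close> Suc.IH k) (use Suc.prems in auto)
      then show "k_times_differentiable_on k (\<lambda>x. frechet_derivative (\<lambda>x. h (f x) (g x)) (at x) v) U"
        by (rule ktd_cong[OF \<open>open U\<close>, rotated]) (simp add: frechet_derivative_at[OF d, symmetric])
    qed (use d in \<open>auto simp: differentiable_def\<close>)
  qed
qed

lemma ktd_sum:
  assumes "open U" "\<And>i. i \<in> I \<Longrightarrow> k_times_differentiable_on k (f i) U"
  shows "k_times_differentiable_on k (\<lambda>x. \<Sum>i\<in>I. f i x) U"
  using assms(2)
proof (induction I rule: infinite_finite_induct)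
  case (insert i I)
  then have "k_times_differentiable_on k (\<lambda>x. f i x + (\<Sum>i\<in>I. f i x)) U"
    by (intro ktd_add assms(1)) auto
  then show ?case using insert by simp
qed (simp_all add: ktd_const)

text \<open>In the chain rule the direction \<open>frechet_derivative g (at x) v\<close> varies with
  \<open>x\<close>, whereas the recursive definition of differentiability fixes the direction.
  Expanding it in \<open>Basis\<close> leaves only derivatives of \<open>f\<close> in fixed
  directions, to which the induction hypothesis applies.\<close>

lemma ktd_compose:
  assumes "open U" "open V" "g ` U \<subseteq> V"
    and "k_times_differentiable_on k f V" "k_times_differentiable_on k g U"
  shows "k_times_differentiable_on k (\<lambda>x. f (g x)) U"
  using assms(3-)
proof (induction k arbitrary: f)
  case 0
  then show ?case using continuous_on_compose2[of V f U g] by simp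
next
  case (Suc k)
  have d: "((\<lambda>x. f (g x)) has_derivative
      (\<lambda>v. \<Sum>b\<in>Basis. (frechet_derivative g (at x) v \<bullet> b) *\<^sub>R frechet_derivative f (at (g x)) b)) (at x)"
    if "x \<in> U" for x
  proof -
    have f: "(f has_derivative frechet_derivative f (at (g x))) (at (g x))"
      using Suc.prems that by (auto simp flip: frechet_derivative_works)
    have g: "(g has_derivative frechet_derivative g (at x)) (at x)"
      using Suc.prems that by (auto simp flip: frechet_derivative_works)
    interpret f: linear "frechet_derivative f (at (g x))"
      using f by (rule has_derivative_linear)
    have "frechet_derivative f (at (g x)) (frechet_derivative g (at x) v) =
        (\<Sum>b\<in>Basis. (frechet_derivative g (at x) v \<bullet> b) *\<^sub>R frechet_derivative f (at (g x)) b)" for v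
    proof -
      let ?w = "frechet_derivative g (at x) v"
      have "frechet_derivative f (at (g x)) ?w = frechet_derivative f (at (g x)) (\<Sum>b\<in>Basis. (?w \<bullet> b) *\<^sub>R b)"
        by (simp only: euclidean_representation)
      also have "\<dots> = (\<Sum>b\<in>Basis. (?w \<bullet> b) *\<^sub>R frechet_derivative f (at (g x)) b)"
        by (simp only: f.sum f.scaleR)
      finally show ?thesis .
    qed
    then show ?thesis by (intro has_derivative_eq_rhs[OF has_derivative_compose[OF g f]] ext)
  qed
  show ?case unfolding k_times_differentiable_on.simps
  proof (intro conjI allI ballI)
    fix v
    show "k_times_differentiable_on k (\<lambda>x. frechet_derivative (\<lambda>x. f (g x)) (at x) v) U"
    proof (rule ktd_cong[OF \<open>open U\<close>])
      show "k_times_differentiable_on k (\<lambda>x. \<Sum>b\<in>Basis.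
          (frechet_derivative g (at x) v \<bullet> b) *\<^sub>R frechet_derivative f (at (g x)) b) U"
      proof (intro ktd_sum \<open>open U\<close> ktd_bilinear[OF bounded_bilinear_scaleR])
        fix b
        show "k_times_differentiable_on k (\<lambda>x. frechet_derivative g (at x) v \<bullet> b) U"
          by (rule ktd_bilinear[OF bounded_bilinear_inner \<open>open U\<close> _ ktd_const]) (use Suc.prems in auto)
        show "k_times_differentiable_on k (\<lambda>x. frechet_derivative f (at (g x)) b) U"
          by (rule Suc.IH) (use Suc.prems ktd_SucD[OF Suc.prems(3)] in auto)
      qed
    qed (simp add: frechet_derivative_at[OF d, symmetric])
  qed (use d in \<open>auto simp: differentiable_def\<close>)
qed

lemma smooth_ident: "smooth_in U (\<lambda>x. x)"
  by (intro smooth_inI ktd_bounded_linear bounded_linear_ident)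

lemma smooth_const: "smooth_in U (\<lambda>x. c)"
  by (intro smooth_inI ktd_const)

lemma smooth_bilinear:
  assumes "bounded_bilinear h" "open U" "smooth_in U f" "smooth_in U g"
  shows "smooth_in U (\<lambda>x. h (f x) (g x))"
  using assms(3,4) unfolding smooth_in_def by (auto intro: ktd_bilinear[OF assms(1,2)])

lemma smooth_add: "open U \<Longrightarrow> smooth_in U f \<Longrightarrow> smooth_in U g \<Longrightarrow> smooth_in U (\<lambda>x. f x + g x)"
  unfolding smooth_in_def by (auto intro: ktd_add)

lemma smooth_linear: "bounded_linear h \<Longrightarrow> open U \<Longrightarrow> smooth_in U f \<Longrightarrow> smooth_in U (\<lambda>x. h (f x))"
  unfolding smooth_in_def by (auto intro: ktd_compose[of U UNIV f _ h] ktd_bounded_linear)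

lemma smooth_compose:
  "open U \<Longrightarrow> open V \<Longrightarrow> g ` U \<subseteq> V \<Longrightarrow> smooth_in V f \<Longrightarrow> smooth_in U g \<Longrightarrow> smooth_in U (\<lambda>x. f (g x))"
  unfolding smooth_in_def by (auto intro: ktd_compose[of U V])

lemma smooth_diff: 
  assumes "open U" "smooth_in U f" "smooth_in U g" shows "smooth_in U (\<lambda>x. f x - g x)"
  using smooth_add[OF assms(1,2) smooth_linear[OF bounded_linear_minus[OF bounded_linear_ident] assms(1,3)]]
  by simp

lemma smooth_mult:
  fixes f g :: "'a::euclidean_space \<Rightarrow> 'b::{euclidean_space,real_normed_algebra}"
  shows "open U \<Longrightarrow> smooth_in U f \<Longrightarrow> smooth_in U g \<Longrightarrow> smooth_in U (\<lambda>x. f x * g x)"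
  by (rule smooth_bilinear[OF bounded_bilinear_mult])

lemma smooth_Pair:
  fixes f :: "'a::euclidean_space \<Rightarrow> 'b::euclidean_space" and g :: "'a \<Rightarrow> 'c::euclidean_space"
  assumes "open U" "smooth_in U f" "smooth_in U g"
  shows "smooth_in U (\<lambda>x. (f x, g x))"
proof -
  have "bounded_linear (\<lambda>y::'b. (y, 0::'c))" "bounded_linear (\<lambda>y::'c. (0::'b, y))"
    by (simp_all add: bounded_linear_Pair bounded_linear_ident bounded_linear_zero)
  from smooth_add[OF assms(1) smooth_linear[OF this(1) assms(1,2)] smooth_linear[OF this(2) assms(1,3)]]
  show ?thesis by simp
qed

lemma smooth_imp_differentiable:
  "smooth_in U f \<Longrightarrow> x \<in> U \<Longrightarrow> f differentiable (at x)"
  using smooth_inD[of U f "Suc 0"] by simp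

lemma smooth_imp_has_derivative:
  "smooth_in U f \<Longrightarrow> x \<in> U \<Longrightarrow> (f has_derivative frechet_derivative f (at x)) (at x)"
  using smooth_imp_differentiable frechet_derivative_works by blast

lemma smooth_frechet_derivative:
  "smooth_in U f \<Longrightarrow> smooth_in U (\<lambda>x. frechet_derivative f (at x) v)"
  using smooth_inD[of U f "Suc _"] by (intro smooth_inI) simp

lemma smooth_imp_continuous_on: "smooth_in U f \<Longrightarrow> continuous_on U f"
  using smooth_inD[of U f 0] by simp

text \<open>Serves for potentials, of which only the differential is known explicitly.\<close>

lemma smoothI_derivatives:
  assumes "open U" "\<And>x. x \<in> U \<Longrightarrow> (f has_derivative F x) (at x)"
    and "\<And>v. smooth_in U (\<lambda>x. F x v)"
  shows "smooth_in U f"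
proof (rule smooth_inI)
  fix k
  have *: "frechet_derivative f (at x) = F x" if "x \<in> U" for x
    using frechet_derivative_at[OF assms(2)[OF that]] by simp
  have "k_times_differentiable_on (Suc k) f U"
    unfolding k_times_differentiable_on.simps
  proof (intro conjI ballI allI)
    fix v
    show "k_times_differentiable_on k (\<lambda>x. frechet_derivative f (at x) v) U"
      by (rule ktd_cong[OF assms(1), of "\<lambda>x. F x v"]) (use * smooth_inD[OF assms(3)] in auto)
  qed (use assms(2) in \<open>auto simp: differentiable_def\<close>)
  then show "k_times_differentiable_on k f U" by (rule ktd_SucD)
qed

lemma smooth_exp: "smooth_in UNIV (exp :: complex \<Rightarrow> complex)"
proof (rule smooth_inI)
  fix k
  show "k_times_differentiable_on k (exp :: complex \<Rightarrow> complex) UNIV"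
  proof (induction k)
    case 0
    show ?case by (auto intro: continuous_intros)
  next
    case (Suc k)
    have d: "(exp has_derivative (\<lambda>v. exp x * v)) (at x)" for x :: complex
      using DERIV_exp[of x] by (simp add: has_field_derivative_def)
    have "k_times_differentiable_on k (\<lambda>x::complex. exp x * v) UNIV" for v
      by (rule ktd_bilinear[OF bounded_bilinear_mult open_UNIV Suc ktd_const])
    then show ?case using d
      by (auto simp: differentiable_def frechet_derivative_at[OF d, symmetric])
  qed
qed

lemma smooth_powr: "smooth_in {0<..} (\<lambda>x::real. x powr a)"
proof (rule smooth_inI)
  fix k
  show "k_times_differentiable_on k (\<lambda>x::real. x powr a) {0<..}"
  proof (induction k arbitrary: a)
    case 0
    show ?case by (auto intro!: continuous_intros)
  next
    case (Suc k)
    have d: "((\<lambda>x. x powr a) has_derivative (\<lambda>v. a * x powr (a - 1) * v)) (at x)" if "x > 0" for x :: real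
      using has_real_derivative_powr[OF that] by (simp add: has_field_derivative_def)
    have "k_times_differentiable_on k (\<lambda>x. a * x powr (a - 1) * v) {0<..}" for v
      by (intro ktd_bilinear[OF bounded_bilinear_mult] ktd_const Suc) auto
    then have "k_times_differentiable_on k (\<lambda>x. frechet_derivative (\<lambda>x. x powr a) (at x) v) {0<..}" for v
      by (rule ktd_cong[rotated 2]) (auto simp: frechet_derivative_at[OF d, symmetric])
    then show ?case using d by (auto simp: differentiable_def)
  qed
qed

lemma smooth_of_real: "open U \<Longrightarrow> smooth_in U f \<Longrightarrow> smooth_in U (\<lambda>x. complex_of_real (f x))"
  by (rule smooth_linear[OF bounded_linear_of_real])

lemma smooth_cong: "open U \<Longrightarrow> (\<And>x. x \<in> U \<Longrightarrow> f x = g x) \<Longrightarrow> smooth_in U f \<Longrightarrow> smooth_in U g"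
  unfolding smooth_in_def by (auto intro: ktd_cong[of U f g])

text \<open>The norm is treated as a power of \<open>x \<bullet> x\<close>, which is bilinear in the
  identity and positive away from the origin.\<close>

lemma smooth_norm_powr:
  "smooth_in (- {0}) (\<lambda>x::'a::euclidean_space. norm x powr a)"
proof -
  have 1: "smooth_in (- {0}) (\<lambda>x::'a. x \<bullet> x)"
    by (intro smooth_bilinear[OF bounded_bilinear_inner] smooth_ident) auto
  have 2: "smooth_in (- {0}) (\<lambda>x::'a. (x \<bullet> x) powr (a / 2))"
    by (rule smooth_compose[OF _ _ _ smooth_powr 1]) auto
  have 3: "(x \<bullet> x) powr (a / 2) = norm x powr a" if "x \<in> - {0}" for x :: 'a
  proof -
    have "x \<bullet> x = norm x powr 2" using that by (simp add: dot_square_norm)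
    then show ?thesis by (simp only: powr_powr) simp
  qed
  show ?thesis by (rule smooth_cong[OF _ 3 2]) auto
qed

lemma smooth_subset: "smooth_in U f \<Longrightarrow> V \<subseteq> U \<Longrightarrow> smooth_in V f"
  unfolding smooth_in_def by (auto intro: ktd_subset)

lemma smooth_local:
  "(\<And>x. x \<in> U \<Longrightarrow> \<exists>V. open V \<and> x \<in> V \<and> smooth_in V f) \<Longrightarrow> smooth_in U f"
  by (rule smooth_inI, rule ktd_local) (simp add: smooth_in_def, fast)

section \<open>The Hopf map and descent of invariant functions\<close>

text \<open>Both sides are choices from the same predicate, so they agree even at points where the
  functions are not differentiable.\<close>

lemma frechet_derivative_eq_open:
  assumes "open U" "x \<in> U" "\<And>y. y \<in> U \<Longrightarrow> f y = g y"
  shows "frechet_derivative f (at x) = frechet_derivative g (at x)"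
proof -
  have "(f has_derivative f') (at x) \<longleftrightarrow> (g has_derivative f') (at x)" for f'
    using has_derivative_transform_within_open[OF _ assms(1,2), of f f' UNIV g]
      has_derivative_transform_within_open[OF _ assms(1,2), of g f' UNIV f] assms(3) by auto
  then show ?thesis by (simp add: frechet_derivative_def)
qed

lemma has_derivative_imp_frechet:
  "(f has_derivative F) (at x) \<Longrightarrow> frechet_derivative f (at x) = F"
  by (rule frechet_derivative_at[symmetric])

lemma smooth_on_altdef:
  "smooth_on M f \<longleftrightarrow> (\<exists>U g. open U \<and> M \<subseteq> U \<and> smooth_in U g \<and> (\<forall>x\<in>M. g x = f x))"
  by (simp add: smooth_on_def smooth_in_def)

lemma smooth_onI:
  "open U \<Longrightarrow> M \<subseteq> U \<Longrightarrow> smooth_in U g \<Longrightarrow> (\<And>x. x \<in> M \<Longrightarrow> g x = f x) \<Longrightarrow> smooth_on M f"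
  unfolding smooth_on_altdef by blast

lemma smooth_on_bilinear:
  assumes "bounded_bilinear h" "smooth_on M f" "smooth_on M g"
  shows "smooth_on M (\<lambda>x. h (f x) (g x))"
proof -
  from assms obtain U f' V g' where
    "open U" "M \<subseteq> U" "smooth_in U f'" "\<And>x. x \<in> M \<Longrightarrow> f' x = f x"
    "open V" "M \<subseteq> V" "smooth_in V g'" "\<And>x. x \<in> M \<Longrightarrow> g' x = g x"
    unfolding smooth_on_altdef by metis
  then show ?thesis
    by (intro smooth_onI[of "U \<inter> V" _ "\<lambda>x. h (f' x) (g' x)"])
       (auto intro!: smooth_bilinear[OF assms(1)] intro: smooth_subset)
qed

lemma smooth_on_add:
  assumes "smooth_on M f" "smooth_on M g"
  shows "smooth_on M (\<lambda>x. f x + g x)"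
proof -
  from assms obtain U f' V g' where
    "open U" "M \<subseteq> U" "smooth_in U f'" "\<And>x. x \<in> M \<Longrightarrow> f' x = f x"
    "open V" "M \<subseteq> V" "smooth_in V g'" "\<And>x. x \<in> M \<Longrightarrow> g' x = g x"
    unfolding smooth_on_altdef by metis
  then show ?thesis
    by (intro smooth_onI[of "U \<inter> V" _ "\<lambda>x. f' x + g' x"])
       (auto intro!: smooth_add intro: smooth_subset)
qed

lemma smooth_on_linear:
  assumes "bounded_linear h" "smooth_on M f"
  shows "smooth_on M (\<lambda>x. h (f x))"
proof -
  from assms obtain U f' where
    "open U" "M \<subseteq> U" "smooth_in U f'" "\<And>x. x \<in> M \<Longrightarrow> f' x = f x"
    unfolding smooth_on_altdef by metis
  then show ?thesis
    by (intro smooth_onI[of U _ "\<lambda>x. h (f' x)"]) (auto intro!: smooth_linear[OF assms(1)])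
qed

lemma smooth_on_mult:
  fixes f g :: "'a::euclidean_space \<Rightarrow> complex"
  shows "smooth_on M f \<Longrightarrow> smooth_on M g \<Longrightarrow> smooth_on M (\<lambda>x. f x * g x)"
  by (rule smooth_on_bilinear[OF bounded_bilinear_mult])

lemma smooth_on_const: "smooth_on M (\<lambda>x. c)"
  by (rule smooth_onI[of UNIV]) (auto intro: smooth_const)

lemma smooth_on_power:
  fixes f :: "'a::euclidean_space \<Rightarrow> complex"
  shows "smooth_on M f \<Longrightarrow> smooth_on M (\<lambda>x. f x ^ n)"
  by (induction n) (auto intro: smooth_on_const smooth_on_mult)

lemma smooth_on_bounded_linear: "bounded_linear h \<Longrightarrow> smooth_on M h"
  by (rule smooth_onI[of UNIV]) (auto intro: smooth_linear smooth_ident)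

lemma smooth_on_cong: "(\<And>x. x \<in> M \<Longrightarrow> f x = g x) \<Longrightarrow> smooth_on M f \<longleftrightarrow> smooth_on M g"
  unfolding smooth_on_def by simp

lemma smooth_on_compose:
  assumes "smooth_in V h" "open V" "smooth_on M f" "f ` M \<subseteq> V"
  shows "smooth_on M (\<lambda>x. h (f x))"
proof -
  from assms obtain U f' where U:
    "open U" "M \<subseteq> U" "smooth_in U f'" "\<And>x. x \<in> M \<Longrightarrow> f' x = f x"
    unfolding smooth_on_altdef by metis
  have o: "open (f' -` V \<inter> U)"
    using U(1) assms(2) smooth_imp_continuous_on[OF U(3)] continuous_on_open_vimage by blast
  show ?thesis
    by (rule smooth_onI[OF o _ smooth_compose[OF o assms(2) _ assms(1) smooth_subset[OF U(3)]]])
       (use U assms in auto)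
qed

lemma hopf_nth:
  "hopf R p $ 1 = R * (2 * Re (fst p * cnj (snd p)))"
  "hopf R p $ 2 = R * (2 * Im (fst p * cnj (snd p)))"
  "hopf R p $ 3 = R * ((cmod (fst p))\<^sup>2 - (cmod (snd p))\<^sup>2)"
  by (simp_all add: hopf_def)

lemma S3_iff: "p \<in> S3 \<longleftrightarrow> (cmod (fst p))\<^sup>2 + (cmod (snd p))\<^sup>2 = 1"
proof -
  have "norm p = 1 \<longleftrightarrow> (norm p)\<^sup>2 = 1"
    by (metis norm_ge_zero one_power2 power2_eq_iff_nonneg zero_le_one)
  then show ?thesis by (simp add: norm_prod_def)
qed

lemma S3_iff_complex:
  "p \<in> S3 \<longleftrightarrow> fst p * cnj (fst p) + snd p * cnj (snd p) = 1"
  unfolding S3_iff complex_norm_square[symmetric] of_real_add[symmetric] of_real_eq_1_iff ..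

lemma norm_vec3: "(norm (x::real^3))\<^sup>2 = (x$1)\<^sup>2 + (x$2)\<^sup>2 + (x$3)\<^sup>2"
  by (simp add: norm_vec_def L2_set_def sum_3 power2_eq_square)

text \<open>This is \<open>(A - B)^2 + 4 A B = (A + B)^2\<close> for the squared moduli A, B of the
  two coordinates.\<close>

lemma norm_hopf: "norm (hopf R p) = \<bar>R\<bar> * (norm p)\<^sup>2"
proof -
  have "(norm (hopf R p))\<^sup>2 = R\<^sup>2 * (4 * (cmod (fst p * cnj (snd p)))\<^sup>2 + ((cmod (fst p))\<^sup>2 - (cmod (snd p))\<^sup>2)\<^sup>2)"
    unfolding norm_vec3 hopf_nth cmod_power2[of "fst p * cnj (snd p)"] by algebra
  also have "\<dots> = (\<bar>R\<bar> * (norm p)\<^sup>2)\<^sup>2"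
    unfolding norm_mult complex_mod_cnj by (simp add: norm_prod_def power2_eq_square algebra_simps)
  finally show ?thesis by (rule power2_eq_imp_eq) auto
qed

lemma hopf_in_sphere: "R > 0 \<Longrightarrow> p \<in> S3 \<Longrightarrow> hopf R p \<in> sphere 0 R"
  by (simp add: norm_hopf)

lemma hopf_nonzero: "R > 0 \<Longrightarrow> p \<in> S3 \<Longrightarrow> hopf R p \<noteq> 0"
  using hopf_in_sphere by fastforce

text \<open>The Hopf image determines the products of the coordinates with their conjugates, that
  is, the orthogonal projection onto the complex line of \<open>p\<close>. If the projections of
  \<open>p\<close> and \<open>q\<close> agree, projecting \<open>q\<close> onto its own line gives
  \<open>q = p u\<close> with \<open>u\<close> the hermitian product of \<open>p\<close> and
  \<open>q\<close>.\<close>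

lemma hopf_fibre:
  assumes "R > 0" "p \<in> S3" "q \<in> S3" "hopf R p = hopf R q"
  obtains u where "cmod u = 1" "q = circle_act p u"
proof -
  have "hopf R p $ i = hopf R q $ i" for i using assms(4) by simp
  from this[of 1] this[of 2] this[of 3] assms(1)
  have 12: "fst p * cnj (snd p) = fst q * cnj (snd q)"
    and 3: "(cmod (fst p))\<^sup>2 - (cmod (snd p))\<^sup>2 = (cmod (fst q))\<^sup>2 - (cmod (snd q))\<^sup>2"
    by (simp_all add: hopf_nth complex_eq_iff)
  from 3 assms(2,3) have n: "(cmod (fst p))\<^sup>2 = (cmod (fst q))\<^sup>2" "(cmod (snd p))\<^sup>2 = (cmod (snd q))\<^sup>2"
    unfolding S3_iff by linarith+
  then have n': "fst p * cnj (fst p) = fst q * cnj (fst q)" "snd p * cnj (snd p) = snd q * cnj (snd q)"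
    by (simp_all add: complex_norm_square[symmetric])
  have q: "fst q * cnj (fst q) + snd q * cnj (snd q) = 1" using assms(3) unfolding S3_iff_complex .
  have 21: "snd p * cnj (fst p) = snd q * cnj (fst q)"
    using arg_cong[OF 12, of cnj] by (simp add: mult.commute)
  define u where "u = cnj (fst p) * fst q + cnj (snd p) * snd q"
  have 1: "fst p * u = fst q"
  proof -
    have "fst p * u = (fst p * cnj (fst p)) * fst q + (fst p * cnj (snd p)) * snd q"
      by (simp add: u_def algebra_simps)
    also have "\<dots> = fst q * (fst q * cnj (fst q) + snd q * cnj (snd q))"
      unfolding n' 12 by (simp add: algebra_simps)
    finally show ?thesis using q by simp
  qed
  have 2: "snd p * u = snd q"
  proof -
    have "snd p * u = (snd p * cnj (fst p)) * fst q + (snd p * cnj (snd p)) * snd q"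
      by (simp add: u_def algebra_simps)
    also have "\<dots> = snd q * (fst q * cnj (fst q) + snd q * cnj (snd q))"
      unfolding n' 21 by (simp add: algebra_simps)
    finally show ?thesis using q by simp
  qed
  have "(cmod u)\<^sup>2 * ((cmod (fst p))\<^sup>2 + (cmod (snd p))\<^sup>2) = (cmod (fst p * u))\<^sup>2 + (cmod (snd p * u))\<^sup>2"
    by (simp add: norm_mult power_mult_distrib algebra_simps)
  then have "(cmod u)\<^sup>2 = 1" using assms(2,3) unfolding 1 2 S3_iff by simp
  then have "cmod u = 1" by (metis norm_ge_zero one_power2 power2_eq_iff_nonneg zero_le_one)
  with 1 2 show ?thesis by (intro that[of u]) (auto simp: circle_act_def prod_eq_iff)
qed

text \<open>Two local sections of the Hopf map, extended to be constant along rays; they are defined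
  away from the negative, respectively positive, third axis.\<close>

definition chart_N :: "real^3 \<Rightarrow> complex \<times> complex" where
  "chart_N y = (let z = (1 + y$3 * norm y powr -1) / 2 in
     (complex_of_real (z powr (1/2)),
      Complex (y$1) (- (y$2)) * complex_of_real (norm y powr -1 * (z powr (-1/2) / 2))))"

definition chart_S :: "real^3 \<Rightarrow> complex \<times> complex" where
  "chart_S y = (let z = (1 - y$3 * norm y powr -1) / 2 in
     (Complex (y$1) (y$2) * complex_of_real (norm y powr -1 * (z powr (-1/2) / 2)),
      complex_of_real (z powr (1/2))))"

definition dom_N :: "(real^3) set" where "dom_N = {y. y \<noteq> 0 \<and> - norm y < y$3}"
definition dom_S :: "(real^3) set" where "dom_S = {y. y \<noteq> 0 \<and> y$3 < norm y}"

lemma open_dom: "open dom_N" "open dom_S"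
  unfolding dom_N_def dom_S_def
  by (intro open_Collect_conj open_Collect_neq open_Collect_less continuous_intros)+

lemma dom_cover: "y \<noteq> 0 \<Longrightarrow> y \<in> dom_N \<or> y \<in> dom_S"
  unfolding dom_N_def dom_S_def using zero_less_norm_iff[of y] by (cases "y $ 3 < norm y") (auto simp del: zero_less_norm_iff)

lemma smooth_nth: "smooth_in U (\<lambda>y::real^3. y $ i)"
  unfolding smooth_in_def by (auto intro!: ktd_bounded_linear bounded_linear_vec_nth)

lemma smooth_Complex:
  assumes "open U" "smooth_in U f" "smooth_in U g"
  shows "smooth_in U (\<lambda>x. Complex (f x) (g x))"
proof -
  have "bounded_linear (\<lambda>r. \<i> * complex_of_real r)"
    by (rule bounded_linear_compose[OF bounded_linear_mult_right bounded_linear_of_real])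
  from smooth_add[OF assms(1) smooth_of_real[OF assms(1,2)] smooth_linear[OF this assms(1,3)]]
  show ?thesis by (simp add: Complex_eq)
qed

lemma smooth_chart: "smooth_in dom_N chart_N" "smooth_in dom_S chart_S"
proof -
  have pos: "0 < (1 + y$3 * norm y powr -1) / 2" if "y \<in> dom_N" for y
    using that by (simp add: dom_N_def powr_minus_divide field_simps add_pos_pos)
  have pos': "0 < (1 - y$3 * norm y powr -1) / 2" if "y \<in> dom_S" for y
    using that by (simp add: dom_S_def powr_minus_divide field_simps)
  have n: "smooth_in dom_N (\<lambda>y::real^3. norm y powr -1)" "smooth_in dom_S (\<lambda>y::real^3. norm y powr -1)"
    by (rule smooth_subset[OF smooth_norm_powr], force simp: dom_N_def dom_S_def)+
  have half: "bounded_linear (\<lambda>x::real. x / 2)" by (rule bounded_linear_divide)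
  have z: "smooth_in dom_N (\<lambda>y::real^3. (1 + y$3 * norm y powr -1) / 2)"
    by (intro smooth_linear[OF half] open_dom smooth_add smooth_mult smooth_const smooth_nth n)
  have z': "smooth_in dom_S (\<lambda>y::real^3. (1 - y$3 * norm y powr -1) / 2)"
    by (intro smooth_linear[OF half] open_dom smooth_diff smooth_mult smooth_const smooth_nth n)
  have zp: "smooth_in dom_N (\<lambda>y::real^3. ((1 + y$3 * norm y powr -1) / 2) powr a)" for a
    by (rule smooth_compose[OF open_dom(1) _ _ smooth_powr z]) (use pos in auto)
  have zp': "smooth_in dom_S (\<lambda>y::real^3. ((1 - y$3 * norm y powr -1) / 2) powr a)" for a
    by (rule smooth_compose[OF open_dom(2) _ _ smooth_powr z']) (use pos' in auto)
  have m: "smooth_in dom_N (\<lambda>y::real^3. - (y $ 2))"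
    by (intro smooth_linear[OF bounded_linear_minus[OF bounded_linear_ident]] open_dom smooth_nth)
  show "smooth_in dom_N chart_N"
    unfolding chart_N_def Let_def
    by (intro smooth_Pair open_dom smooth_of_real zp smooth_mult smooth_Complex smooth_nth m n
        smooth_linear[OF half])
  show "smooth_in dom_S chart_S"
    unfolding chart_S_def Let_def
    by (intro smooth_Pair open_dom smooth_of_real zp' smooth_mult smooth_Complex smooth_nth n
        smooth_linear[OF half])
qed

text \<open>Here \<open>s\<close> is the cosine of half the polar angle. The phase in the fibre is
  fixed by making the first coordinate real and positive, and the Hopf equations then give the
  second one.\<close>

lemma chart_N_props:
  assumes "R > 0" "y \<in> dom_N"
  shows "chart_N y \<in> S3" "hopf R (chart_N y) = (R / norm y) *\<^sub>R y"
proof -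
  define r where "r = norm y"
  have r: "r > 0" using assms by (auto simp: r_def dom_N_def)
  have r2: "r\<^sup>2 = (y$1)\<^sup>2 + (y$2)\<^sup>2 + (y$3)\<^sup>2" unfolding r_def by (rule norm_vec3)
  define z where "z = (1 + y$3 / r) / 2"
  have zpos: "z > 0" using assms r by (auto simp: z_def r_def dom_N_def field_simps)
  define s where "s = sqrt z"
  have s: "s > 0" "s\<^sup>2 = z" using zpos by (auto simp: s_def)
  have c: "chart_N y = (complex_of_real s, Complex (y$1) (- (y$2)) * complex_of_real (1 / (2 * r * s)))"
    using r zpos by (simp add: chart_N_def Let_def powr_minus_divide powr_half_sqrt s_def z_def flip: r_def)
  have y3: "y$3 = r * (2 * s\<^sup>2 - 1)" using r by (simp add: s(2) z_def field_simps)
  have cm: "(cmod (snd (chart_N y)))\<^sup>2 = 1 - s\<^sup>2"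
  proof -
    have "(cmod (snd (chart_N y)))\<^sup>2 = ((y$1)\<^sup>2 + (y$2)\<^sup>2) / (2 * r * s)\<^sup>2"
      unfolding c by (simp add: norm_mult norm_divide power_mult_distrib power_divide cmod_power2)
    also have "(y$1)\<^sup>2 + (y$2)\<^sup>2 = r\<^sup>2 - r\<^sup>2 * (2 * s\<^sup>2 - 1)\<^sup>2" using r2 unfolding y3 by (simp add: power_mult_distrib)
    also have "\<dots> / (2 * r * s)\<^sup>2 = 1 - s\<^sup>2" using r s(1) by (simp add: field_simps) algebra
    finally show ?thesis .
  qed
  show S: "chart_N y \<in> S3" using cm unfolding S3_iff by (simp add: c)
  have "hopf R (chart_N y) $ 1 = R / r * y$1" "hopf R (chart_N y) $ 2 = R / r * y$2"
    using s(1) by (simp_all add: hopf_nth c)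
  moreover have "hopf R (chart_N y) $ 3 = R / r * y$3"
    unfolding hopf_nth cm y3 using r by (simp add: c)
  ultimately show "hopf R (chart_N y) = (R / norm y) *\<^sub>R y"
    by (simp add: vec_eq_iff forall_3 r_def)
qed

lemma chart_S_props:
  assumes "R > 0" "y \<in> dom_S"
  shows "chart_S y \<in> S3" "hopf R (chart_S y) = (R / norm y) *\<^sub>R y"
proof -
  define r where "r = norm y"
  have r: "r > 0" using assms by (auto simp: r_def dom_S_def)
  have r2: "r\<^sup>2 = (y$1)\<^sup>2 + (y$2)\<^sup>2 + (y$3)\<^sup>2" unfolding r_def by (rule norm_vec3)
  define z where "z = (1 - y$3 / r) / 2"
  have zpos: "z > 0" using assms r by (auto simp: z_def r_def dom_S_def field_simps)
  define s where "s = sqrt z"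
  have s: "s > 0" "s\<^sup>2 = z" using zpos by (auto simp: s_def)
  have c: "chart_S y = (Complex (y$1) (y$2) * complex_of_real (1 / (2 * r * s)), complex_of_real s)"
    using r zpos by (simp add: chart_S_def Let_def powr_minus_divide powr_half_sqrt s_def z_def flip: r_def)
  have y3: "y$3 = r * (1 - 2 * s\<^sup>2)" using r by (simp add: s(2) z_def field_simps)
  have cm: "(cmod (fst (chart_S y)))\<^sup>2 = 1 - s\<^sup>2"
  proof -
    have "(cmod (fst (chart_S y)))\<^sup>2 = ((y$1)\<^sup>2 + (y$2)\<^sup>2) / (2 * r * s)\<^sup>2"
      unfolding c by (simp add: norm_mult norm_divide power_mult_distrib power_divide cmod_power2)
    also have "(y$1)\<^sup>2 + (y$2)\<^sup>2 = r\<^sup>2 - r\<^sup>2 * (1 - 2 * s\<^sup>2)\<^sup>2" using r2 unfolding y3 by (simp add: power_mult_distrib)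
    also have "\<dots> / (2 * r * s)\<^sup>2 = 1 - s\<^sup>2" using r s(1) by (simp add: field_simps) algebra
    finally show ?thesis .
  qed
  show S: "chart_S y \<in> S3" using cm unfolding S3_iff by (simp add: c)
  have "hopf R (chart_S y) $ 1 = R / r * y$1" "hopf R (chart_S y) $ 2 = R / r * y$2"
    using s(1) by (simp_all add: hopf_nth c)
  moreover have "hopf R (chart_S y) $ 3 = R / r * y$3"
    unfolding hopf_nth cm y3 using r by (simp add: c algebra_simps)
  ultimately show "hopf R (chart_S y) = (R / norm y) *\<^sub>R y"
    by (simp add: vec_eq_iff forall_3 r_def)
qed

lemma fibre_point:
  assumes "R > 0" "x \<in> sphere 0 R"
  shows "fibre_point R x \<in> S3" "hopf R (fibre_point R x) = x"
proof -
  have "\<exists>p. p \<in> S3 \<and> hopf R p = x"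
  proof -
    have x: "x \<noteq> 0" "(R / norm x) *\<^sub>R x = x" using assms by auto
    from dom_cover[OF x(1)] show ?thesis
      using chart_N_props[OF assms(1), of x] chart_S_props[OF assms(1), of x] x(2) by metis
  qed
  from someI_ex[OF this] show "fibre_point R x \<in> S3" "hopf R (fibre_point R x) = x"
    by (auto simp: fibre_point_def)
qed

section \<open>Functions on the sphere as circle-invariant functions on the 3-sphere\<close>

definition invariant :: "(complex \<times> complex \<Rightarrow> 'b) \<Rightarrow> bool" where
  "invariant F \<longleftrightarrow> (\<forall>p\<in>S3. \<forall>u. cmod u = 1 \<longrightarrow> F (circle_act p u) = F p)"

text \<open>For an invariant \<open>F\<close> this is the induced function on the sphere, made
  constant along rays so that it can be differentiated in the ambient space.\<close>

definition desc :: "real \<Rightarrow> (complex \<times> complex \<Rightarrow> 'b) \<Rightarrow> real^3 \<Rightarrow> 'b" where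
  "desc R F y = F (fibre_point R ((R / norm y) *\<^sub>R y))"

lemma invariant_fibre:
  assumes "R > 0" "invariant F" "p \<in> S3"
  shows "F (fibre_point R (hopf R p)) = F p"
proof -
  note h = fibre_point[OF assms(1) hopf_in_sphere[OF assms(1,3)]]
  obtain u where "cmod u = 1" "fibre_point R (hopf R p) = circle_act p u"
    using hopf_fibre[OF assms(1,3) h(1) h(2)[symmetric]] .
  with assms(2,3) show ?thesis by (simp add: invariant_def)
qed

lemma desc_hopf:
  assumes "R > 0" "invariant F" "p \<in> S3"
  shows "desc R F (hopf R p) = F p"
  using invariant_fibre[OF assms] assms by (simp add: desc_def norm_hopf)

text \<open>\<open>fibre_point\<close> is an arbitrary choice and need not even be continuous;
  invariance allows it to be replaced near each point by one of the two smooth charts.\<close>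

lemma desc_smooth:
  assumes "R > 0" "invariant F" "smooth_on S3 F"
  shows "smooth_in (- {0}) (desc R F)"
proof (rule smooth_local)
  obtain U g where g: "open U" "S3 \<subseteq> U" "smooth_in U g" "\<And>x. x \<in> S3 \<Longrightarrow> g x = F x"
    using assms(3) unfolding smooth_on_altdef by blast
  have eq: "g q = desc R F y" if "q \<in> S3" "hopf R q = (R / norm y) *\<^sub>R y" for q y
    unfolding desc_def that(2)[symmetric] using g(4) invariant_fibre[OF assms(1,2)] that(1) by simp
  have "smooth_in dom_N (desc R F)"
    by (rule smooth_cong[OF open_dom(1) _ smooth_compose[OF open_dom(1) g(1) _ g(3) smooth_chart(1)]])
       (use eq chart_N_props[OF assms(1)] g(2) in auto)
  moreover have "smooth_in dom_S (desc R F)"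
    by (rule smooth_cong[OF open_dom(2) _ smooth_compose[OF open_dom(2) g(1) _ g(3) smooth_chart(2)]])
       (use eq chart_S_props[OF assms(1)] g(2) in auto)
  ultimately show "\<exists>V. open V \<and> y \<in> V \<and> smooth_in V (desc R F)" if "y \<in> - {0}" for y
    using open_dom dom_cover[of y] that by blast
qed

lemma smooth_on_fst: "smooth_on S3 fst" and smooth_on_snd: "smooth_on S3 snd"
  by (rule smooth_on_bounded_linear, rule bounded_linear_fst bounded_linear_snd)+

lemma smooth_on_cnj:
  "smooth_on M f \<Longrightarrow> smooth_on M (\<lambda>x. cnj (f x))"
  by (rule smooth_on_linear[OF bounded_linear_cnj])

lemma hopf_altdef:
  "hopf R p = R *\<^sub>R ((2 * Re (fst p * cnj (snd p))) *\<^sub>R axis 1 1 + (2 * Im (fst p * cnj (snd p))) *\<^sub>R axis 2 1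
      + Re (fst p * cnj (fst p) - snd p * cnj (snd p)) *\<^sub>R axis 3 1)"
  unfolding hopf_def vector_3_eq_axis complex_norm_square[symmetric] by simp

lemma smooth_hopf: "smooth_on S3 (hopf R)"
proof -
  have "smooth_on S3 (\<lambda>p. R *\<^sub>R ((2 * Re (fst p * cnj (snd p))) *\<^sub>R (axis 1 1 :: real^3)
      + (2 * Im (fst p * cnj (snd p))) *\<^sub>R axis 2 1
      + Re (fst p * cnj (fst p) + (-1) * (snd p * cnj (snd p))) *\<^sub>R axis 3 1))"
    by (intro smooth_on_linear[OF bounded_linear_scaleR_right] smooth_on_add
        smooth_on_bilinear[OF bounded_bilinear_scaleR] smooth_on_const
        smooth_on_linear[OF bounded_linear_mult_right] smooth_on_mult
        smooth_on_linear[OF bounded_linear_Re] smooth_on_linear[OF bounded_linear_Im]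
        smooth_on_fst smooth_on_snd smooth_on_cnj)
  then show ?thesis unfolding hopf_altdef[abs_def] by simp
qed

lemma smooth_on_hopf_compose:
  assumes "R > 0" "smooth_on (sphere 0 R) h"
  shows "smooth_on S3 (\<lambda>p. h (hopf R p))"
proof -
  obtain U g where g: "open U" "sphere 0 R \<subseteq> U" "smooth_in U g" "\<And>x. x \<in> sphere 0 R \<Longrightarrow> g x = h x"
    using assms(2) unfolding smooth_on_altdef by blast
  have "smooth_on S3 (\<lambda>p. g (hopf R p))"
    by (rule smooth_on_compose[OF g(3,1) smooth_hopf]) (use g(2) hopf_in_sphere[OF assms(1)] in blast)
  then show ?thesis
    using smooth_on_cong[of S3 "\<lambda>p. g (hopf R p)" "\<lambda>p. h (hopf R p)"] g(4) hopf_in_sphere[OF assms(1)] by blast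
qed

lemma invariant_hopf: "invariant (\<lambda>p. h (hopf R p))"
  unfolding invariant_def
proof safe
  fix a b u :: complex assume u: "cmod u = 1"
  have "u * cnj u = 1" using u by (simp add: complex_norm_square[symmetric])
  then have "a * u * cnj (b * u) = a * cnj b" by (simp add: algebra_simps)
  then have "hopf R (circle_act (a, b) u) = hopf R (a, b)"
    unfolding hopf_def circle_act_def fst_conv snd_conv using u by (simp only: norm_mult mult_1_right)
  then show "h (hopf R (circle_act (a, b) u)) = h (hopf R (a, b))" by simp
qed

subsection \<open>Derivatives along the sphere\<close>

lemma sphere_deriv_cong:
  assumes "norm x = R" "R > 0" "\<And>y. y \<in> sphere 0 R \<Longrightarrow> h y = h' y"
  shows "sphere_deriv h x v = sphere_deriv h' x v"
proof -
  have "frechet_derivative (\<lambda>y. h ((norm x / norm y) *\<^sub>R y)) (at x) =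
        frechet_derivative (\<lambda>y. h' ((norm x / norm y) *\<^sub>R y)) (at x)"
    by (rule frechet_derivative_eq_open[of "- {0}"]) (use assms in auto)
  then show ?thesis by (simp add: sphere_deriv_def)
qed

text \<open>The derivative at \<open>x\<close> of the radial projection onto the sphere through
  \<open>x\<close> is the orthogonal projection along \<open>x\<close>, which fixes tangent
  vectors.\<close>

lemma sphere_deriv_eq:
  assumes "x \<noteq> 0" "(h has_derivative h') (at x)" "v \<bullet> x = 0"
  shows "sphere_deriv h x v = h' v"
proof -
  have d: "((\<lambda>y. (norm x / norm y) *\<^sub>R y) has_derivative (\<lambda>w. w - ((w \<bullet> x) / (norm x)\<^sup>2) *\<^sub>R x)) (at x)"
  proof -
    have n: "((\<lambda>y. norm y) has_derivative (\<lambda>w. w \<bullet> sgn x)) (at x)"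
      using has_derivative_norm[OF assms(1)] by simp
    have "((\<lambda>y. (norm x * inverse (norm y)) *\<^sub>R y) has_derivative
        (\<lambda>w. (norm x * inverse (norm x)) *\<^sub>R w
           + (norm x * - (inverse (norm x) * (w \<bullet> sgn x) * inverse (norm x))) *\<^sub>R x)) (at x)"
      by (rule has_derivative_scaleR[OF has_derivative_mult_right[OF Deriv.has_derivative_inverse[OF _ n]]
            has_derivative_ident]) (use assms(1) in simp)
    moreover have "(norm x * inverse (norm x)) *\<^sub>R w
           + (norm x * - (inverse (norm x) * (w \<bullet> sgn x) * inverse (norm x))) *\<^sub>R x
        = w - ((w \<bullet> x) / (norm x)\<^sup>2) *\<^sub>R x" for w
    proof -
      have "norm x * - (inverse (norm x) * (w \<bullet> sgn x) * inverse (norm x)) = - ((w \<bullet> x) / (norm x)\<^sup>2)"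
        using assms(1) by (simp add: sgn_div_norm power2_eq_square divide_inverse)
      moreover have "norm x * inverse (norm x) = 1" using assms(1) by simp
      ultimately show ?thesis by (simp only: scaleR_one scaleR_minus_left) simp
    qed
    ultimately have "((\<lambda>y. (norm x * inverse (norm y)) *\<^sub>R y) has_derivative
        (\<lambda>w. w - ((w \<bullet> x) / (norm x)\<^sup>2) *\<^sub>R x)) (at x)"
      by (rule has_derivative_eq_rhs[OF _ ext])
    then show ?thesis by (simp only: divide_inverse)
  qed
  have "((norm x / norm x) *\<^sub>R x) = x" using assms(1) by simp
  then have "((\<lambda>y. h ((norm x / norm y) *\<^sub>R y)) has_derivative (\<lambda>w. h' (w - ((w \<bullet> x) / (norm x)\<^sup>2) *\<^sub>R x))) (at x)"
    using has_derivative_compose[OF d, of h h'] assms(2) by simp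
  from has_derivative_imp_frechet[OF this] show ?thesis
    by (simp add: sphere_deriv_def assms(3))
qed

lemma bounded_linear_cross: "bounded_linear (cross3 u)"
proof -
  have "linear (cross3 u)" using bilinear_cross by (simp add: bilinear_def)
  then show ?thesis by (simp add: linear_conv_bounded_linear)
qed

lemma vector_field_cross: "vector_field R (cross3 u)"
  unfolding vector_field_def tangent_space_def
  by (auto intro!: smooth_on_bounded_linear bounded_linear_cross simp: dot_cross_self)

lemma cross_tangent: "cross3 u x \<in> tangent_space x"
  by (simp add: tangent_space_def dot_cross_self)

text \<open>The Jacobi identity of the cross product. The sign is the usual one: sending a vector to
  its rotation field reverses brackets.\<close>

lemma lie_bracket_cross:
  assumes "x \<noteq> 0"
  shows "lie_bracket (cross3 u) (cross3 w) x = cross3 (- cross3 u w) x"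
proof -
  have d: "sphere_deriv (cross3 a) x (cross3 b x) = cross3 a (cross3 b x)" for a b
    by (rule sphere_deriv_eq[OF assms bounded_linear_imp_has_derivative[OF bounded_linear_cross]])
       (simp add: dot_cross_self)
  show ?thesis
    unfolding lie_bracket_def d by (simp add: vec_eq_iff forall_3 cross3_def algebra_simps)
qed

section \<open>Integration over the sphere\<close>

lemma spherical_derivatives:
  "((\<lambda>t. spherical R t \<phi>) has_vector_derivative
      vector [R * cos \<theta> * cos \<phi>, R * cos \<theta> * sin \<phi>, - (R * sin \<theta>)]) (at \<theta>)"
  "((\<lambda>t. spherical R \<theta> t) has_vector_derivative
      vector [- (R * sin \<theta> * sin \<phi>), R * sin \<theta> * cos \<phi>, 0]) (at \<phi>)"
  unfolding spherical_def vector_3_eq_axis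
  by (auto intro!: derivative_eq_intros simp: mult_ac has_real_derivative_iff_has_vector_derivative[symmetric])

lemma norm_spherical: "norm (spherical R \<theta> \<phi>) = \<bar>R\<bar>"
proof -
  have "(norm (spherical R \<theta> \<phi>))\<^sup>2 = R\<^sup>2 * ((sin \<theta>)\<^sup>2 * ((cos \<phi>)\<^sup>2 + (sin \<phi>)\<^sup>2) + (cos \<theta>)\<^sup>2)"
    unfolding norm_vec3 spherical_def vector_3 by algebra
  also have "\<dots> = \<bar>R\<bar>\<^sup>2" by simp
  finally show ?thesis by (rule power2_eq_imp_eq) auto
qed

lemma spherical_surj:
  assumes "R > 0" "x \<in> sphere 0 R"
  obtains \<theta> \<phi> where "0 \<le> \<theta>" "\<theta> \<le> pi" "x = spherical R \<theta> \<phi>"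
proof -
  have n: "(x$1)\<^sup>2 + (x$2)\<^sup>2 + (x$3)\<^sup>2 = R\<^sup>2" using assms norm_vec3[of x] by simp
  have "(x$3 / R)\<^sup>2 \<le> 1" using n assms(1) by (simp add: power_divide field_simps) (smt (verit) zero_le_power2)
  then have "\<bar>x$3 / R\<bar> \<le> 1" by (simp only: abs_square_le_1)
  then have b: "-1 \<le> x$3 / R" "x$3 / R \<le> 1" by linarith+
  define \<theta> where "\<theta> = arccos (x$3 / R)"
  have th: "0 \<le> \<theta>" "\<theta> \<le> pi" "cos \<theta> = x$3 / R"
    unfolding \<theta>_def using arccos_lbound[OF b] arccos_ubound[OF b] cos_arccos[OF b] by auto
  have sn: "sin \<theta> \<ge> 0" using th by (simp add: sin_ge_zero)
  have s2: "(R * sin \<theta>)\<^sup>2 = (x$1)\<^sup>2 + (x$2)\<^sup>2"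
  proof -
    have "(R * sin \<theta>)\<^sup>2 = R\<^sup>2 - (R * cos \<theta>)\<^sup>2" by (simp add: power_mult_distrib sin_squared_eq algebra_simps)
    also have "R * cos \<theta> = x$3" using assms(1) by (simp add: th(3))
    finally show ?thesis using n by simp
  qed
  obtain \<phi> where "x$1 = R * sin \<theta> * cos \<phi>" "x$2 = R * sin \<theta> * sin \<phi>"
  proof (cases "R * sin \<theta> = 0")
    case True
    with s2 have "x$1 = 0" "x$2 = 0" by (simp_all add: sum_power2_eq_zero_iff)
    with True that[of 0] show ?thesis by simp
  next
    case False
    have "(x$1 / (R * sin \<theta>))\<^sup>2 + (x$2 / (R * sin \<theta>))\<^sup>2 = 1"
    proof -
      have "(x$1 / (R * sin \<theta>))\<^sup>2 + (x$2 / (R * sin \<theta>))\<^sup>2 = ((x$1)\<^sup>2 + (x$2)\<^sup>2) / (R * sin \<theta>)\<^sup>2"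
        by (simp only: power_divide add_divide_distrib)
      then show ?thesis unfolding s2[symmetric] using False by simp
    qed
    from sincos_total_2pi[OF this] obtain t where
      "x$1 / (R * sin \<theta>) = cos t" "x$2 / (R * sin \<theta>) = sin t" by metis
    with False that[of t] show ?thesis by (simp add: field_simps)
  qed
  then have "x = spherical R \<theta> \<phi>"
    using th(3) assms(1) by (simp add: spherical_def vec_eq_iff forall_3)
  with th that show ?thesis by blast
qed

lemma continuous_on_spherical:
  fixes A :: "'a::t2_space set"
  assumes "R > 0" "continuous_on (sphere 0 R) h" "continuous_on A f" "continuous_on A g"
  shows "continuous_on A (\<lambda>q. h (spherical R (f q) (g q)))"
proof (rule continuous_on_compose2[OF assms(2)])
  show "continuous_on A (\<lambda>q. spherical R (f q) (g q))"
    unfolding spherical_def vector_3_eq_axis by (intro continuous_intros assms)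
qed (use assms(1) norm_spherical in auto)

abbreviation angles :: "(real \<times> real) set" where
  "angles \<equiv> cbox (0, 0) (pi, 2 * pi)"

lemma continuous_on_sphere_integrand:
  assumes "R > 0" "continuous_on (sphere 0 R) h"
  shows "continuous_on A (\<lambda>q. complex_of_real (R\<^sup>2 * sin (fst q)) * h (spherical R (fst q) (snd q)))"
  by (intro continuous_intros continuous_on_spherical[OF assms])

text \<open>Passing from the open coordinate domain to the closed box makes iterated integrals and
  the fundamental theorem of calculus available for continuous integrands.\<close>

lemma sphere_integral_eq:
  assumes "R > 0" "continuous_on (sphere 0 R) h"
  shows "sphere_integral R h =
    integral angles (\<lambda>q. complex_of_real (R\<^sup>2 * sin (fst q)) * h (spherical R (fst q) (snd q)))"
proof -
  let ?f = "\<lambda>q::real \<times> real. complex_of_real (R\<^sup>2 * sin (fst q)) * h (spherical R (fst q) (snd q))"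
  have box: "{0<..<pi} \<times> {0<..<2 * pi} = box (0::real, 0::real) (pi, 2 * pi)"
    by (auto simp: box_def Basis_prod_def)
  have "set_integrable lborel angles ?f"
    unfolding set_integrable_def
    by (rule borel_integrable_compact[OF compact_cbox continuous_on_sphere_integrand[OF assms]])
  then have "set_integrable lborel (box (0::real, 0::real) (pi, 2 * pi)) ?f"
    by (rule set_integrable_subset) (auto simp: box_subset_cbox)
  from set_borel_integral_eq_integral(2)[OF this] show ?thesis
    by (simp only: sphere_integral_def box integral_open_interval)
qed

lemma integrable_sphere_integrand:
  assumes "R > 0" "continuous_on (sphere 0 R) h"
  shows "(\<lambda>q. complex_of_real (R\<^sup>2 * sin (fst q)) * h (spherical R (fst q) (snd q))) integrable_on angles"
  by (rule integrable_continuous[OF continuous_on_sphere_integrand[OF assms]])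

lemma sphere_integral_add:
  assumes "R > 0" "continuous_on (sphere 0 R) g" "continuous_on (sphere 0 R) h"
  shows "sphere_integral R (\<lambda>x. g x + h x) = sphere_integral R g + sphere_integral R h"
proof -
  have "continuous_on (sphere 0 R) (\<lambda>x. g x + h x)" by (intro continuous_intros assms)
  from sphere_integral_eq[OF assms(1) this] integral_add[OF integrable_sphere_integrand[OF assms(1,2)]
      integrable_sphere_integrand[OF assms(1,3)]]
  show ?thesis by (simp add: sphere_integral_eq[OF assms(1,2)] sphere_integral_eq[OF assms(1,3)] distrib_left)
qed

lemma sphere_integral_mult:
  assumes "R > 0" "continuous_on (sphere 0 R) h"
  shows "sphere_integral R (\<lambda>x. c * h x) = c * sphere_integral R h"
proof -
  have "continuous_on (sphere 0 R) (\<lambda>x. c * h x)" by (intro continuous_intros assms)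
  from sphere_integral_eq[OF assms(1) this] show ?thesis
    by (simp add: sphere_integral_eq[OF assms] mult.left_commute[of _ c])
qed

lemma sphere_integral_sum:
  assumes "R > 0" "\<And>i. i \<in> I \<Longrightarrow> continuous_on (sphere 0 R) (h i)" "finite I"
  shows "sphere_integral R (\<lambda>x. \<Sum>i\<in>I. h i x) = (\<Sum>i\<in>I. sphere_integral R (h i))"
  using assms(3,2)
proof (induction I rule: finite_induct)
  case empty
  show ?case by (simp add: sphere_integral_def)
next
  case (insert i I)
  then show ?case
    by (simp add: sphere_integral_add[OF assms(1)] continuous_on_sum)
qed

lemma sphere_integral_cong:
  assumes "R > 0" "\<And>x. x \<in> sphere 0 R \<Longrightarrow> g x = h x"
  shows "sphere_integral R g = sphere_integral R h"
proof -
  have "g (spherical R a b) = h (spherical R a b)" for a b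
    using assms norm_spherical[of R a b] by simp
  then show ?thesis by (simp add: sphere_integral_def)
qed

lemma sphere_integral_cnj:
  "sphere_integral R (\<lambda>x. cnj (h x)) = cnj (sphere_integral R h)"
proof -
  have "sphere_integral R (\<lambda>x. cnj (h x)) = (LINT q|lborel. cnj
     (indicator ({0<..<pi} \<times> {0<..<2 * pi}) q *\<^sub>R (complex_of_real (R\<^sup>2 * sin (fst q)) * h (spherical R (fst q) (snd q)))))"
    by (simp add: sphere_integral_def set_lebesgue_integral_def)
  then show ?thesis
    by (simp only: Bochner_Integration.integral_cnj) (simp add: sphere_integral_def set_lebesgue_integral_def)
qed

text \<open>The factor \<open>2 * pi\<^sup>2\<close> is the area of the coordinate rectangle,
  \<open>sin\<close> being estimated by 1; this crude constant is enough for the density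
  argument.\<close>

lemma sphere_integral_bound:
  assumes "R > 0" "continuous_on (sphere 0 R) h" "\<And>x. x \<in> sphere 0 R \<Longrightarrow> norm (h x) \<le> B"
  shows "norm (sphere_integral R h) \<le> R\<^sup>2 * B * (2 * pi\<^sup>2)"
proof -
  have B: "B \<ge> 0" using assms(3)[of "spherical R 0 0"] norm_spherical[of R 0 0] assms(1) norm_ge_zero order_trans by (metis (no_types, lifting) abs_of_pos dist_0_norm mem_sphere)
  have "norm (integral angles (\<lambda>q. complex_of_real (R\<^sup>2 * sin (fst q)) * h (spherical R (fst q) (snd q))))
    \<le> (R\<^sup>2 * B) * measure lborel angles"
  proof (rule has_integral_bound)
    fix q :: "real \<times> real"
    have "norm (h (spherical R (fst q) (snd q))) \<le> B"
      using assms(1) by (intro assms(3)) (simp add: norm_spherical)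
    moreover have "\<bar>R\<^sup>2 * sin (fst q)\<bar> \<le> R\<^sup>2" by (simp add: abs_mult mult_left_le)
    ultimately show "norm (complex_of_real (R\<^sup>2 * sin (fst q)) * h (spherical R (fst q) (snd q))) \<le> R\<^sup>2 * B"
      unfolding norm_mult norm_of_real by (intro mult_mono) auto
  qed (use B integrable_integral[OF integrable_sphere_integrand[OF assms(1,2)]] in auto)
  also have "measure lborel angles = 2 * pi\<^sup>2"
    by (simp add: content_Pair power2_eq_square)
  finally show ?thesis by (simp add: sphere_integral_eq[OF assms(1,2)])
qed

lemma sphere_integral_zero_imp:
  assumes "R > 0" "continuous_on (sphere 0 R) h"
    and "sphere_integral R (\<lambda>x. h x * cnj (h x)) = 0" "x \<in> sphere 0 R"
  shows "h x = 0"
proof -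
  have c: "continuous_on (sphere 0 R) (\<lambda>x. (cmod (h x))\<^sup>2)" by (intro continuous_intros assms)
  let ?g = "\<lambda>q. R\<^sup>2 * sin (fst q) * (cmod (h (spherical R (fst q) (snd q))))\<^sup>2"
  have cg: "continuous_on angles ?g"
    by (intro continuous_intros continuous_on_spherical[OF assms(1,2)])
  have "integral angles (\<lambda>q. complex_of_real (?g q)) = 0"
    using assms(3) c
    by (subst (asm) sphere_integral_eq[OF assms(1)]) (simp_all add: complex_norm_square[symmetric] del: of_real_power flip: of_real_mult)
  moreover have "integral angles (\<lambda>q. complex_of_real (?g q)) = of_real (integral angles ?g)"
    using integral_linear[OF integrable_continuous[OF cg] bounded_linear_of_real] by (simp add: o_def)
  ultimately have "integral angles ?g = 0" by simp
  then have "(?g has_integral 0) angles"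
    using integrable_integral[OF integrable_continuous[OF cg]] by simp
  note gi = this
  have z: "?g q = 0" if "q \<in> angles" for q
  proof (rule has_integral_0_cbox_imp_0[OF cg _ gi _ that])
    have "(pi / 2, pi) \<in> box (0::real, 0::real) (pi, 2 * pi)" by (simp add: box_def Basis_prod_def)
    then show "box (0::real, 0::real) (pi, 2 * pi) \<noteq> {}" by blast
    show "0 \<le> ?g q" if "q \<in> box (0::real, 0::real) (pi, 2 * pi)" for q
      using that by (cases q) (auto simp: box_def Basis_prod_def intro!: mult_nonneg_nonneg sin_ge_zero)
  qed
  have z': "h (spherical R \<theta> \<phi>) = 0" if "\<theta> \<in> {0<..<pi}" "\<phi> \<in> {0..2*pi}" for \<theta> \<phi>
    using z[of "(\<theta>, \<phi>)"] that assms(1) sin_gt_zero[of \<theta>] by auto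
  obtain \<theta> \<phi>0 where \<theta>: "0 \<le> \<theta>" "\<theta> \<le> pi" "x = spherical R \<theta> \<phi>0"
    using spherical_surj[OF assms(1,4)] .
  obtain \<phi> where \<phi>: "\<phi> \<in> {0..2*pi}" "sin \<phi>0 = sin \<phi>" "cos \<phi>0 = cos \<phi>"
    using sincos_total_2pi[of "cos \<phi>0" "sin \<phi>0"] by (metis atLeastAtMost_iff less_imp_le sin_cos_squared_add3 add.commute power2_eq_square)
  have x: "x = spherical R \<theta> \<phi>" using \<theta>(3) \<phi> by (simp add: spherical_def)
  \<comment> \<open>At the poles the weight \<open>sin \<theta>\<close> vanishes and gives no
    information, so these points are reached by continuity along a meridian.\<close>
  have "continuous_on {0..pi} (\<lambda>t. h (spherical R t \<phi>))"
    by (intro continuous_on_spherical[OF assms(1,2)] continuous_intros)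
  moreover have "closure {0<..<pi} = {0..pi}" by (simp add: closure_greaterThanLessThan)
  ultimately have "h (spherical R \<theta> \<phi>) = 0"
    using continuous_constant_on_closure[of "{0<..<pi}" "\<lambda>t. h (spherical R t \<phi>)" 0 \<theta>] z' \<phi>(1) \<theta> by auto
  then show ?thesis by (simp add: x)
qed

lemma integral_exp_int:
  assumes "k \<noteq> 0"
  shows "integral {0..2 * pi} (\<lambda>t. exp (\<i> * of_int k * complex_of_real t)) = 0"
proof -
  let ?F = "\<lambda>t. exp (\<i> * of_int k * complex_of_real t) / (\<i> * of_int k)"
  have "(?F has_vector_derivative exp (\<i> * of_int k * complex_of_real t)) (at t within {0..2*pi})" for t
  proof -
    have "((\<lambda>z. exp (\<i> * of_int k * z) / (\<i> * of_int k)) has_field_derivative exp (\<i> * of_int k * z)) (at z)" for z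
      using assms by (auto intro!: derivative_eq_intros)
    from has_vector_derivative_real_field[OF this[of "complex_of_real t"]]
    show ?thesis by (simp add: has_vector_derivative_at_within)
  qed
  then have "((\<lambda>t. exp (\<i> * of_int k * complex_of_real t)) has_integral ?F (2 * pi) - ?F 0) {0..2*pi}"
    by (intro fundamental_theorem_of_calculus) auto
  moreover have "exp (\<i> * of_int k * complex_of_real (2 * pi)) = 1"
    using exp_integer_2pi[of "of_int k"] by (simp add: mult_ac)
  ultimately show ?thesis by (simp add: integral_unique)
qed

text \<open>Orthogonality of different weights of the rotations about the third axis.\<close>

lemma sphere_integral_weight:
  assumes "R > 0" "continuous_on (sphere 0 R) h" "k \<noteq> 0"
    and "\<And>\<theta> \<phi>. h (spherical R \<theta> \<phi>) = H \<theta> * exp (\<i> * of_int k * complex_of_real \<phi>)"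
  shows "sphere_integral R h = 0"
proof -
  let ?f = "\<lambda>q. complex_of_real (R\<^sup>2 * sin (fst q)) * h (spherical R (fst q) (snd q))"
  have "integral angles ?f = integral (cbox 0 pi) (\<lambda>\<theta>. integral (cbox 0 (2 * pi)) (\<lambda>\<phi>. ?f (\<theta>, \<phi>)))"
    by (rule integral_prod_continuous[OF continuous_on_sphere_integrand[OF assms(1,2)]])
  also have "\<dots> = 0"
    by (simp add: assms(4) integral_exp_int[OF assms(3)] flip: mult.assoc)
  finally show ?thesis by (simp add: sphere_integral_eq[OF assms(1,2)])
qed

text \<open>In spherical coordinates \<open>sin \<theta>\<close> times the
  derivative along \<open>x \<mapsto> u \<times> x\<close> is the divergence of a vector field that vanishes
  for \<open>sin \<theta> = 0\<close> in the first component and is periodic in the second.\<close>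

lemma sphere_integral_rotation:
  assumes "R > 0" "smooth_in (- {0}) \<Phi>"
  shows "sphere_integral R (\<lambda>x. frechet_derivative \<Phi> (at x) (cross3 u x)) = 0"
proof -
  let ?D = "\<lambda>x. frechet_derivative \<Phi> (at x)"
  have nz: "spherical R \<theta> \<phi> \<noteq> 0" for \<theta> \<phi>
    using assms(1) norm_spherical[of R \<theta> \<phi>] by auto
  have D: "(\<Phi> has_derivative ?D (spherical R \<theta> \<phi>)) (at (spherical R \<theta> \<phi>))" for \<theta> \<phi>
    using smooth_imp_has_derivative[OF assms(2)] nz by simp
  have lin: "linear (?D (spherical R \<theta> \<phi>))" for \<theta> \<phi> by (rule has_derivative_linear[OF D])
  \<comment> \<open>\<open>A\<close> and \<open>B\<close> are the components of the rotation field
    along the two coordinate fields, multiplied by \<open>sin \<theta>\<close>. \<open>A'\<close> is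
    both the \<theta>-derivative of \<open>A\<close> and minus the \<phi>-derivative of
    \<open>B\<close>; hence the terms without derivatives of \<open>h\<close> cancel in
    \<open>G1 + G2\<close>.\<close>
  define A where "A \<theta> \<phi> = sin \<theta> * (- (u$1) * sin \<phi> + u$2 * cos \<phi>)" for \<theta> \<phi>
  define A' where "A' \<theta> \<phi> = cos \<theta> * (- (u$1) * sin \<phi> + u$2 * cos \<phi>)" for \<theta> \<phi>
  define B where "B \<theta> \<phi> = - cos \<theta> * (u$1 * cos \<phi> + u$2 * sin \<phi>) + u$3 * sin \<theta>" for \<theta> \<phi>
  define T where "T \<theta> \<phi> = (vector [R * cos \<theta> * cos \<phi>, R * cos \<theta> * sin \<phi>, - (R * sin \<theta>)] :: real^3)" for \<theta> \<phi>
  define P where "P \<theta> \<phi> = (vector [- (R * sin \<theta> * sin \<phi>), R * sin \<theta> * cos \<phi>, 0] :: real^3)" for \<theta> \<phi>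
  define h where "h \<theta> \<phi> = \<Phi> (spherical R \<theta> \<phi>)" for \<theta> \<phi>
  have h1: "((\<lambda>t. h t \<phi>) has_vector_derivative ?D (spherical R \<theta> \<phi>) (T \<theta> \<phi>)) (at \<theta>)" for \<theta> \<phi>
    using vector_derivative_diff_chain_within[of "\<lambda>t. spherical R t \<phi>" "T \<theta> \<phi>" \<theta> UNIV \<Phi>] D spherical_derivatives(1)
    by (auto simp: h_def T_def o_def intro: has_derivative_at_withinI)
  have h2: "((\<lambda>t. h \<theta> t) has_vector_derivative ?D (spherical R \<theta> \<phi>) (P \<theta> \<phi>)) (at \<phi>)" for \<theta> \<phi>
    using vector_derivative_diff_chain_within[of "\<lambda>t. spherical R \<theta> t" "P \<theta> \<phi>" \<phi> UNIV \<Phi>] D spherical_derivatives(2)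
    by (auto simp: h_def P_def o_def intro: has_derivative_at_withinI)
  have F1: "((\<lambda>t. A t \<phi> *\<^sub>R h t \<phi>) has_vector_derivative A \<theta> \<phi> *\<^sub>R ?D (spherical R \<theta> \<phi>) (T \<theta> \<phi>) + A' \<theta> \<phi> *\<^sub>R h \<theta> \<phi>) (at \<theta>)"
    for \<theta> \<phi>
    by (rule has_vector_derivative_scaleR[OF _ h1])
       (auto simp: A_def A'_def intro!: derivative_eq_intros)
  have F2: "((\<lambda>t. B \<theta> t *\<^sub>R h \<theta> t) has_vector_derivative B \<theta> \<phi> *\<^sub>R ?D (spherical R \<theta> \<phi>) (P \<theta> \<phi>) + (- A' \<theta> \<phi>) *\<^sub>R h \<theta> \<phi>) (at \<phi>)"
    for \<theta> \<phi>
    by (rule has_vector_derivative_scaleR[OF _ h2])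
       (auto simp: B_def A'_def intro!: derivative_eq_intros simp: algebra_simps)
  have comb: "A \<theta> \<phi> *\<^sub>R T \<theta> \<phi> + B \<theta> \<phi> *\<^sub>R P \<theta> \<phi> = sin \<theta> *\<^sub>R cross3 u (spherical R \<theta> \<phi>)" for \<theta> \<phi>
  proof -
    have "(sin \<phi>)\<^sup>2 + (cos \<phi>)\<^sup>2 = 1" by simp
    then show ?thesis
      unfolding vec_eq_iff forall_3 vector_add_component vector_scaleR_component A_def T_def B_def P_def spherical_def cross3_def vector_3 real_scaleR_def
      by algebra
  qed
  have cD: "continuous_on UNIV (\<lambda>q. ?D (spherical R (fst q) (snd q)) (v q))"
    if "continuous_on UNIV v" for v :: "real \<times> real \<Rightarrow> real^3"
  proof -
    have e: "?D (spherical R a b) w = (\<Sum>i\<in>Basis. (w \<bullet> i) *\<^sub>R ?D (spherical R a b) i)" for a b w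
    proof -
      have "?D (spherical R a b) w = ?D (spherical R a b) (\<Sum>i\<in>Basis. (w \<bullet> i) *\<^sub>R i)"
        by (simp only: euclidean_representation)
      also have "\<dots> = (\<Sum>i\<in>Basis. (w \<bullet> i) *\<^sub>R ?D (spherical R a b) i)"
        by (simp only: linear_sum[OF lin] linear_scale[OF lin])
      finally show ?thesis .
    qed
    have "continuous_on (sphere 0 R) (\<lambda>x. ?D x i)" for i
      using smooth_imp_continuous_on[OF smooth_frechet_derivative[OF assms(2)]]
      by (rule continuous_on_subset) (use assms(1) in auto)
    then have "continuous_on UNIV (\<lambda>q. \<Sum>i\<in>Basis. (v q \<bullet> i) *\<^sub>R ?D (spherical R (fst q) (snd q)) i)"
      by (intro continuous_intros that continuous_on_spherical[OF assms(1)])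
    then show ?thesis by (subst e)
  qed
  have ch: "continuous_on UNIV (\<lambda>q. h (fst q) (snd q))"
    unfolding h_def
    by (rule continuous_on_spherical[OF assms(1) continuous_on_subset[OF smooth_imp_continuous_on[OF assms(2)]]])
       (use assms(1) in \<open>auto intro: continuous_intros\<close>)
  define G1 where "G1 q = A (fst q) (snd q) *\<^sub>R ?D (spherical R (fst q) (snd q)) (T (fst q) (snd q))
      + A' (fst q) (snd q) *\<^sub>R h (fst q) (snd q)" for q
  define G2 where "G2 q = B (fst q) (snd q) *\<^sub>R ?D (spherical R (fst q) (snd q)) (P (fst q) (snd q))
      + (- A' (fst q) (snd q)) *\<^sub>R h (fst q) (snd q)" for q
  have c1: "continuous_on UNIV G1" unfolding G1_def A_def A'_def
    by (intro continuous_intros ch cD) (auto simp: T_def vector_3_eq_axis intro!: continuous_intros)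
  have c2: "continuous_on UNIV G2" unfolding G2_def B_def A'_def
    by (intro continuous_intros ch cD) (auto simp: P_def vector_3_eq_axis intro!: continuous_intros)
  note c12 = continuous_on_subset[OF c1 subset_UNIV] continuous_on_subset[OF c2 subset_UNIV]
  have G: "sin (fst q) *\<^sub>R ?D (spherical R (fst q) (snd q)) (cross3 u (spherical R (fst q) (snd q))) = G1 q + G2 q" for q
  proof -
    note l = lin[of "fst q" "snd q"]
    have "G1 q + G2 q = ?D (spherical R (fst q) (snd q)) (A (fst q) (snd q) *\<^sub>R T (fst q) (snd q) + B (fst q) (snd q) *\<^sub>R P (fst q) (snd q))"
      by (simp add: G1_def G2_def linear_add[OF l] linear_scale[OF l])
    then show ?thesis by (simp only: comb linear_scale[OF l])
  qed
  have "integral angles G1 = integral (cbox 0 pi) (\<lambda>\<theta>. integral (cbox 0 (2 * pi)) (\<lambda>\<phi>. G1 (\<theta>, \<phi>)))"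
    by (rule integral_prod_continuous[OF c12(1)])
  also have "\<dots> = integral (cbox 0 (2 * pi)) (\<lambda>\<phi>. integral (cbox 0 pi) (\<lambda>\<theta>. G1 (\<theta>, \<phi>)))"
    by (rule integral_swap_continuous) (simp add: case_prod_beta c12(1))
  also have "(\<lambda>\<phi>. integral (cbox 0 pi) (\<lambda>\<theta>. G1 (\<theta>, \<phi>))) = (\<lambda>\<phi>. 0)"
  proof
    fix \<phi>
    have "((\<lambda>\<theta>. G1 (\<theta>, \<phi>)) has_integral A pi \<phi> *\<^sub>R h pi \<phi> - A 0 \<phi> *\<^sub>R h 0 \<phi>) {0..pi}"
      unfolding G1_def fst_conv snd_conv
      by (intro fundamental_theorem_of_calculus has_vector_derivative_at_within[OF F1]) auto
    then show "integral (cbox 0 pi) (\<lambda>\<theta>. G1 (\<theta>, \<phi>)) = 0" by (simp add: A_def integral_unique)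
  qed
  finally have I1: "integral angles G1 = 0" by simp
  have "integral angles G2 = integral (cbox 0 pi) (\<lambda>\<theta>. integral (cbox 0 (2 * pi)) (\<lambda>\<phi>. G2 (\<theta>, \<phi>)))"
    by (rule integral_prod_continuous[OF c12(2)])
  also have "(\<lambda>\<theta>. integral (cbox 0 (2 * pi)) (\<lambda>\<phi>. G2 (\<theta>, \<phi>))) = (\<lambda>\<theta>. 0)"
  proof
    fix \<theta>
    have "((\<lambda>\<phi>. G2 (\<theta>, \<phi>)) has_integral B \<theta> (2*pi) *\<^sub>R h \<theta> (2*pi) - B \<theta> 0 *\<^sub>R h \<theta> 0) {0..2*pi}"
      unfolding G2_def fst_conv snd_conv
      by (intro fundamental_theorem_of_calculus has_vector_derivative_at_within[OF F2]) auto
    then show "integral (cbox 0 (2 * pi)) (\<lambda>\<phi>. G2 (\<theta>, \<phi>)) = 0"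
      by (simp add: B_def h_def spherical_def integral_unique)
  qed
  finally have I2: "integral angles G2 = 0" by simp
  have "continuous_on (- {0}) (\<lambda>x. \<Sum>i\<in>Basis. (cross3 u x \<bullet> i) *\<^sub>R ?D x i)"
    by (intro continuous_intros continuous_on_cross smooth_imp_continuous_on[OF smooth_frechet_derivative[OF assms(2)]])
  moreover have "(\<Sum>i\<in>Basis. (cross3 u x \<bullet> i) *\<^sub>R ?D x i) = ?D x (cross3 u x)" if "x \<in> - {0}" for x
  proof -
    have l: "linear (?D x)" by (rule has_derivative_linear[OF smooth_imp_has_derivative[OF assms(2) that]])
    have "?D x (cross3 u x) = ?D x (\<Sum>i\<in>Basis. (cross3 u x \<bullet> i) *\<^sub>R i)" by (simp only: euclidean_representation)
    then show ?thesis by (simp only: linear_sum[OF l] linear_scale[OF l])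
  qed
  ultimately have "continuous_on (- {0}) (\<lambda>x. ?D x (cross3 u x))"
    using continuous_on_cong by (metis (no_types, lifting))
  then have "continuous_on (sphere 0 R) (\<lambda>x. ?D x (cross3 u x))"
    by (rule continuous_on_subset) (use assms(1) in auto)
  from sphere_integral_eq[OF assms(1) this]
  have "sphere_integral R (\<lambda>x. ?D x (cross3 u x)) = integral angles (\<lambda>q. of_real (R\<^sup>2) * (G1 q + G2 q))"
    by (simp add: G[symmetric] scaleR_conv_of_real mult.assoc)
  also have "\<dots> = of_real (R\<^sup>2) * (integral angles G1 + integral angles G2)"
    by (subst integral_mult_right) (simp add: integral_add integrable_continuous c12)
  finally show ?thesis by (simp add: I1 I2)
qed

subsection \<open>Orthonormal frames of the tangent spaces\<close>

lemma tangent_onb_props: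
  "pairwise orthogonal (tangent_onb x)" "\<forall>b\<in>tangent_onb x. norm b = 1"
  "span (tangent_onb x) = tangent_space x" "finite (tangent_onb x)"
proof -
  have "subspace (tangent_space x)"
    unfolding tangent_space_def subspace_def by (auto simp: inner_add_left)
  from orthonormal_basis_subspace[OF this]
  have "\<exists>B. pairwise orthogonal B \<and> (\<forall>b\<in>B. norm b = 1) \<and> span B = tangent_space x" by metis
  from someI_ex[OF this]
  show p: "pairwise orthogonal (tangent_onb x)" "\<forall>b\<in>tangent_onb x. norm b = 1"
    "span (tangent_onb x) = tangent_space x"
    by (auto simp: tangent_onb_def)
  have "0 \<notin> tangent_onb x" using p(2) by auto
  from pairwise_orthogonal_independent[OF p(1) this] show "finite (tangent_onb x)"
    by (rule independent_imp_finite)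
qed

text \<open>The vectors \<open>cross3 (axis i 1) x\<close> form a tight frame of the tangent space
  with frame constant the squared norm of \<open>x\<close>. This trades the arbitrary orthonormal
  basis at each point for three global vector fields.\<close>

lemma tangent_onb_sum:
  fixes \<alpha> \<beta> :: "real^3 \<Rightarrow> complex"
  assumes "x \<noteq> 0"
    and \<alpha>: "\<And>v w a b. v \<in> tangent_space x \<Longrightarrow> w \<in> tangent_space x \<Longrightarrow>
      \<alpha> (a *\<^sub>R v + b *\<^sub>R w) = of_real a * \<alpha> v + of_real b * \<alpha> w"
    and \<beta>: "\<And>v w a b. v \<in> tangent_space x \<Longrightarrow> w \<in> tangent_space x \<Longrightarrow>
      \<beta> (a *\<^sub>R v + b *\<^sub>R w) = of_real a * \<beta> v + of_real b * \<beta> w"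
  shows "(\<Sum>i\<in>UNIV. \<alpha> (cross3 (axis i 1) x) * cnj (\<beta> (cross3 (axis i 1) x)))
      = of_real ((norm x)\<^sup>2) * (\<Sum>e\<in>tangent_onb x. \<alpha> e * cnj (\<beta> e))"
proof -
  define E where "E = tangent_onb x"
  note E = tangent_onb_props[of x, folded E_def]
  have Et: "e \<in> tangent_space x" if "e \<in> E" for e using E(3) that span_base by metis
  have T0: "0 \<in> tangent_space x" by (simp add: tangent_space_def)
  \<comment> \<open>The forms are linear on the tangent space only, so every partial sum must be
    shown to be tangent before linearity is used.\<close>
  have exp: "\<gamma> v = (\<Sum>e\<in>E. of_real (v \<bullet> e) * \<gamma> e)"
    if "v \<in> tangent_space x" and \<gamma>: "\<And>v w a b. v \<in> tangent_space x \<Longrightarrow> w \<in> tangent_space x \<Longrightarrow>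
      \<gamma> (a *\<^sub>R v + b *\<^sub>R w) = of_real a * \<gamma> v + of_real b * \<gamma> w" for v and \<gamma> :: "real^3 \<Rightarrow> complex"
  proof -
    have "(\<Sum>e\<in>F. c e *\<^sub>R e) \<in> tangent_space x \<and> \<gamma> (\<Sum>e\<in>F. c e *\<^sub>R e) = (\<Sum>e\<in>F. of_real (c e) * \<gamma> e)"
      if "finite F" "F \<subseteq> E" for F c
      using that
    proof (induction F rule: finite_induct)
      case empty
      then show ?case using \<gamma>[of 0 0 0 0] T0 by simp
    next
      case (insert e F)
      then have "(\<Sum>e\<in>insert e F. c e *\<^sub>R e) = c e *\<^sub>R e + 1 *\<^sub>R (\<Sum>e\<in>F. c e *\<^sub>R e)" by simp
      moreover have "c e *\<^sub>R e + 1 *\<^sub>R (\<Sum>e\<in>F. c e *\<^sub>R e) \<in> tangent_space x"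
        using insert Et by (auto simp: tangent_space_def inner_add_left)
      ultimately show ?case using insert \<gamma>[of e "\<Sum>e\<in>F. c e *\<^sub>R e" "c e" 1] Et by auto
    qed
    from this[OF E(4) subset_refl, of "\<lambda>e. v \<bullet> e"] show ?thesis
      using orthonormal_basis_expand[OF E(1) _ _ E(4), of v] E(2,3) that(1) by auto
  qed
  have d: "(\<Sum>i\<in>UNIV. of_real (cross3 (axis i 1) x \<bullet> e) * of_real (cross3 (axis i 1) x \<bullet> e'))
      = complex_of_real (if e = e' then (norm x)\<^sup>2 else 0)" if "e \<in> E" "e' \<in> E" for e e'
  proof -
    have "(\<Sum>i\<in>UNIV. (cross3 (axis i 1) x \<bullet> e) * (cross3 (axis i 1) x \<bullet> e')) =
        (x \<bullet> x) * (e \<bullet> e') - (x \<bullet> e) * (x \<bullet> e')"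
      by (simp add: sum_3 cross3_def inner_vec_def axis_def algebra_simps)
    also have "x \<bullet> e = 0" using Et[OF that(1)] by (simp add: tangent_space_def inner_commute)
    also have "e \<bullet> e' = (if e = e' then 1 else 0)"
      using E(1,2) that by (auto simp: pairwise_def orthogonal_def dot_square_norm)
    finally show ?thesis by (simp add: dot_square_norm flip: of_real_mult of_real_sum)
  qed
  have "(\<Sum>i\<in>UNIV. \<alpha> (cross3 (axis i 1) x) * cnj (\<beta> (cross3 (axis i 1) x)))
      = (\<Sum>i\<in>UNIV. (\<Sum>e\<in>E. of_real (cross3 (axis i 1) x \<bullet> e) * \<alpha> e) * cnj (\<Sum>e\<in>E. of_real (cross3 (axis i 1) x \<bullet> e) * \<beta> e))"
    using exp[OF cross_tangent \<alpha>] exp[OF cross_tangent \<beta>] by simp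
  also have "\<dots> = (\<Sum>i\<in>UNIV. \<Sum>e\<in>E. \<Sum>e'\<in>E. (of_real (cross3 (axis i 1) x \<bullet> e) * of_real (cross3 (axis i 1) x \<bullet> e')) * (\<alpha> e * cnj (\<beta> e')))"
    by (simp add: sum_product mult_ac)
  also have "\<dots> = (\<Sum>e\<in>E. \<Sum>e'\<in>E. \<Sum>i\<in>UNIV. (of_real (cross3 (axis i 1) x \<bullet> e) * of_real (cross3 (axis i 1) x \<bullet> e')) * (\<alpha> e * cnj (\<beta> e')))"
    by (subst sum.swap, rule sum.cong[OF refl], rule sum.swap)
  also have "\<dots> = (\<Sum>e\<in>E. \<Sum>e'\<in>E. of_real (if e = e' then (norm x)\<^sup>2 else 0) * (\<alpha> e * cnj (\<beta> e')))"
    by (intro sum.cong refl) (simp only: sum_distrib_right[symmetric] d)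
  also have "\<dots> = (\<Sum>e\<in>E. of_real ((norm x)\<^sup>2) * (\<alpha> e * cnj (\<beta> e)))"
    by (intro sum.cong refl) (simp add: if_distrib[of of_real] if_distrib[of "\<lambda>x. x * _"] E(4) cong: if_cong)
  finally show ?thesis by (simp add: sum_distrib_left E_def)
qed

section \<open>Closed one-forms on punctured space are exact\<close>

lemma linear_euclidean_expand:
  assumes "linear f"
  shows "f w = (\<Sum>i\<in>Basis. (w \<bullet> i) *\<^sub>R f i)"
proof -
  have "f w = f (\<Sum>i\<in>Basis. (w \<bullet> i) *\<^sub>R i)" by (simp only: euclidean_representation)
  then show ?thesis by (simp only: linear_sum[OF assms] linear_scale[OF assms])
qed

lemma continuous_on_frechet_derivative:
  assumes "smooth_in U f" "continuous_on S g" "g ` S \<subseteq> U" "continuous_on S v"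
  shows "continuous_on S (\<lambda>s. frechet_derivative f (at (g s)) (v s))"
proof -
  have "continuous_on S (\<lambda>s. \<Sum>i\<in>Basis. (v s \<bullet> i) *\<^sub>R frechet_derivative f (at (g s)) i)"
    using continuous_on_compose2[OF smooth_imp_continuous_on[OF smooth_frechet_derivative[OF assms(1)]] assms(2,3)]
    by (intro continuous_intros assms)
  moreover have "(\<Sum>i\<in>Basis. (v s \<bullet> i) *\<^sub>R frechet_derivative f (at (g s)) i) = frechet_derivative f (at (g s)) (v s)"
    if "s \<in> S" for s
    using linear_euclidean_expand[OF has_derivative_linear[OF smooth_imp_has_derivative[OF assms(1)]], of "g s" "v s"]
      assms(3) that by auto
  ultimately show ?thesis by (simp cong: continuous_on_cong)
qed

text \<open>The primitive is the integral of \<open>A\<close> along the segment from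
  \<open>c\<close>. In its gradient, symmetry moves the derivative of \<open>A\<close> onto the
  direction \<open>x - c\<close>, so that the integrand \<open>g x t\<close> becomes the
  \<open>t\<close>-derivative of \<open>t *\<^sub>R A (c + t *\<^sub>R (x - c))\<close>.\<close>

lemma poincare_star:
  fixes A :: "'a::euclidean_space \<Rightarrow> 'a"
  assumes U: "open U" and star: "\<And>y t. y \<in> U \<Longrightarrow> 0 \<le> t \<Longrightarrow> t \<le> 1 \<Longrightarrow> c + t *\<^sub>R (y - c) \<in> U"
    and A: "smooth_in U A"
    and sym: "\<And>y v w. y \<in> U \<Longrightarrow> frechet_derivative A (at y) v \<bullet> w = frechet_derivative A (at y) w \<bullet> v"
  obtains h where "\<And>y. y \<in> U \<Longrightarrow> (h has_derivative (\<lambda>w. A y \<bullet> w)) (at y)"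
proof -
  define D where "D y = frechet_derivative A (at y)" for y
  have D: "(A has_derivative D y) (at y)" if "y \<in> U" for y
    unfolding D_def by (rule smooth_imp_has_derivative[OF A that])
  define f where "f x t = A (c + t *\<^sub>R (x - c)) \<bullet> (x - c)" for x and t :: real
  define g where "g x t = t *\<^sub>R D (c + t *\<^sub>R (x - c)) (x - c) + A (c + t *\<^sub>R (x - c))" for x and t :: real
  have cg: "continuous_on (V \<times> {0..1}) (\<lambda>(x, t). g x t)" if "V \<subseteq> U" for V
    unfolding g_def D_def case_prod_beta using that star
    by (intro continuous_intros continuous_on_frechet_derivative[OF A]
        continuous_on_compose2[OF smooth_imp_continuous_on[OF A]]) auto
  have main: "((\<lambda>x. integral (cbox 0 1) (f x)) has_derivative (\<lambda>w. A x0 \<bullet> w)) (at x0)" if x0: "x0 \<in> U" for x0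
  proof -
    obtain e where e: "e > 0" "ball x0 e \<subseteq> U" using U x0 open_contains_ball by blast
    let ?B = "ball x0 e"
    have d: "((\<lambda>x. f x t) has_derivative blinfun_apply (blinfun_inner_right (g x t))) (at x within ?B)"
      if "x \<in> ?B" "t \<in> cbox 0 1" for x t
    proof -
      let ?z = "c + t *\<^sub>R (x - c)"
      have z: "?z \<in> U" using star that e by auto
      have "((\<lambda>x. c + t *\<^sub>R (x - c)) has_derivative (\<lambda>w. t *\<^sub>R w)) (at x)"
        by (auto intro!: derivative_eq_intros)
      from has_derivative_compose[OF this D[OF z]]
      have "((\<lambda>x. A (c + t *\<^sub>R (x - c))) has_derivative (\<lambda>w. D ?z (t *\<^sub>R w))) (at x)" .
      moreover have "((\<lambda>x. x - c) has_derivative (\<lambda>w. w)) (at x)"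
        by (auto intro!: derivative_eq_intros)
      ultimately have "((\<lambda>x. f x t) has_derivative (\<lambda>w. A ?z \<bullet> w + D ?z (t *\<^sub>R w) \<bullet> (x - c))) (at x)"
        unfolding f_def by (rule has_derivative_inner)
      moreover have "A ?z \<bullet> w + D ?z (t *\<^sub>R w) \<bullet> (x - c) = blinfun_apply (blinfun_inner_right (g x t)) w" for w
        using sym[OF z, of w "x - c"]
        by (simp add: g_def inner_add_left linear_scale[OF has_derivative_linear[OF D[OF z]]]) (simp add: D_def)
      ultimately have "((\<lambda>x. f x t) has_derivative blinfun_apply (blinfun_inner_right (g x t))) (at x)"
        by (rule has_derivative_eq_rhs[OF _ ext])
      then show ?thesis by (rule has_derivative_at_withinI)
    qed
    have "continuous_on {0..1} (f x)" if "x \<in> ?B" for x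
      unfolding f_def using that e star
      by (intro continuous_intros continuous_on_compose2[OF smooth_imp_continuous_on[OF A]]) auto
    then have i: "f x integrable_on cbox 0 1" if "x \<in> ?B" for x
      using integrable_continuous_real[of 0 1 "f x"] that by simp
    have "continuous_on (?B \<times> cbox 0 1) (\<lambda>q. blinfun_inner_right ((\<lambda>(x, t). g x t) q))"
      by (rule bounded_linear.continuous_on[OF bounded_linear_blinfun_inner_right]) (use cg[OF e(2)] in simp)
    then have c': "continuous_on (?B \<times> cbox 0 1) (\<lambda>(x, t). blinfun_inner_right (g x t))"
      by (simp add: case_prod_beta)
    have F: "((\<lambda>x. integral (cbox 0 1) (f x)) has_derivative
        integral (cbox 0 1) (\<lambda>t. blinfun_inner_right (g x0 t))) (at x0 within ?B)"
      by (rule leibniz_rule[OF d i c']) (use e in auto)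
    have "(g x0 has_integral A x0) {0..1}"
    proof -
      have "((\<lambda>t. t *\<^sub>R A (c + t *\<^sub>R (x0 - c))) has_vector_derivative g x0 t) (at t within {0..1})"
        if "t \<in> {0..1}" for t
      proof -
        let ?z = "c + t *\<^sub>R (x0 - c)"
        have z: "?z \<in> U" using star that x0 by auto
        have "((\<lambda>t. c + t *\<^sub>R (x0 - c)) has_vector_derivative (x0 - c)) (at t within {0..1})"
          by (auto intro!: derivative_eq_intros)
        from vector_derivative_diff_chain_within[OF this has_derivative_at_withinI[OF D[OF z]]]
        have "((\<lambda>t. A (c + t *\<^sub>R (x0 - c))) has_vector_derivative D ?z (x0 - c)) (at t within {0..1})"
          by (simp add: o_def)
        from has_vector_derivative_scaleR[OF DERIV_ident this] show ?thesis
          by (simp add: g_def)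
      qed
      then have "(g x0 has_integral 1 *\<^sub>R A (c + 1 *\<^sub>R (x0 - c)) - 0 *\<^sub>R A (c + 0 *\<^sub>R (x0 - c))) {0..1}"
        by (intro fundamental_theorem_of_calculus) auto
      then show ?thesis by simp
    qed
    from has_integral_linear[OF this bounded_linear_blinfun_inner_right]
    have "((\<lambda>t. blinfun_inner_right (g x0 t)) has_integral blinfun_inner_right (A x0)) (cbox 0 1)"
      by (simp add: o_def)
    note I = integral_unique[OF this]
    have "at x0 within ?B = at x0" by (rule at_within_open) (use e in auto)
    with F[unfolded I] have "((\<lambda>x. integral (cbox 0 1) (f x)) has_derivative blinfun_apply (blinfun_inner_right (A x0))) (at x0)"
      by argo
    then show ?thesis unfolding blinfun_inner_right.rep_eq .
  qed
  show ?thesis by (rule that[OF main])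
qed

text \<open>Removing the lower or the upper closed half of the third axis leaves a set that is
  star-shaped about the unit point on the other half. The two sets cover punctured space, and they
  meet in the complement of the axis, which is connected; so the two primitives differ there by a
  constant.\<close>

lemma poincare_R3:
  fixes A :: "real^3 \<Rightarrow> real^3"
  assumes A: "smooth_in (- {0}) A"
    and sym: "\<And>y v w. y \<noteq> 0 \<Longrightarrow> frechet_derivative A (at y) v \<bullet> w = frechet_derivative A (at y) w \<bullet> v"
  obtains h where "\<And>y. y \<noteq> 0 \<Longrightarrow> (h has_derivative (\<lambda>w. A y \<bullet> w)) (at y)"
proof -
  define U where "U s = {y::real^3. y$1 \<noteq> 0 \<or> y$2 \<noteq> 0 \<or> s * y$3 > 0}" for s
  have oU: "open (U s)" for s
    unfolding U_def by (intro open_Collect_disj open_Collect_neq open_Collect_less continuous_intros)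
  have ex: "\<exists>h. \<forall>y\<in>U s. (h has_derivative (\<lambda>w. A y \<bullet> w)) (at y)" if s: "s = 1 \<or> s = -1" for s :: real
  proof -
    obtain h where "\<And>y. y \<in> U s \<Longrightarrow> (h has_derivative (\<lambda>w. A y \<bullet> w)) (at y)"
    proof (rule poincare_star[OF oU, of s "s *\<^sub>R axis 3 1" A])
      show "smooth_in (U s) A" by (rule smooth_subset[OF A]) (auto simp: U_def)
      show "frechet_derivative A (at y) v \<bullet> w = frechet_derivative A (at y) w \<bullet> v" if "y \<in> U s" for y v w
        using that by (intro sym) (auto simp: U_def)
      show "s *\<^sub>R axis 3 1 + t *\<^sub>R (y - s *\<^sub>R axis 3 1) \<in> U s" if y: "y \<in> U s" and t: "0 \<le> t" "t \<le> 1" for y t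
      proof (cases "t = 0")
        case True
        then show ?thesis using s by (auto simp: U_def axis_def)
      next
        case False
        have "s * (s + t * (y$3 - s)) = (1 - t) + t * (s * y$3)" using s by (auto simp: algebra_simps)
        moreover have "(1 - t) + t * (s * y$3) > 0" if "s * y$3 > 0"
          using that t False by (intro add_nonneg_pos) auto
        ultimately show ?thesis using y False by (auto simp: U_def axis_def)
      qed
    qed auto
    then show ?thesis by blast
  qed
  obtain h1 where h1: "\<And>y. y \<in> U 1 \<Longrightarrow> (h1 has_derivative (\<lambda>w. A y \<bullet> w)) (at y)" using ex[of 1] by auto
  obtain h2 where h2: "\<And>y. y \<in> U (-1) \<Longrightarrow> (h2 has_derivative (\<lambda>w. A y \<bullet> w)) (at y)" using ex[of "-1"] by auto
  let ?I = "{y::real^3. y$1 \<noteq> 0 \<or> y$2 \<noteq> 0}"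
  \<comment> \<open>Cylindrical coordinates present the complement of the axis as a continuous image
    of a product of connected sets.\<close>
  have "?I = (\<lambda>(r, a, z). vector [r * cos a, r * sin a, z]) ` ({0<..} \<times> UNIV \<times> UNIV)"
  proof (intro equalityI subsetI)
    fix y :: "real^3" assume y: "y \<in> ?I"
    define r where "r = sqrt ((y$1)\<^sup>2 + (y$2)\<^sup>2)"
    have r2: "r\<^sup>2 = (y$1)\<^sup>2 + (y$2)\<^sup>2" unfolding r_def by simp
    have r: "r > 0" using y by (auto simp: r_def sum_power2_gt_zero_iff)
    have "(y$1 / r)\<^sup>2 + (y$2 / r)\<^sup>2 = ((y$1)\<^sup>2 + (y$2)\<^sup>2) / r\<^sup>2" by (simp only: power_divide add_divide_distrib)
    also have "\<dots> = 1" unfolding r2[symmetric] using r by simp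
    finally obtain a where "y$1 / r = cos a" "y$2 / r = sin a" using sincos_total_2pi by metis
    then have "y = vector [r * cos a, r * sin a, y$3]"
      using r by (simp add: vec_eq_iff forall_3 field_simps)
    then show "y \<in> (\<lambda>(r, a, z). vector [r * cos a, r * sin a, z]) ` ({0<..} \<times> UNIV \<times> UNIV)"
      using r by (intro image_eqI[of _ _ "(r, a, y$3)"]) auto
  next
    fix y :: "real^3" assume "y \<in> (\<lambda>(r, a, z). vector [r * cos a, r * sin a, z]) ` ({0<..} \<times> UNIV \<times> UNIV)"
    then obtain r a z where "r > 0" "y = vector [r * cos a, r * sin a, z]" by auto
    moreover have "\<not> (cos a = 0 \<and> sin a = 0)"
    proof
      assume "cos a = 0 \<and> sin a = 0"
      then have "(sin a)\<^sup>2 + (cos a)\<^sup>2 = 0" by simp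
      then show False by (simp only: sin_cos_squared_add)
    qed
    ultimately show "y \<in> ?I" by auto
  qed
  moreover have "connected ((\<lambda>(r, a, z). vector [r * cos a, r * sin a, z] :: real^3) ` ({0<..} \<times> (UNIV :: real set) \<times> (UNIV :: real set)))"
    unfolding case_prod_beta vector_3_eq_axis
    by (intro connected_continuous_image connected_Times continuous_intros) auto
  ultimately have conn: "connected ?I" by simp
  have sub: "?I = U 1 \<inter> U (-1)" by (auto simp: U_def)
  have "(\<lambda>y. h1 y - h2 y) constant_on ?I"
  proof (rule has_derivative_zero_connected_constant_on[OF conn])
    show o: "open ?I" unfolding sub by (intro open_Int oU)
    have d: "((\<lambda>y. h1 y - h2 y) has_derivative (\<lambda>h. 0)) (at y)" if "y \<in> ?I" for y
      using has_derivative_diff[OF h1[of y] h2[of y]] that unfolding sub by auto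
    then show "\<forall>y\<in>?I - {}. ((\<lambda>y. h1 y - h2 y) has_derivative (\<lambda>h. 0)) (at y within ?I)"
      by (auto intro: has_derivative_at_withinI)
    show "continuous_on ?I (\<lambda>y. h1 y - h2 y)"
      using d has_derivative_continuous by (intro continuous_at_imp_continuous_on) blast
  qed auto
  then obtain k where k: "\<And>y. y \<in> U 1 \<Longrightarrow> y \<in> U (-1) \<Longrightarrow> h1 y - h2 y = k"
    unfolding constant_on_def sub by auto
  define h where "h y = (if y \<in> U 1 then h1 y else h2 y + k)" for y
  have "(h has_derivative (\<lambda>w. A y \<bullet> w)) (at y)" if "y \<noteq> 0" for y
  proof (cases "y \<in> U 1")
    case True
    show ?thesis
      by (rule has_derivative_transform_within_open[OF h1[OF True] oU True]) (simp add: h_def)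
  next
    case False
    then have y: "y \<in> U (-1)" using that by (auto simp: U_def vec_eq_iff forall_3)
    have "((\<lambda>y. h2 y + k) has_derivative (\<lambda>w. A y \<bullet> w)) (at y)"
      by (rule has_derivative_eq_rhs[OF has_derivative_add[OF h2[OF y] Deriv.has_derivative_const]]) simp
    then show ?thesis
      by (rule has_derivative_transform_within_open[OF _ oU y]) (use k in \<open>force simp: h_def\<close>)
  qed
  then show ?thesis by (rule that)
qed

section \<open>Sections and hermitian connections\<close>

lemma circle_act_S3: "p \<in> S3 \<Longrightarrow> cmod u = 1 \<Longrightarrow> circle_act p u \<in> S3"
  unfolding S3_iff by (simp add: circle_act_def norm_mult)

lemma hopf_circle_act: "p \<in> S3 \<Longrightarrow> cmod u = 1 \<Longrightarrow> hopf R (circle_act p u) = hopf R p"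
  using invariant_hopf[of "\<lambda>x. x" R] by (simp add: invariant_def del: mem_sphere mem_sphere_0)

lemma sectionsI:
  assumes "smooth_on S3 s" "\<And>p. p \<notin> S3 \<Longrightarrow> s p = 0"
    and "\<And>p u. p \<in> S3 \<Longrightarrow> cmod u = 1 \<Longrightarrow> s (circle_act p u) = inverse (u ^ N) * s p"
  shows "s \<in> sections N"
  unfolding sections_def using assms by (simp del: mem_sphere mem_sphere_0)

lemma sectionsD:
  assumes "s \<in> sections N"
  shows "smooth_on S3 s" "\<And>p. p \<notin> S3 \<Longrightarrow> s p = 0"
    and "\<And>p u. p \<in> S3 \<Longrightarrow> cmod u = 1 \<Longrightarrow> s (circle_act p u) = inverse (u ^ N) * s p"
  using assms unfolding sections_def by blast+

lemma sections_add: "s \<in> sections N \<Longrightarrow> t \<in> sections N \<Longrightarrow> (\<lambda>q. s q + t q) \<in> sections N"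
  by (rule sectionsI) (auto simp: sectionsD algebra_simps intro!: smooth_on_add simp del: mem_sphere mem_sphere_0)

lemma sections_hopf_mult:
  assumes "R > 0" "smooth_on (sphere 0 R) h" "s \<in> sections N"
  shows "(\<lambda>q. h (hopf R q) * s q) \<in> sections N"
  by (rule sectionsI)
     (use assms smooth_on_hopf_compose[OF assms(1,2)] in
      \<open>auto simp: sectionsD hopf_circle_act intro!: smooth_on_mult simp del: mem_sphere mem_sphere_0\<close>)

lemma sections_scale: "s \<in> sections N \<Longrightarrow> (\<lambda>q. c * s q) \<in> sections N"
  by (rule sectionsI) (auto simp: sectionsD intro!: smooth_on_mult smooth_on_const simp del: mem_sphere mem_sphere_0)

lemma sections_zero: "(\<lambda>q. 0) \<in> sections N"
  by (rule sectionsI) (auto intro: smooth_on_const)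

lemma sections_sum: "(\<And>i. i \<in> I \<Longrightarrow> s i \<in> sections N) \<Longrightarrow> (\<lambda>q. \<Sum>i\<in>I. s i q) \<in> sections N"
  by (induction I rule: infinite_finite_induct) (auto intro: sections_zero sections_add)

lemma invariant_herm:
  assumes "s \<in> sections N" "t \<in> sections N"
  shows "invariant (\<lambda>p. s p * cnj (t p))"
  unfolding invariant_def
proof (intro ballI allI impI)
  fix p and u :: complex assume p: "p \<in> S3" and u: "cmod u = 1"
  have "inverse (u ^ N) * cnj (inverse (u ^ N)) = 1"
    unfolding complex_norm_square[symmetric] using u by (simp add: norm_inverse norm_power)
  moreover have "s (circle_act p u) * cnj (t (circle_act p u))
      = (inverse (u ^ N) * cnj (inverse (u ^ N))) * (s p * cnj (t p))"
    unfolding sectionsD(3)[OF assms(1) p u] sectionsD(3)[OF assms(2) p u] complex_cnj_mult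
    by (simp only: mult_ac)
  ultimately show "s (circle_act p u) * cnj (t (circle_act p u)) = s p * cnj (t p)" by simp
qed

lemma smooth_herm:
  assumes "R > 0" "s \<in> sections N" "t \<in> sections N"
  shows "smooth_in (- {0}) (desc R (\<lambda>p. s p * cnj (t p)))"
  by (intro desc_smooth assms(1) invariant_herm[OF assms(2,3)] smooth_on_mult smooth_on_cnj
      sectionsD(1)[OF assms(2)] sectionsD(1)[OF assms(3)])

lemma herm_desc: "R > 0 \<Longrightarrow> x \<in> sphere 0 R \<Longrightarrow> herm R s t x = desc R (\<lambda>p. s p * cnj (t p)) x"
  by (simp add: herm_def desc_def)

lemma herm_hopf:
  assumes "R > 0" "s \<in> sections N" "t \<in> sections N" "p \<in> S3"
  shows "herm R s t (hopf R p) = s p * cnj (t p)"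
  using herm_desc[OF assms(1) hopf_in_sphere[OF assms(1,4)]]
    desc_hopf[OF assms(1) invariant_herm[OF assms(2,3)] assms(4)] by simp

lemma continuous_herm:
  assumes "R > 0" "s \<in> sections N" "t \<in> sections N"
  shows "continuous_on (sphere 0 R) (herm R s t)"
proof -
  have "continuous_on (sphere 0 R) (desc R (\<lambda>p. s p * cnj (t p)))"
    by (rule continuous_on_subset[OF smooth_imp_continuous_on[OF smooth_herm[OF assms]]]) (use assms(1) in auto)
  then show ?thesis
    by (rule continuous_on_eq) (use herm_desc[OF assms(1)] in simp)
qed

lemma sphere_deriv_herm:
  assumes "R > 0" "x \<in> sphere 0 R"
  shows "sphere_deriv (herm R s t) x v = frechet_derivative (desc R (\<lambda>p. s p * cnj (t p))) (at x) v"
proof -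
  have "frechet_derivative (\<lambda>y. herm R s t ((norm x / norm y) *\<^sub>R y)) (at x)
      = frechet_derivative (desc R (\<lambda>p. s p * cnj (t p))) (at x)"
    by (rule frechet_derivative_eq_open[of "- {0}"]) (use assms in \<open>auto simp: herm_def desc_def\<close>)
  then show ?thesis by (simp add: sphere_deriv_def)
qed

section \<open>The L2 inner product of sections\<close>

definition ip :: "real \<Rightarrow> bundle_section \<Rightarrow> bundle_section \<Rightarrow> complex" where
  "ip R s t = sphere_integral R (herm R s t)"

lemma ip_cnj: "ip R t s = cnj (ip R s t)"
  unfolding ip_def sphere_integral_cnj[symmetric] by (simp add: herm_def[abs_def] mult.commute)

lemma ip_add_right:
  assumes "R > 0" "s \<in> sections N" "t \<in> sections N" "t' \<in> sections N"
  shows "ip R s (\<lambda>q. t q + t' q) = ip R s t + ip R s t'"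
  unfolding ip_def
  by (subst sphere_integral_add[OF assms(1), symmetric])
     (use continuous_herm[OF assms(1)] assms in \<open>auto simp: herm_def[abs_def] algebra_simps\<close>)

lemma ip_scale_left:
  assumes "R > 0" "s \<in> sections N" "t \<in> sections N"
  shows "ip R (\<lambda>q. c * s q) t = c * ip R s t"
  unfolding ip_def sphere_integral_mult[OF assms(1) continuous_herm[OF assms], symmetric]
  by (simp add: herm_def[abs_def] mult.assoc)

lemma ip_scale_right:
  assumes "R > 0" "s \<in> sections N" "t \<in> sections N"
  shows "ip R s (\<lambda>q. c * t q) = cnj c * ip R s t"
  by (subst ip_cnj, subst ip_scale_left[OF assms(1,3,2)]) (simp add: ip_cnj[of R s t])

lemma ip_zero_right: "ip R s (\<lambda>q. 0) = 0"
  by (simp add: ip_def herm_def[abs_def] sphere_integral_def)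

lemma ip_sum_right:
  assumes "R > 0" "s \<in> sections N" "\<And>i. i \<in> I \<Longrightarrow> t i \<in> sections N"
  shows "ip R s (\<lambda>q. \<Sum>i\<in>I. t i q) = (\<Sum>i\<in>I. ip R s (t i))"
  using assms(3)
proof (induction I rule: infinite_finite_induct)
  case (insert i I)
  then show ?case by (simp add: ip_add_right[OF assms(1,2)] sections_sum)
qed (simp_all add: ip_zero_right)

lemma laplacian_symmetric:
  assumes "magnetic_laplacian R N D s t" "magnetic_laplacian R N D s' t'"
  shows "ip R t s' = ip R s t'"
proof -
  have "sphere_integral R (herm_form R (D s) (D s')) = cnj (sphere_integral R (herm_form R (D s') (D s)))"
    unfolding sphere_integral_cnj[symmetric] by (simp add: herm_form_def[abs_def] mult.commute)
  then have "ip R t s' = cnj (ip R t' s)"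
    using assms by (simp add: magnetic_laplacian_def ip_def)
  then show ?thesis by (simp add: ip_cnj[of R s t'])
qed

locale hermitian_conn =
  fixes R :: real and N :: nat and D :: connection
  assumes R_pos: "R > 0" and herm_conn: "hermitian_connection R N D"
begin

lemma D_linear:
  "s \<in> sections N \<Longrightarrow> p \<in> S3 \<Longrightarrow> v \<in> tangent_space (hopf R p) \<Longrightarrow> w \<in> tangent_space (hopf R p) \<Longrightarrow>
    D s p (a *\<^sub>R v + b *\<^sub>R w) = of_real a * D s p v + of_real b * D s p w"
  using herm_conn unfolding hermitian_connection_def by blast

lemma D_closed: "s \<in> sections N \<Longrightarrow> vector_field R X \<Longrightarrow> covariant_deriv R D X s \<in> sections N"
  using herm_conn unfolding hermitian_connection_def by blast

lemma D_add:
  "s \<in> sections N \<Longrightarrow> t \<in> sections N \<Longrightarrow> p \<in> S3 \<Longrightarrow> v \<in> tangent_space (hopf R p) \<Longrightarrow>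
    D (\<lambda>q. s q + t q) p v = D s p v + D t p v"
  using herm_conn unfolding hermitian_connection_def by blast

lemma D_leibniz:
  "s \<in> sections N \<Longrightarrow> smooth_on (sphere 0 R) h \<Longrightarrow> p \<in> S3 \<Longrightarrow> v \<in> tangent_space (hopf R p) \<Longrightarrow>
    D (\<lambda>q. h (hopf R q) * s q) p v = sphere_deriv h (hopf R p) v * s p + h (hopf R p) * D s p v"
  using herm_conn unfolding hermitian_connection_def by blast

lemma D_metric:
  "s \<in> sections N \<Longrightarrow> t \<in> sections N \<Longrightarrow> p \<in> S3 \<Longrightarrow> v \<in> tangent_space (hopf R p) \<Longrightarrow>
    sphere_deriv (herm R s t) (hopf R p) v = D s p v * cnj (t p) + s p * cnj (D t p v)"
  using herm_conn unfolding hermitian_connection_def by blast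

lemma D_scale:
  assumes "s \<in> sections N" "p \<in> S3" "v \<in> tangent_space (hopf R p)"
  shows "D (\<lambda>q. c * s q) p v = c * D s p v"
proof -
  have "sphere_deriv (\<lambda>x. c) (hopf R p) v = 0" by (simp add: sphere_deriv_def)
  then show ?thesis using D_leibniz[OF assms(1) smooth_on_const[of _ c] assms(2,3)] by simp
qed

text \<open>Rotation fields are global, divergence free and span every tangent space, so the
  derivatives along them replace local frames.\<close>

definition nab :: "real^3 \<Rightarrow> bundle_section \<Rightarrow> bundle_section" where
  "nab u s = covariant_deriv R D (cross3 u) s"

lemma nab_apply: "p \<in> S3 \<Longrightarrow> nab u s p = D s p (cross3 u (hopf R p))"
  by (simp add: nab_def covariant_deriv_def del: mem_sphere mem_sphere_0)

lemma nab_outside: "p \<notin> S3 \<Longrightarrow> nab u s p = 0"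
  by (simp add: nab_def covariant_deriv_def del: mem_sphere mem_sphere_0)

lemma nab_closed: "s \<in> sections N \<Longrightarrow> nab u s \<in> sections N"
  unfolding nab_def by (rule D_closed[OF _ vector_field_cross])

lemma nab_add:
  "s \<in> sections N \<Longrightarrow> t \<in> sections N \<Longrightarrow> nab u (\<lambda>q. s q + t q) = (\<lambda>q. nab u s q + nab u t q)"
proof
  fix q assume "s \<in> sections N" "t \<in> sections N"
  then show "nab u (\<lambda>q. s q + t q) q = nab u s q + nab u t q"
    by (cases "q \<in> S3") (simp_all add: nab_apply nab_outside D_add cross_tangent del: mem_sphere mem_sphere_0)
qed

lemma nab_scale: "s \<in> sections N \<Longrightarrow> nab u (\<lambda>q. c * s q) = (\<lambda>q. c * nab u s q)"
proof
  fix q assume "s \<in> sections N"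
  then show "nab u (\<lambda>q. c * s q) q = c * nab u s q"
    by (cases "q \<in> S3") (simp_all add: nab_apply nab_outside D_scale cross_tangent del: mem_sphere mem_sphere_0)
qed

text \<open>By metric compatibility and \<open>sphere_integral_rotation\<close> the formal adjoint
  of \<open>nab u\<close> is its negative. The tight frame of \<open>tangent_onb_sum\<close>, with
  constant \<open>R\<^sup>2\<close> on the sphere, turns the sum over the axes into the pointwise
  product of one-forms.\<close>

lemma laplacian_nab:
  assumes s: "s \<in> sections N"
  shows "magnetic_laplacian R N D s
    (\<lambda>p. of_real (- 1 / R\<^sup>2) * (\<Sum>i\<in>UNIV. nab (axis i 1) (nab (axis i 1) s) p))"
proof -
  define L where "L i = nab (axis i 1) (nab (axis i 1) s)" for i
  have L: "L i \<in> sections N" for i unfolding L_def by (intro nab_closed s)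
  have "ip R (\<lambda>p. of_real (- 1 / R\<^sup>2) * (\<Sum>i\<in>UNIV. L i p)) v = sphere_integral R (herm_form R (D s) (D v))"
    if v: "v \<in> sections N" for v
  proof -
    have cl: "nab u s \<in> sections N" "nab u v \<in> sections N" for u by (intro nab_closed s v)+
    have zero: "sphere_integral R (herm R (L i) v) + sphere_integral R (herm R (nab (axis i 1) s) (nab (axis i 1) v)) = 0" for i
    proof -
      let ?u = "axis i 1 :: real^3"
      let ?F = "\<lambda>p. nab ?u s p * cnj (v p)"
      have "frechet_derivative (desc R ?F) (at x) (cross3 ?u x) = herm R (L i) v x + herm R (nab ?u s) (nab ?u v) x"
        if x: "x \<in> sphere 0 R" for x
      proof -
        define p where "p = fibre_point R x"
        have p: "p \<in> S3" "hopf R p = x" using fibre_point[OF R_pos x] by (auto simp: p_def)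
        show ?thesis
          using D_metric[OF cl(1) v p(1) cross_tangent, of ?u ?u] sphere_deriv_herm[OF R_pos x]
            nab_apply[OF p(1)]
          by (simp add: p(2) herm_def L_def flip: p_def)
      qed
      from sphere_integral_cong[OF R_pos this]
      have "sphere_integral R (\<lambda>x. herm R (L i) v x + herm R (nab ?u s) (nab ?u v) x) = 0"
        using sphere_integral_rotation[OF R_pos smooth_herm[OF R_pos cl(1) v], of ?u ?u] by simp
      then show ?thesis
        unfolding sphere_integral_add[OF R_pos continuous_herm[OF R_pos L v] continuous_herm[OF R_pos cl]] .
    qed
    have "sphere_integral R (herm_form R (D s) (D v)) =
        sphere_integral R (\<lambda>x. of_real (1 / R\<^sup>2) * (\<Sum>i\<in>UNIV. herm R (nab (axis i 1) s) (nab (axis i 1) v) x))"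
    proof (rule sphere_integral_cong[OF R_pos])
      fix x :: "real^3" assume x: "x \<in> sphere 0 R"
      define p where "p = fibre_point R x"
      have p: "p \<in> S3" "hopf R p = x" using fibre_point[OF R_pos x] by (auto simp: p_def)
      have "(\<Sum>i\<in>UNIV. D s p (cross3 (axis i 1) x) * cnj (D v p (cross3 (axis i 1) x)))
          = of_real ((norm x)\<^sup>2) * (\<Sum>e\<in>tangent_onb x. D s p e * cnj (D v p e))"
        by (rule tangent_onb_sum) (use x R_pos D_linear[OF s p(1)] D_linear[OF v p(1)] p(2) in auto)
      then show "herm_form R (D s) (D v) x =
          of_real (1 / R\<^sup>2) * (\<Sum>i\<in>UNIV. herm R (nab (axis i 1) s) (nab (axis i 1) v) x)"
        using x R_pos by (simp add: herm_form_def herm_def nab_apply[OF p(1)] p(2) flip: p_def)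
    qed
    also have "\<dots> = of_real (1 / R\<^sup>2) * (\<Sum>i\<in>UNIV. sphere_integral R (herm R (nab (axis i 1) s) (nab (axis i 1) v)))"
      using continuous_herm[OF R_pos cl]
      by (subst sphere_integral_mult[OF R_pos]) (auto intro!: continuous_on_sum simp: sphere_integral_sum[OF R_pos])
    also have "\<dots> = of_real (- 1 / R\<^sup>2) * (\<Sum>i\<in>UNIV. sphere_integral R (herm R (L i) v))"
      using zero by (simp add: eq_neg_iff_add_eq_0[symmetric] sum_negf)
    also have "\<dots> = sphere_integral R (\<lambda>x. of_real (- 1 / R\<^sup>2) * (\<Sum>i\<in>UNIV. herm R (L i) v x))"
      using continuous_herm[OF R_pos L v]
      by (subst sphere_integral_mult[OF R_pos]) (auto intro!: continuous_on_sum simp: sphere_integral_sum[OF R_pos])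
    also have "(\<lambda>x. of_real (- 1 / R\<^sup>2) * (\<Sum>i\<in>UNIV. herm R (L i) v x))
        = herm R (\<lambda>p. of_real (- 1 / R\<^sup>2) * (\<Sum>i\<in>UNIV. L i p)) v"
      by (simp add: herm_def[abs_def] sum_distrib_right mult.assoc)
    finally show ?thesis by (simp add: ip_def)
  qed
  then show ?thesis
    unfolding magnetic_laplacian_def ip_def L_def
    by (intro conjI s sections_scale sections_sum nab_closed) auto
qed

end

section \<open>Gauge fixing\<close>

text \<open>The conjugate appears because sections of \<open>L\<close> transform with the inverse of
  the character.\<close>

definition c1 :: bundle_section where "c1 p = (if p \<in> S3 then cnj (fst p) else 0)"
definition c2 :: bundle_section where "c2 p = (if p \<in> S3 then cnj (snd p) else 0)"

lemma c12_S3: "p \<in> S3 \<Longrightarrow> c1 p = cnj (fst p)" "p \<in> S3 \<Longrightarrow> c2 p = cnj (snd p)"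
  by (simp_all add: c1_def c2_def del: mem_sphere mem_sphere_0)

lemma inverse_unit: "cmod u = 1 \<Longrightarrow> inverse u = cnj u"
  by (rule inverse_unique) (simp add: complex_norm_square[symmetric])

lemma c12_sections: "c1 \<in> sections 1" "c2 \<in> sections 1"
proof -
  have "smooth_on S3 c1"
    using smooth_on_cong[of S3 c1 "\<lambda>p. cnj (fst p)"] c12_S3 smooth_on_cnj[OF smooth_on_fst] by blast
  then show "c1 \<in> sections 1"
  proof (rule sectionsI)
    show "c1 p = 0" if "p \<notin> S3" for p using that by (simp add: c1_def del: mem_sphere mem_sphere_0)
    show "c1 (circle_act p u) = inverse (u ^ 1) * c1 p" if "p \<in> S3" "cmod u = 1" for p u
      unfolding c12_S3[OF circle_act_S3[OF that]] c12_S3[OF that(1)] power_one_right inverse_unit[OF that(2)]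
      by (simp add: circle_act_def)
  qed
  have "smooth_on S3 c2"
    using smooth_on_cong[of S3 c2 "\<lambda>p. cnj (snd p)"] c12_S3 smooth_on_cnj[OF smooth_on_snd] by blast
  then show "c2 \<in> sections 1"
  proof (rule sectionsI)
    show "c2 p = 0" if "p \<notin> S3" for p using that by (simp add: c2_def del: mem_sphere mem_sphere_0)
    show "c2 (circle_act p u) = inverse (u ^ 1) * c2 p" if "p \<in> S3" "cmod u = 1" for p u
      unfolding c12_S3[OF circle_act_S3[OF that]] c12_S3[OF that(1)] power_one_right inverse_unit[OF that(2)]
      by (simp add: circle_act_def)
  qed
qed

text \<open>The rotation field \<open>x \<mapsto> u \<times> x\<close> lifts along the Hopf map to the linear field \<open>lift u\<close>,
  whose vertical part at \<open>p\<close> is \<open>(\<i>/2) (u \<bullet> hopf 1 p) p\<close>.\<close>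

definition lift :: "real^3 \<Rightarrow> complex \<times> complex \<Rightarrow> complex \<times> complex" where
  "lift u p = (\<i> / 2 * (of_real (u$3) * fst p + Complex (u$1) (u$2) * snd p),
               \<i> / 2 * (Complex (u$1) (- (u$2)) * fst p - of_real (u$3) * snd p))"

text \<open>The standard connection differentiates along the horizontal part of \<open>lift u\<close>; \<open>std1\<close>
  and \<open>std2\<close> are its values on the sections \<open>c1\<close> and \<open>c2\<close>.\<close>

definition std1 :: "real^3 \<Rightarrow> bundle_section" where
  "std1 u p = cnj (fst (lift u p)) + \<i> / 2 * of_real (u \<bullet> hopf 1 p) * cnj (fst p)"

definition std2 :: "real^3 \<Rightarrow> bundle_section" where
  "std2 u p = cnj (snd (lift u p)) + \<i> / 2 * of_real (u \<bullet> hopf 1 p) * cnj (snd p)"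

lemma hopf_scale: "hopf R p = R *\<^sub>R hopf 1 p"
  by (simp add: hopf_def)

lemma hopf_complex:
  "complex_of_real (hopf 1 p $ 1) = fst p * cnj (snd p) + snd p * cnj (fst p)"
  "complex_of_real (hopf 1 p $ 2) = - \<i> * (fst p * cnj (snd p) - snd p * cnj (fst p))"
  "complex_of_real (hopf 1 p $ 3) = fst p * cnj (fst p) - snd p * cnj (snd p)"
    apply (simp_all add: hopf_nth complex_eq_iff)[2]
  by (simp only: hopf_nth mult_1 of_real_diff complex_norm_square)

lemma inner_3: "(u::real^3) \<bullet> v = u$1 * v$1 + u$2 * v$2 + u$3 * v$3"
  by (simp add: inner_vec_def sum_3)

lemma halve_eq:
  fixes s a b X Y k :: complex
  assumes "2 * s = a * Y + b * X + 2 * k"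
  shows "s = a / 2 * Y + b / 2 * X + k"
proof -
  have "s = (2 * s) / 2" by simp
  also have "\<dots> = a / 2 * Y + b / 2 * X + k" unfolding assms by (simp add: add_divide_distrib)
  finally show ?thesis .
qed

lemma Complex_as_sum: "Complex a b = of_real a + \<i> * of_real b"
  by (simp add: complex_eq_iff)

text \<open>Rewrites the standard connection through the components of the tangent vector, the form
  in which differentiated Hopf coordinates enter \<open>nab_c12\<close>.\<close>

lemma std_alt:
  assumes "p \<in> S3"
  shows "std1 u p = (of_real (cross3 u (hopf 1 p) $ 1) - \<i> * of_real (cross3 u (hopf 1 p) $ 2)) / 2 * cnj (snd p)
      + of_real (cross3 u (hopf 1 p) $ 3) / 2 * cnj (fst p)" (is ?A)
    and "std2 u p = (of_real (cross3 u (hopf 1 p) $ 1) + \<i> * of_real (cross3 u (hopf 1 p) $ 2)) / 2 * cnj (fst p)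
      - of_real (cross3 u (hopf 1 p) $ 3) / 2 * cnj (snd p)" (is ?B)
proof -
  \<comment> \<open>Coordinates and conjugates become independent letters; the claims are then
    polynomial identities modulo \<open>x * X + y * Y = 1\<close> and
    \<open>\<i> * \<i> = -1\<close>.\<close>
  define x y X Y where "x = fst p" "y = snd p" "X = cnj (fst p)" "Y = cnj (snd p)"
  have 1: "x * X + y * Y = 1" using assms unfolding S3_iff_complex by (simp add: x_y_X_Y_def)
  have i: "\<i> * \<i> = -1" by simp
  define a b c where "a = complex_of_real (u$1)" "b = complex_of_real (u$2)" "c = complex_of_real (u$3)"
  define h1 h2 h3 where "h1 = complex_of_real (hopf 1 p $ 1)" "h2 = complex_of_real (hopf 1 p $ 2)" "h3 = complex_of_real (hopf 1 p $ 3)"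
  have h: "h1 = x * Y + y * X" "h2 = - \<i> * (x * Y - y * X)" "h3 = x * X - y * Y"
    by (simp_all only: h1_h2_h3_def hopf_complex x_y_X_Y_def)
  have s1: "std1 u p = - \<i> / 2 * (c * X + (a - \<i> * b) * Y) + \<i> / 2 * (a * h1 + b * h2 + c * h3) * X"
    by (simp add: std1_def lift_def inner_3 Complex_as_sum a_b_c_def h1_h2_h3_def x_y_X_Y_def)
  have s2: "std2 u p = - \<i> / 2 * ((a + \<i> * b) * X - c * Y) + \<i> / 2 * (a * h1 + b * h2 + c * h3) * Y"
    by (simp add: std2_def lift_def inner_3 Complex_as_sum a_b_c_def h1_h2_h3_def x_y_X_Y_def)
  have v: "complex_of_real (cross3 u (hopf 1 p) $ 1) = b * h3 - c * h2"
    "complex_of_real (cross3 u (hopf 1 p) $ 2) = c * h1 - a * h3"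
    "complex_of_real (cross3 u (hopf 1 p) $ 3) = a * h2 - b * h1"
    by (simp_all add: cross3_def a_b_c_def h1_h2_h3_def)
  have "2 * std1 u p = (b * h3 - c * h2 - \<i> * (c * h1 - a * h3)) * Y + (a * h2 - b * h1) * X"
    unfolding s1 h using 1 i by algebra
  from halve_eq[of _ _ _ _ _ 0, simplified, OF this] show ?A unfolding v x_y_X_Y_def by simp
  have "2 * std2 u p = (b * h3 - c * h2 + \<i> * (c * h1 - a * h3)) * X - (a * h2 - b * h1) * Y"
    unfolding s2 h using 1 i by algebra
  from arg_cong[OF this, of "\<lambda>z. z / 2"] show ?B unfolding v x_y_X_Y_def by (simp add: diff_divide_distrib)
qed

lemma desc_scale: "c > 0 \<Longrightarrow> desc R F (c *\<^sub>R y) = desc R F y"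
  by (simp add: desc_def)

lemma smooth_on_affine: "smooth_on M (\<lambda>x::real^3. a + b * complex_of_real (x$i))"
  by (intro smooth_on_add smooth_on_const smooth_on_mult smooth_on_linear[OF bounded_linear_of_real]
      smooth_on_bounded_linear bounded_linear_vec_nth)

lemma has_derivative_affine:
  "((\<lambda>x::real^3. a + b * complex_of_real (x$i)) has_derivative (\<lambda>v. b * of_real (v$i))) F"
proof -
  have "bounded_linear (\<lambda>x::real^3. b * complex_of_real (x$i))"
    by (rule bounded_linear_compose[OF bounded_linear_mult_right bounded_linear_compose[OF bounded_linear_of_real bounded_linear_vec_nth]])
  from has_derivative_add[OF Deriv.has_derivative_const bounded_linear_imp_has_derivative[OF this]]
  show ?thesis by simp
qed

section \<open>The difference between the given connection and the standard one\<close>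

locale degree_one = hermitian_conn R 1 D for R and D +
  assumes curv: "has_magnetic_curvature R D"
begin

text \<open>On the 3-sphere \<open>std1 u p * fst p + std2 u p * snd p = 0\<close>, while the
  squared moduli of \<open>c1\<close> and \<open>c2\<close> add up to 1. So this expression extracts
  the difference one-form to the standard connection, evaluated on the rotation field of
  \<open>u\<close>.\<close>

definition K :: "real^3 \<Rightarrow> complex \<times> complex \<Rightarrow> complex" where
  "K u p = nab u c1 p * cnj (c1 p) + nab u c2 p * cnj (c2 p)"

lemma K_S3: "p \<in> S3 \<Longrightarrow> K u p = nab u c1 p * fst p + nab u c2 p * snd p"
  by (simp add: K_def c12_S3 del: mem_sphere mem_sphere_0)

lemma K_invariant: "invariant (K u)"
  using invariant_herm[OF nab_closed[OF c12_sections(1)] c12_sections(1)]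
    invariant_herm[OF nab_closed[OF c12_sections(2)] c12_sections(2)]
  unfolding invariant_def K_def by metis

lemma K_smooth: "smooth_on S3 (K u)"
  unfolding K_def[abs_def]
  by (intro smooth_on_add smooth_on_mult smooth_on_cnj sectionsD(1)[OF c12_sections(1)] sectionsD(1)[OF c12_sections(2)]
      sectionsD(1)[OF nab_closed[OF c12_sections(1)]] sectionsD(1)[OF nab_closed[OF c12_sections(2)]])

lemma D_leibniz_affine:
  assumes "s \<in> sections 1" "p \<in> S3" "v \<in> tangent_space (hopf R p)"
  shows "D (\<lambda>q. (a + b * complex_of_real (hopf R q $ i)) * s q) p v
      = b * of_real (v$i) * s p + (a + b * complex_of_real (hopf R p $ i)) * D s p v"
proof -
  have "sphere_deriv (\<lambda>x. a + b * complex_of_real (x$i)) (hopf R p) v = b * of_real (v$i)"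
    by (rule sphere_deriv_eq[OF hopf_nonzero[OF R_pos assms(2)] has_derivative_affine])
       (use assms(3) in \<open>simp add: tangent_space_def\<close>)
  with D_leibniz[OF assms(1) smooth_on_affine assms(2,3), of a b i] show ?thesis by simp
qed

text \<open>With h the Hopf coordinates, \<open>c1\<close> and \<open>c2\<close> satisfy (1 + h3) c2
  = (h1 + \<i> h2) c1 and (1 - h3) c1 = (h1 - \<i> h2) c2. Differentiating both relations by the
  Leibniz rule gives linear equations for the two derivatives, which determine them up to a common
  multiple of \<open>c1\<close> and \<open>c2\<close>; that multiple is \<open>K\<close>.\<close>

lemma nab_c12:
  assumes p: "p \<in> S3"
  shows "nab u c1 p = std1 u p + K u p * cnj (fst p)" (is ?A)
    and "nab u c2 p = std2 u p + K u p * cnj (snd p)" (is ?B)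
proof -
  define v where "v = cross3 u (hopf R p)"
  have vt: "v \<in> tangent_space (hopf R p)" by (simp add: v_def cross_tangent)
  have vR: "v $ i = R * (cross3 u (hopf 1 p) $ i)" for i
    unfolding v_def hopf_scale[of R] by (simp add: cross_mult_right)
  note a = D_leibniz_affine[OF _ p vt]
  note sec = c12_sections sections_scale[OF c12_sections(1)] sections_scale[OF c12_sections(2)]
  define x y X Y where "x = fst p" "y = snd p" "X = cnj (fst p)" "Y = cnj (snd p)"
  have one: "x * X + y * Y = 1" using p unfolding S3_iff_complex by (simp add: x_y_X_Y_def)
  define h where "h i = complex_of_real (hopf 1 p $ i)" for i
  have h: "h 1 = x * Y + y * X" "h 2 = - \<i> * (x * Y - y * X)" "h 3 = x * X - y * Y"
    by (simp_all only: h_def hopf_complex x_y_X_Y_def)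
  define w where "w i = complex_of_real (cross3 u (hopf 1 p) $ i)" for i
  define A B where "A = nab u c1 p" "B = nab u c2 p"
  have AB: "D c1 p v = A" "D c2 p v = B" by (simp_all add: A_B_def nab_apply[OF p] v_def)
  have cp: "c1 p = X" "c2 p = Y" using c12_S3[OF p] by (simp_all add: x_y_X_Y_def)
  let ?r = "complex_of_real (1 / R)"
  have hR: "?r * complex_of_real (hopf R q $ i) = complex_of_real (hopf 1 q $ i)" for q i
    using R_pos by (simp add: hopf_scale[of R])
  have eq: "?r * of_real (v $ i) = w i" for i using R_pos by (simp add: vR w_def)
  \<comment> \<open>Each coefficient is written as a constant plus a multiple of one coordinate, as
    \<open>D_leibniz_affine\<close> expects; hence the summands 0.\<close>
  have e1: "(\<lambda>q. (1 + ?r * complex_of_real (hopf R q $ 3)) * c2 q) =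
      (\<lambda>q. (0 + ?r * complex_of_real (hopf R q $ 1)) * c1 q + \<i> * ((0 + ?r * complex_of_real (hopf R q $ 2)) * c1 q))"
  proof
    fix q
    show "(1 + ?r * complex_of_real (hopf R q $ 3)) * c2 q = (0 + ?r * complex_of_real (hopf R q $ 1)) * c1 q + \<i> * ((0 + ?r * complex_of_real (hopf R q $ 2)) * c1 q)"
    proof (cases "q \<in> S3")
      case True
      have i: "\<i> * \<i> = -1" by simp
      show ?thesis unfolding hR hopf_complex c12_S3[OF True]
        using True[unfolded S3_iff_complex] i by algebra
    qed (simp add: c1_def c2_def del: mem_sphere mem_sphere_0)
  qed
  have e2: "(\<lambda>q. (1 + (- ?r) * complex_of_real (hopf R q $ 3)) * c1 q) =
      (\<lambda>q. (0 + ?r * complex_of_real (hopf R q $ 1)) * c2 q + (- \<i>) * ((0 + ?r * complex_of_real (hopf R q $ 2)) * c2 q))"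
  proof
    fix q
    show "(1 + (- ?r) * complex_of_real (hopf R q $ 3)) * c1 q = (0 + ?r * complex_of_real (hopf R q $ 1)) * c2 q + (- \<i>) * ((0 + ?r * complex_of_real (hopf R q $ 2)) * c2 q)"
    proof (cases "q \<in> S3")
      case True
      have i: "\<i> * \<i> = -1" by simp
      have hR': "- ?r * complex_of_real (hopf R q $ i) = - complex_of_real (hopf 1 q $ i)" for i
        using hR[of q i] by simp
      show ?thesis unfolding hR hR' hopf_complex c12_S3[OF True]
        using True[unfolded S3_iff_complex] i by algebra
    qed (simp add: c1_def c2_def del: mem_sphere mem_sphere_0)
  qed
  have secs: "(\<lambda>q. (a + b * complex_of_real (hopf R q $ i)) * s q) \<in> sections 1" if "s \<in> sections 1" for a b i s
    by (rule sections_hopf_mult[OF R_pos smooth_on_affine that])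
  have E1: "w 3 * Y + (1 + h 3) * B = w 1 * X + h 1 * A + \<i> * (w 2 * X + h 2 * A)"
    using arg_cong[OF e1, of "\<lambda>s. D s p v"]
    unfolding D_add[OF secs[OF c12_sections(1)] sections_scale[OF secs[OF c12_sections(1)]] p vt]
      D_scale[OF secs[OF c12_sections(1)] p vt] a[OF c12_sections(1)] a[OF c12_sections(2)]
    unfolding hR eq cp AB by (simp add: h_def)
  have E2: "- w 3 * X + (1 - h 3) * A = w 1 * Y + h 1 * B - \<i> * (w 2 * Y + h 2 * B)"
    using arg_cong[OF e2, of "\<lambda>s. D s p v"]
    unfolding D_add[OF secs[OF c12_sections(2)] sections_scale[OF secs[OF c12_sections(2)]] p vt]
      D_scale[OF secs[OF c12_sections(2)] p vt] a[OF c12_sections(1)] a[OF c12_sections(2)]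
    unfolding minus_mult_left[symmetric] hR eq cp AB by (simp add: h_def)
  have i: "\<i> * \<i> = -1" by simp
  have Kp: "K u p = A * x + B * y" by (simp add: K_S3[OF p] A_B_def x_y_X_Y_def)
  have "2 * A = (w 1 - \<i> * w 2) * Y + w 3 * X + 2 * (K u p * X)"
    unfolding Kp using E2[unfolded h] one i by algebra
  from halve_eq[OF this] show ?A unfolding std_alt[OF p] A_B_def w_def x_y_X_Y_def .
  have "2 * B = (w 1 + \<i> * w 2) * X + (- w 3) * Y + 2 * (K u p * Y)"
    unfolding Kp using E1[unfolded h] one i by algebra
  from halve_eq[OF this] show ?B unfolding std_alt[OF p] A_B_def w_def x_y_X_Y_def by simp
qed

text \<open>By metric compatibility \<open>2 * Re (K u p)\<close> is the derivative of the sum of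
  the squared norms of \<open>c1\<close> and \<open>c2\<close>, which is constant: the two norms are
  1/2 plus and minus the third coordinate divided by \<open>2 * R\<close>.\<close>

lemma Re_K:
  assumes p: "p \<in> S3"
  shows "Re (K u p) = 0"
proof -
  define v where "v = cross3 u (hopf R p)"
  have vt: "v \<in> tangent_space (hopf R p)" by (simp add: v_def cross_tangent)
  have x: "norm (hopf R p) = R" using hopf_in_sphere[OF R_pos p] by simp
  have key: "2 * Re (nab u s p * cnj (s p)) = Re b * v $ 3"
    if s: "s \<in> sections 1" and h: "\<And>q. q \<in> S3 \<Longrightarrow> s q * cnj (s q) = 1 / 2 + b * complex_of_real (hopf R q $ 3)"
      and b: "Im b = 0" for s b
  proof -
    have "sphere_deriv (herm R s s) (hopf R p) v = sphere_deriv (\<lambda>x. 1 / 2 + b * complex_of_real (x$3)) (hopf R p) v"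
    proof (rule sphere_deriv_cong[OF x R_pos])
      fix y :: "real^3" assume y: "y \<in> sphere 0 R"
      from fibre_point[OF R_pos y] h[of "fibre_point R y"]
      show "herm R s s y = 1 / 2 + b * complex_of_real (y$3)" by (simp add: herm_def)
    qed
    also have "\<dots> = b * of_real (v$3)"
      by (rule sphere_deriv_eq[OF hopf_nonzero[OF R_pos p] has_derivative_affine])
         (use vt in \<open>simp add: tangent_space_def\<close>)
    finally have "b * of_real (v$3) = D s p v * cnj (s p) + s p * cnj (D s p v)"
      using D_metric[OF s s p vt] by simp
    from arg_cong[OF this, of Re] b show ?thesis
      by (simp add: nab_apply[OF p] v_def algebra_simps)
  qed
  have q: "complex_of_real (1 / (2 * R)) * complex_of_real (hopf R q $ 3) = complex_of_real (hopf 1 q $ 3) / 2" for q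
    using R_pos by (simp add: hopf_scale[of R])
  have "c1 q * cnj (c1 q) = 1 / 2 + of_real (1 / (2 * R)) * complex_of_real (hopf R q $ 3)" if "q \<in> S3" for q
  proof -
    have "2 * (c1 q * cnj (c1 q)) = 1 + complex_of_real (hopf 1 q $ 3)"
      unfolding hopf_complex c12_S3[OF that] complex_cnj_cnj using that[unfolded S3_iff_complex] by algebra
    then show ?thesis unfolding q by (simp add: field_simps)
  qed
  then have k1: "2 * Re (nab u c1 p * cnj (c1 p)) = Re (of_real (1 / (2 * R))) * v $ 3"
    by (rule key[OF c12_sections(1) _ Im_complex_of_real])
  have "c2 q * cnj (c2 q) = 1 / 2 + of_real (- 1 / (2 * R)) * complex_of_real (hopf R q $ 3)" if "q \<in> S3" for q
  proof -
    have "2 * (c2 q * cnj (c2 q)) = 1 - complex_of_real (hopf 1 q $ 3)"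
      unfolding hopf_complex c12_S3[OF that] complex_cnj_cnj using that[unfolded S3_iff_complex] by algebra
    then show ?thesis using q[of q] by (simp add: field_simps)
  qed
  then have k2: "2 * Re (nab u c2 p * cnj (c2 p)) = Re (of_real (- 1 / (2 * R))) * v $ 3"
    by (rule key[OF c12_sections(2) _ Im_complex_of_real])
  have "2 * Re (K u p) = 2 * Re (nab u c1 p * cnj (c1 p)) + 2 * Re (nab u c2 p * cnj (c2 p))"
    by (simp only: K_def plus_complex.sel distrib_left)
  then show ?thesis unfolding k1 k2 Re_complex_of_real by simp
qed

text \<open>The difference form is purely imaginary by \<open>Re_K\<close>; this is its real
  coefficient, constant along rays.\<close>

definition al :: "real^3 \<Rightarrow> real^3 \<Rightarrow> real" where
  "al u y = Im (desc R (K u) y)"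

lemma al_hopf: "p \<in> S3 \<Longrightarrow> K u p = \<i> * of_real (al u (hopf R p))"
  by (simp add: al_def desc_hopf[OF R_pos K_invariant] complex_eq_iff Re_K del: mem_sphere mem_sphere_0)

lemma al_smooth: "smooth_in (- {0}) (al u)"
  unfolding al_def[abs_def]
  by (rule smooth_linear[OF bounded_linear_Im _ desc_smooth[OF R_pos K_invariant K_smooth]]) auto

definition alv :: "real^3 \<Rightarrow> real^3" where
  "alv y = al (axis 1 1) y *\<^sub>R axis 1 1 + al (axis 2 1) y *\<^sub>R axis 2 1 + al (axis 3 1) y *\<^sub>R axis 3 1"

lemma alv_smooth: "smooth_in (- {0}) alv"
  unfolding alv_def[abs_def]
  by (intro smooth_add smooth_bilinear[OF bounded_bilinear_scaleR] smooth_const al_smooth) auto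

lemma alv_scale: "c > 0 \<Longrightarrow> alv (c *\<^sub>R y) = alv y"
  by (simp add: alv_def al_def desc_scale)

lemma sphere_point:
  assumes "y \<noteq> 0"
  obtains p where "p \<in> S3" "hopf R p = (R / norm y) *\<^sub>R y"
  using fibre_point[OF R_pos, of "(R / norm y) *\<^sub>R y"] R_pos assms by auto

lemma cross_coords:
  "cross3 u x = (u$1) *\<^sub>R cross3 (axis 1 1) x + 1 *\<^sub>R ((u$2) *\<^sub>R cross3 (axis 2 1) x + (u$3) *\<^sub>R cross3 (axis 3 1) x)"
  by (simp add: vec_eq_iff forall_3 cross3_def axis_def)

text \<open>The first part is the tensoriality of a connection in the direction. The second holds
  because the rotation about the axis \<open>y\<close> does not move \<open>y\<close>.\<close>

lemma al_alv:
  assumes "y \<noteq> 0"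
  shows "al u y = alv y \<bullet> u" "alv y \<bullet> y = 0"
proof -
  obtain p where p: "p \<in> S3" "hopf R p = (R / norm y) *\<^sub>R y" using sphere_point[OF assms] .
  have pos: "R / norm y > 0" using R_pos assms by simp
  have lin: "nab u s p = of_real (u$1) * nab (axis 1 1) s p + of_real (u$2) * nab (axis 2 1) s p + of_real (u$3) * nab (axis 3 1) s p"
    if s: "s \<in> sections 1" for s u
  proof -
    have t: "(u$2) *\<^sub>R cross3 (axis 2 1) x + (u$3) *\<^sub>R cross3 (axis 3 1) x \<in> tangent_space x" for x
      by (simp add: tangent_space_def inner_add_left dot_cross_self)
    show ?thesis unfolding nab_apply[OF p(1)]
      by (subst cross_coords) (simp only: D_linear[OF s p(1) cross_tangent t] D_linear[OF s p(1) cross_tangent cross_tangent], simp)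
  qed
  have "K u p = of_real (u$1) * K (axis 1 1) p + of_real (u$2) * K (axis 2 1) p + of_real (u$3) * K (axis 3 1) p" for u
    unfolding K_def lin[OF c12_sections(1), of u] lin[OF c12_sections(2), of u] by (simp add: algebra_simps)
  note Ku = this
  have *: "al u (hopf R p) = alv (hopf R p) \<bullet> u" for u
    using arg_cong[OF Ku[of u], of Im] unfolding al_hopf[OF p(1)] alv_def
    by (simp add: inner_add_left inner_axis' mult.commute)
  have al_y: "al u (hopf R p) = al u y" for u
    unfolding p(2) using pos by (simp add: al_def desc_scale)
  have alv_y: "alv (hopf R p) = alv y" unfolding p(2) by (rule alv_scale[OF pos])
  show "al u y = alv y \<bullet> u" using * al_y alv_y by simp
  have "nab (hopf R p) s p = 0" if "s \<in> sections 1" for s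
    using D_linear[OF that p(1), of 0 0 0 0] by (simp add: nab_apply[OF p(1)] tangent_space_def)
  from this[OF c12_sections(1)] this[OF c12_sections(2)] have "K (hopf R p) p = 0" by (simp add: K_def)
  then have "al (hopf R p) (hopf R p) = 0" using al_hopf[OF p(1)] by simp
  then have "alv y \<bullet> hopf R p = 0" using * alv_y by simp
  then show "alv y \<bullet> y = 0" using R_pos assms by (simp add: p(2))
qed

text \<open>The standard connection already has the prescribed curvature, so the curvature condition
  says that the difference form is closed. The claim is the invariant formula for the exterior
  derivative on two rotation fields, the sign of the last term coming from
  \<open>lie_bracket_cross\<close>.\<close>

lemma alv_closed_sphere:
  assumes p: "p \<in> S3" and x: "x = hopf R p"
  shows "frechet_derivative (al w) (at x) (cross3 u x) - frechet_derivative (al u) (at x) (cross3 w x) + al (cross3 u w) x = 0"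
proof -
  have x0: "x \<noteq> 0" using hopf_nonzero[OF R_pos p] x by simp
  \<comment> \<open>\<open>H w\<close> gathers the two terms that multiply a section by a function
    of the base point, namely the difference form and the vertical part of \<open>lift w\<close>.
    What remains of \<open>nab w\<close> acts on \<open>c1\<close> and \<open>c2\<close> with
    constant coefficients.\<close>
  define H where "H w y = \<i> * of_real (al w y + w \<bullet> y / (2 * R))" for w y
  have Hs: "smooth_on (sphere 0 R) (H w)" for w
  proof -
    have "smooth_in (- {0}) (\<lambda>y. al w y + (w \<bullet> y) * (1 / (2 * R)))"
      by (intro smooth_add al_smooth smooth_mult smooth_const smooth_bilinear[OF bounded_bilinear_inner] smooth_ident) auto
    then have "smooth_in (- {0}) (\<lambda>y. \<i> * complex_of_real (al w y + (w \<bullet> y) * (1 / (2 * R))))"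
      by (intro smooth_mult smooth_const smooth_of_real) auto
    moreover have "H w = (\<lambda>y. \<i> * complex_of_real (al w y + (w \<bullet> y) * (1 / (2 * R))))"
      by (simp add: H_def[abs_def])
    ultimately have "smooth_in (- {0}) (H w)" by simp
    then show ?thesis by (rule smooth_onI[rotated 2]) (use R_pos in auto)
  qed
  have nabS: "nab w c1 = (\<lambda>q. (- \<i> / 2 * of_real (w$3)) * c1 q + ((- \<i> / 2 * Complex (w$1) (- (w$2))) * c2 q + H w (hopf R q) * c1 q))"
    "nab w c2 = (\<lambda>q. (- \<i> / 2 * Complex (w$1) (w$2)) * c1 q + ((\<i> / 2 * of_real (w$3)) * c2 q + H w (hopf R q) * c2 q))" for w
  proof -
    have "nab w c1 q = (- \<i> / 2 * of_real (w$3)) * c1 q + ((- \<i> / 2 * Complex (w$1) (- (w$2))) * c2 q + H w (hopf R q) * c1 q)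
      \<and> nab w c2 q = (- \<i> / 2 * Complex (w$1) (w$2)) * c1 q + ((\<i> / 2 * of_real (w$3)) * c2 q + H w (hopf R q) * c2 q)" for q
    proof (cases "q \<in> S3")
      case True
      have wR: "w \<bullet> hopf R q / (2 * R) = (w \<bullet> hopf 1 q) / 2" using R_pos by (simp add: hopf_scale[of R])
      show ?thesis
        unfolding nab_c12[OF True] al_hopf[OF True] c12_S3[OF True] H_def wR std1_def std2_def lift_def
        by (simp add: algebra_simps complex_eq_iff)
    next
      case False
      then show ?thesis by (simp add: nab_outside c1_def c2_def del: mem_sphere mem_sphere_0)
    qed
    then show "nab w c1 = (\<lambda>q. (- \<i> / 2 * of_real (w$3)) * c1 q + ((- \<i> / 2 * Complex (w$1) (- (w$2))) * c2 q + H w (hopf R q) * c1 q))"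
      "nab w c2 = (\<lambda>q. (- \<i> / 2 * Complex (w$1) (w$2)) * c1 q + ((\<i> / 2 * of_real (w$3)) * c2 q + H w (hopf R q) * c2 q))"
      by blast+
  qed
  define dH where "dH w v = \<i> * of_real (frechet_derivative (al w) (at x) v + w \<bullet> v / (2 * R))" for w v
  have dH: "sphere_deriv (H w) x v = dH w v" if "v \<bullet> x = 0" for w v
  proof (rule sphere_deriv_eq[OF x0 _ that])
    have "(al w has_derivative frechet_derivative (al w) (at x)) (at x)"
      by (rule smooth_imp_has_derivative[OF al_smooth]) (use x0 in simp)
    moreover have "bounded_linear (\<lambda>y. w \<bullet> y / (2 * R))"
      by (rule bounded_linear_compose[OF bounded_linear_divide bounded_linear_inner_right])
    ultimately have "((\<lambda>y. al w y + w \<bullet> y / (2 * R)) has_derivative (\<lambda>v. frechet_derivative (al w) (at x) v + w \<bullet> v / (2 * R))) (at x)"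
      by (intro has_derivative_add bounded_linear_imp_has_derivative)
    then show "(H w has_derivative dH w) (at x)"
      unfolding H_def dH_def by (intro has_derivative_mult_right has_derivative_of_real)
  qed
  have vt: "cross3 u x \<in> tangent_space (hopf R p)" for u by (simp add: x cross_tangent)
  have vx: "cross3 u x \<bullet> x = 0" for u by (simp add: dot_cross_self)
  note sc = sections_scale[OF c12_sections(1)] sections_scale[OF c12_sections(2)]
  note sh = sections_hopf_mult[OF R_pos Hs c12_sections(1)] sections_hopf_mult[OF R_pos Hs c12_sections(2)]
  have N1: "nab u (nab w c1) p = (- \<i> / 2 * of_real (w$3)) * nab u c1 p + ((- \<i> / 2 * Complex (w$1) (- (w$2))) * nab u c2 p
      + (dH w (cross3 u x) * c1 p + H w x * nab u c1 p))" for u w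
    by (subst nabS(1)) (simp only: nab_apply[OF p, folded x] D_add[OF sc(1) sections_add[OF sc(2) sh(1)] p vt]
        D_add[OF sc(2) sh(1) p vt] D_scale[OF c12_sections(1) p vt] D_scale[OF c12_sections(2) p vt]
        D_leibniz[OF c12_sections(1) Hs p vt] x[symmetric] dH[OF vx])
  have N2: "nab u (nab w c2) p = (- \<i> / 2 * Complex (w$1) (w$2)) * nab u c1 p + ((\<i> / 2 * of_real (w$3)) * nab u c2 p
      + (dH w (cross3 u x) * c2 p + H w x * nab u c2 p))" for u w
    by (subst nabS(2)) (simp only: nab_apply[OF p, folded x] D_add[OF sc(1) sections_add[OF sc(2) sh(2)] p vt]
        D_add[OF sc(2) sh(2) p vt] D_scale[OF c12_sections(1) p vt] D_scale[OF c12_sections(2) p vt]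
        D_leibniz[OF c12_sections(2) Hs p vt] x[symmetric] dH[OF vx])
  define F where "F = complex_of_real (magnetic_form R x (cross3 u x) (cross3 w x))"
  have curv': "F * s p = \<i> * (nab u (nab w s) p - nab w (nab u s) p - nab (- cross3 u w) s p)" if "s \<in> sections 1" for s
  proof -
    have "covariant_deriv R D (lie_bracket (cross3 u) (cross3 w)) s p = nab (- cross3 u w) s p"
      using p lie_bracket_cross[OF x0, of u w] by (simp add: covariant_deriv_def nab_def x)
    then show ?thesis
      using curv vector_field_cross that p
      unfolding has_magnetic_curvature_def curvature_def F_def x nab_def by fastforce
  qed
  have Hm: "H (- cross3 u w) x = - H (cross3 u w) x"
    by (simp add: H_def al_alv(1)[OF x0] algebra_simps)
  have *: "F * c1 p = \<i> * (dH w (cross3 u x) - dH u (cross3 w x) + H (cross3 u w) x) * c1 p"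
    "F * c2 p = \<i> * (dH w (cross3 u x) - dH u (cross3 w x) + H (cross3 u w) x) * c2 p"
  proof -
    define n where "n = cross3 u w"
    have n: "complex_of_real (n$1) = of_real (u$2) * of_real (w$3) - of_real (u$3) * of_real (w$2)"
       "complex_of_real (n$2) = of_real (u$3) * of_real (w$1) - of_real (u$1) * of_real (w$3)"
       "complex_of_real (n$3) = of_real (u$1) * of_real (w$2) - of_real (u$2) * of_real (w$1)"
      by (simp_all add: n_def cross3_def)
    have i: "\<i> * \<i> = -1" by simp
    let ?d1 = "dH w (cross3 u x)" and ?d2 = "dH u (cross3 w x)"
    have Hm': "H (- n) x = - H n x" using Hm by (simp add: n_def)
    have C1: "nab a c1 p = (- \<i> / 2 * of_real (a$3)) * c1 p + ((- \<i> / 2 * Complex (a$1) (- (a$2))) * c2 p + H a x * c1 p)"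
      and C2: "nab a c2 p = (- \<i> / 2 * Complex (a$1) (a$2)) * c1 p + ((\<i> / 2 * of_real (a$3)) * c2 p + H a x * c2 p)" for a
      using fun_cong[OF nabS(1)] fun_cong[OF nabS(2)] by (simp_all only: x)
    have "nab u (nab w c1) p - nab w (nab u c1) p - nab (- n) c1 p = (?d1 - ?d2 + H n x) * c1 p"
      unfolding N1 C1 C2 Hm' Complex_as_sum vector_uminus_component of_real_minus n
      using i by (simp add: field_simps)
    then show "F * c1 p = \<i> * (?d1 - ?d2 + H (cross3 u w) x) * c1 p"
      unfolding curv'[OF c12_sections(1)] by (simp add: n_def)
    have "nab u (nab w c2) p - nab w (nab u c2) p - nab (- n) c2 p = (?d1 - ?d2 + H n x) * c2 p"
      unfolding N2 C1 C2 Hm' Complex_as_sum vector_uminus_component of_real_minus n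
      using i by (simp add: field_simps)
    then show "F * c2 p = \<i> * (?d1 - ?d2 + H (cross3 u w) x) * c2 p"
      unfolding curv'[OF c12_sections(2)] by (simp add: n_def)
  qed
  \<comment> \<open>The two sections have no common zero, so one of them can be cancelled.\<close>
  have "c1 p \<noteq> 0 \<or> c2 p \<noteq> 0"
  proof (rule ccontr)
    assume "\<not> (c1 p \<noteq> 0 \<or> c2 p \<noteq> 0)"
    then have "fst p = 0" "snd p = 0" using c12_S3[OF p] by auto
    then show False using p[unfolded S3_iff] by simp
  qed
  with * have "F = \<i> * (dH w (cross3 u x) - dH u (cross3 w x) + H (cross3 u w) x)" by auto
  then have "magnetic_form R x (cross3 u x) (cross3 w x) =
    - ((frechet_derivative (al w) (at x) (cross3 u x) + w \<bullet> cross3 u x / (2 * R))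
     - (frechet_derivative (al u) (at x) (cross3 w x) + u \<bullet> cross3 w x / (2 * R))
     + (al (cross3 u w) x + cross3 u w \<bullet> x / (2 * R)))"
    by (simp add: F_def dH_def H_def complex_eq_iff)
  moreover have "w \<bullet> cross3 u x = - (cross3 u w \<bullet> x)" "u \<bullet> cross3 w x = cross3 u w \<bullet> x"
    by (simp_all add: inner_3 cross3_def algebra_simps)
  moreover have "magnetic_form R x (cross3 u x) (cross3 w x) = cross3 u w \<bullet> x / (2 * R)"
  proof -
    have "x \<bullet> cross3 (cross3 u x) (cross3 w x) = (cross3 u w \<bullet> x) * (norm x)\<^sup>2"
      unfolding norm_vec3 by (simp add: inner_3 cross3_def) algebra
    moreover have "norm x = R" using hopf_in_sphere[OF R_pos p] x by simp
    ultimately show ?thesis using R_pos by (simp add: magnetic_form_def power2_eq_square power3_eq_cube)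
  qed
  ultimately show ?thesis by (simp add: algebra_simps)
qed

text \<open>Homogeneity of degree 0 carries the identity from radius \<open>R\<close> to every
  radius: the scaling of the rotation field compensates that of the derivative.\<close>

lemma alv_closed:
  assumes "y \<noteq> 0"
  shows "frechet_derivative alv (at y) (cross3 u y) \<bullet> w - frechet_derivative alv (at y) (cross3 w y) \<bullet> u
      + alv y \<bullet> cross3 u w = 0"
proof -
  obtain p where p: "p \<in> S3" "hopf R p = (R / norm y) *\<^sub>R y" using sphere_point[OF assms] .
  define c where "c = R / norm y"
  have c: "c > 0" using R_pos assms by (simp add: c_def)
  have cy: "c *\<^sub>R y \<noteq> 0" using c assms by simp
  have d: "frechet_derivative (al w) (at (c *\<^sub>R y)) (c *\<^sub>R v) = frechet_derivative alv (at y) v \<bullet> w" for v w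
  proof -
    have "(alv has_derivative frechet_derivative alv (at y)) (at y)"
      by (rule smooth_imp_has_derivative[OF alv_smooth]) (use assms in simp)
    from has_derivative_inner_left[OF this]
    have 1: "((\<lambda>z. alv z \<bullet> w) has_derivative (\<lambda>v. frechet_derivative alv (at y) v \<bullet> w)) (at y)" .
    have 2: "(al w has_derivative frechet_derivative (al w) (at (c *\<^sub>R y))) (at (c *\<^sub>R y))"
      by (rule smooth_imp_has_derivative[OF al_smooth]) (use cy in simp)
    have "((\<lambda>z. c *\<^sub>R z) has_derivative (\<lambda>v. c *\<^sub>R v)) (at y)"
      by (rule bounded_linear_imp_has_derivative[OF bounded_linear_scaleR_right])
    from has_derivative_compose[OF this 2]
    have 3: "((\<lambda>z. al w (c *\<^sub>R z)) has_derivative (\<lambda>v. frechet_derivative (al w) (at (c *\<^sub>R y)) (c *\<^sub>R v))) (at y)" .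
    have "((\<lambda>z. al w (c *\<^sub>R z)) has_derivative (\<lambda>v. frechet_derivative alv (at y) v \<bullet> w)) (at y)"
      by (rule has_derivative_transform_within_open[OF 1, of "- {0}"])
         (use assms c in \<open>auto simp: al_alv(1) alv_scale\<close>)
    from has_derivative_unique[OF 3 this] show ?thesis by metis
  qed
  have "frechet_derivative (al w) (at (c *\<^sub>R y)) (cross3 u (c *\<^sub>R y)) - frechet_derivative (al u) (at (c *\<^sub>R y)) (cross3 w (c *\<^sub>R y))
      + al (cross3 u w) (c *\<^sub>R y) = 0"
    by (rule alv_closed_sphere[OF p(1)]) (simp add: p(2) c_def)
  then show ?thesis
    by (simp add: cross_mult_right d al_alv(1)[OF cy] alv_scale[OF c])
qed

text \<open>The one-form \<open>u \<times> y \<mapsto> al u y\<close>, extended by \<open>0\<close> to radial vectors, is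
  \<open>w \<mapsto> pot y \<bullet> w\<close>.\<close>

definition pot :: "real^3 \<Rightarrow> real^3" where
  "pot y = (norm y powr -2) *\<^sub>R cross3 (alv y) y"

lemma bounded_bilinear_cross: "bounded_bilinear cross3"
  using bilinear_cross bilinear_conv_bounded_bilinear by blast

lemma pot_smooth: "smooth_in (- {0}) pot"
  unfolding pot_def[abs_def]
  by (intro smooth_bilinear[OF bounded_bilinear_scaleR] smooth_norm_powr
      smooth_bilinear[OF bounded_bilinear_cross] alv_smooth smooth_ident) auto

lemma pot_alv:
  assumes "y \<noteq> 0"
  shows "pot y \<bullet> cross3 u y = alv y \<bullet> u"
proof -
  have "cross3 (alv y) y \<bullet> cross3 u y = (alv y \<bullet> u) * (norm y)\<^sup>2 - (alv y \<bullet> y) * (y \<bullet> u)"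
    unfolding norm_vec3 by (simp add: inner_3 cross3_def) algebra
  then show ?thesis using assms by (simp add: pot_def al_alv(2) powr_minus_divide)
qed

text \<open>Closedness in all of punctured space. On tangential directions it is
  \<open>alv_closed\<close>; the radial direction contributes nothing to the derivative of
  \<open>alv\<close> because \<open>alv\<close> is constant along rays. The terms that do not
  contain this derivative cancel since \<open>alv y\<close> is orthogonal to
  \<open>y\<close>.\<close>

lemma pot_symmetric:
  assumes y: "y \<noteq> 0"
  shows "frechet_derivative pot (at y) v \<bullet> w = frechet_derivative pot (at y) w \<bullet> v"
proof -
  define P where "P = frechet_derivative alv (at y)"
  have P: "(alv has_derivative P) (at y)"
    unfolding P_def by (rule smooth_imp_has_derivative[OF alv_smooth]) (use y in simp)
  have lP: "linear P" by (rule has_derivative_linear[OF P])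
  define m where "m = y \<bullet> y"
  have m: "m > 0" using y by (simp add: m_def)
  have pot2: "pot z = inverse (z \<bullet> z) *\<^sub>R cross3 (alv z) z" if "z \<noteq> 0" for z
    using that by (simp add: pot_def powr_minus_divide dot_square_norm inverse_eq_divide)
  have "((\<lambda>z. z \<bullet> z) has_derivative (\<lambda>v. y \<bullet> v + v \<bullet> y)) (at y)"
    by (rule has_derivative_inner[OF has_derivative_ident has_derivative_ident])
  from Deriv.has_derivative_inverse[OF _ this]
  have 1: "((\<lambda>z. inverse (z \<bullet> z)) has_derivative (\<lambda>v. - (inverse m * (y \<bullet> v + v \<bullet> y) * inverse m))) (at y)"
    using y by (simp add: m_def)
  have 2: "((\<lambda>z. cross3 (alv z) z) has_derivative (\<lambda>v. cross3 (alv y) v + cross3 (P v) y)) (at y)"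
    by (rule bounded_bilinear.FDERIV[OF bounded_bilinear_cross P has_derivative_ident])
  define Q where "Q v = inverse m *\<^sub>R (cross3 (alv y) v + cross3 (P v) y)
      + (- (inverse m * (y \<bullet> v + v \<bullet> y) * inverse m)) *\<^sub>R cross3 (alv y) y" for v
  have "((\<lambda>z. inverse (z \<bullet> z) *\<^sub>R cross3 (alv z) z) has_derivative Q) (at y)"
    using has_derivative_scaleR[OF 1 2] by (simp add: Q_def[abs_def] m_def)
  then have "(pot has_derivative Q) (at y)"
    by (rule has_derivative_transform_within_open[of _ _ _ _ "- {0}"]) (use y pot2 in auto)
  from has_derivative_imp_frechet[OF this] have fr: "frechet_derivative pot (at y) = Q" .
  have Py: "P y = 0"
  proof -
    have "((\<lambda>t. alv (t *\<^sub>R y)) has_derivative (\<lambda>t. P (t *\<^sub>R y))) (at 1)"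
      by (rule has_derivative_compose[OF bounded_linear_imp_has_derivative[OF bounded_linear_scaleR_left]])
         (use P in simp)
    moreover have "((\<lambda>t. alv (t *\<^sub>R y)) has_derivative (\<lambda>t. 0)) (at 1)"
    proof (rule has_derivative_transform_within_open[OF Deriv.has_derivative_const[of "alv y"]])
      show "open {0::real<..}" by simp
    qed (auto simp: alv_scale)
    ultimately have "(\<lambda>t. P (t *\<^sub>R y)) = (\<lambda>t. 0)" by (rule has_derivative_unique)
    from fun_cong[OF this, of 1] show ?thesis by simp
  qed
  \<comment> \<open>The tangential part of \<open>v\<close> is the value at \<open>y\<close> of the
    rotation field with axis \<open>inverse m *\<^sub>R cross3 y v\<close>.\<close>
  have PT: "P v = P (cross3 (inverse m *\<^sub>R cross3 y v) y)" for v
  proof -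
    have "cross3 (inverse m *\<^sub>R cross3 y v) y = v + (- (y \<bullet> v) * inverse m) *\<^sub>R y"
    proof -
      have "cross3 (cross3 y v) y = m *\<^sub>R v - (y \<bullet> v) *\<^sub>R y"
        by (simp add: vec_eq_iff forall_3 cross3_def inner_3 m_def algebra_simps)
      then show ?thesis using m by (simp add: cross_mult_left scaleR_diff_right)
    qed
    then show ?thesis by (simp add: linear_add[OF lP] linear_scale[OF lP] linear_diff[OF lP] Py)
  qed
  have "P v \<bullet> cross3 y w - P w \<bullet> cross3 y v = 0"
  proof -
    \<comment> \<open>Both axes are orthogonal to \<open>y\<close>, hence their cross product is
      radial and its inner product with \<open>alv y\<close> vanishes.\<close>
    let ?a = "inverse m *\<^sub>R cross3 y v" and ?b = "inverse m *\<^sub>R cross3 y w"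
    have "P (cross3 ?a y) \<bullet> ?b - P (cross3 ?b y) \<bullet> ?a + alv y \<bullet> cross3 ?a ?b = 0"
      unfolding P_def by (rule alv_closed[OF y])
    moreover have "cross3 (cross3 y v) (cross3 y w) = (y \<bullet> cross3 v w) *\<^sub>R y"
      by (simp add: vec_eq_iff forall_3 cross3_def inner_3 algebra_simps)
    then have "alv y \<bullet> cross3 ?a ?b = 0"
      by (simp add: cross_mult_left cross_mult_right al_alv(2)[OF y])
    ultimately have "inverse m * (P v \<bullet> cross3 y w - P w \<bullet> cross3 y v) = 0"
      by (simp add: PT[symmetric] right_diff_distrib)
    then show ?thesis using m by simp
  qed
  moreover have "m * (cross3 (alv y) v \<bullet> w - cross3 (alv y) w \<bullet> v)
      = 2 * (y \<bullet> v) * (cross3 (alv y) y \<bullet> w) - 2 * (y \<bullet> w) * (cross3 (alv y) y \<bullet> v)"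
    using al_alv(2)[OF y] unfolding m_def inner_3 cross3_def vector_3 by algebra
  moreover have "cross3 (P v) y \<bullet> w = P v \<bullet> cross3 y w" "cross3 (P w) y \<bullet> v = P w \<bullet> cross3 y v"
    by (simp_all add: inner_3 cross3_def algebra_simps)
  moreover have "m * m * (Q v \<bullet> w) = m * (cross3 (alv y) v \<bullet> w + cross3 (P v) y \<bullet> w)
      - 2 * (y \<bullet> v) * (cross3 (alv y) y \<bullet> w)" for v w
    unfolding Q_def inner_add_left inner_scaleR_left inner_commute[of v y] using m by (simp add: field_simps)
  note this[of v w] this[of w v]
  ultimately have "m * m * (Q v \<bullet> w - Q w \<bullet> v) = 0"
    by algebra
  then show ?thesis unfolding fr using m by simp
qed

text \<open>For a primitive \<open>h\<close> of the potential, the derivative of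
  \<open>exp (- \<i> * h)\<close> along a rotation field contributes exactly the negative of
  \<open>K\<close>.\<close>

lemma gauge:
  obtains g where "smooth_in (- {0}) g" "\<And>y. cmod (g y) = 1"
    "\<And>p u. p \<in> S3 \<Longrightarrow> nab u (\<lambda>q. g (hopf R q) * c1 q) p = g (hopf R p) * std1 u p"
    "\<And>p u. p \<in> S3 \<Longrightarrow> nab u (\<lambda>q. g (hopf R q) * c2 q) p = g (hopf R p) * std2 u p"
proof -
  obtain h where h: "\<And>y. y \<noteq> 0 \<Longrightarrow> (h has_derivative (\<lambda>w. pot y \<bullet> w)) (at y)"
    using poincare_R3[OF pot_smooth pot_symmetric] by blast
  have hs: "smooth_in (- {0}) h"
    by (rule smoothI_derivatives[of _ _ "\<lambda>y w. pot y \<bullet> w"])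
       (use h in \<open>auto intro!: smooth_bilinear[OF bounded_bilinear_inner] pot_smooth smooth_const\<close>)
  define g where "g y = exp (- \<i> * complex_of_real (h y))" for y
  have gs: "smooth_in (- {0}) g"
    unfolding g_def
  proof (rule smooth_compose[OF _ open_UNIV _ smooth_exp])
    show "smooth_in (- {0}) (\<lambda>y. - \<i> * complex_of_real (h y))"
      by (intro smooth_mult smooth_const smooth_of_real hs) auto
  qed auto
  have g1: "cmod (g y) = 1" for y by (simp add: g_def)
  have gs': "smooth_on (sphere 0 R) g" by (rule smooth_onI[OF _ _ gs]) (use R_pos in auto)
  have gd: "sphere_deriv g (hopf R p) (cross3 u (hopf R p)) = - \<i> * of_real (al u (hopf R p)) * g (hopf R p)"
    if p: "p \<in> S3" for p u
  proof -
    let ?x = "hopf R p"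
    have x0: "?x \<noteq> 0" by (rule hopf_nonzero[OF R_pos p])
    have d: "((\<lambda>y. - \<i> * complex_of_real (h y)) has_derivative (\<lambda>w. - \<i> * complex_of_real (pot ?x \<bullet> w))) (at ?x)"
      by (intro has_derivative_mult_right has_derivative_of_real h x0)
    have "(exp has_derivative (\<lambda>v. exp z * v)) (at z)" for z :: complex
      using DERIV_exp[of z] by (simp add: has_field_derivative_def)
    from has_derivative_compose[OF d this]
    have "(g has_derivative (\<lambda>w. g ?x * (- \<i> * complex_of_real (pot ?x \<bullet> w)))) (at ?x)"
      by (simp add: g_def[abs_def])
    from sphere_deriv_eq[OF x0 this, of "cross3 u ?x"] show ?thesis
      by (simp add: dot_cross_self pot_alv[OF x0] al_alv(1)[OF x0])
  qed
  show ?thesis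
  proof (rule that[OF gs g1])
    fix p u assume p: "p \<in> S3"
    show "nab u (\<lambda>q. g (hopf R q) * c1 q) p = g (hopf R p) * std1 u p"
      unfolding nab_apply[OF p] D_leibniz[OF c12_sections(1) gs' p cross_tangent] gd[OF p]
      by (simp only: nab_apply[OF p, symmetric] nab_c12[OF p] al_hopf[OF p] c12_S3[OF p]) (simp add: algebra_simps)
    show "nab u (\<lambda>q. g (hopf R q) * c2 q) p = g (hopf R p) * std2 u p"
      unfolding nab_apply[OF p] D_leibniz[OF c12_sections(2) gs' p cross_tangent] gd[OF p]
      by (simp only: nab_apply[OF p, symmetric] nab_c12[OF p] al_hopf[OF p] c12_S3[OF p]) (simp add: algebra_simps)
  qed
qed

end

section \<open>The Laplacian on monomial sections\<close>

text \<open>The Leibniz sum for \<open>c\<close> equal factors followed by \<open>d\<close> equal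
  factors. The exponents \<open>c - 1\<close> and \<open>d - 1\<close> truncate only where their
  coefficient is 0.\<close>

lemma sum_prod_two_valued:
  fixes s1 s2 t1 t2 :: complex
  shows "(\<Sum>i<c + d. (if i < c then t1 else t2) * (\<Prod>j\<in>{..<c + d} - {i}. if j < c then s1 else s2))
    = of_nat c * t1 * s1 ^ (c - 1) * s2 ^ d + of_nat d * t2 * s1 ^ c * s2 ^ (d - 1)"
proof -
  let ?P = "\<lambda>i. \<Prod>j\<in>{..<c + d} - {i}. if j < c then s1 else s2"
  have split: "{..<c + d} = {..<c} \<union> {c..<c + d}" by auto
  have 1: "?P i = s1 ^ (c - 1) * s2 ^ d" if "i < c" for i
  proof -
    have "{..<c + d} - {i} = ({..<c} - {i}) \<union> {c..<c + d}" using that by auto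
    then have "?P i = (\<Prod>j\<in>{..<c} - {i}. if j < c then s1 else s2) * (\<Prod>j\<in>{c..<c + d}. if j < c then s1 else s2)"
      by (simp add: prod.union_disjoint disjoint_iff)
    also have "\<dots> = (\<Prod>j\<in>{..<c} - {i}. s1) * (\<Prod>j\<in>{c..<c + d}. s2)"
      by (intro arg_cong2[of _ _ _ _ "(*)"] prod.cong) auto
    finally show ?thesis using that by simp
  qed
  have 2: "?P i = s1 ^ c * s2 ^ (d - 1)" if "i \<in> {c..<c + d}" for i
  proof -
    have "{..<c + d} - {i} = {..<c} \<union> ({c..<c + d} - {i})" using that by auto
    then have "?P i = (\<Prod>j\<in>{..<c}. if j < c then s1 else s2) * (\<Prod>j\<in>{c..<c + d} - {i}. if j < c then s1 else s2)"
      by (simp add: prod.union_disjoint disjoint_iff)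
    also have "\<dots> = (\<Prod>j\<in>{..<c}. s1) * (\<Prod>j\<in>{c..<c + d} - {i}. s2)"
      by (intro arg_cong2[of _ _ _ _ "(*)"] prod.cong) auto
    finally show ?thesis using that by simp
  qed
  have "(\<Sum>i<c + d. (if i < c then t1 else t2) * ?P i)
      = (\<Sum>i<c. (if i < c then t1 else t2) * ?P i) + (\<Sum>i\<in>{c..<c + d}. (if i < c then t1 else t2) * ?P i)"
    unfolding split by (intro sum.union_disjoint) auto
  also have "(\<Sum>i<c. (if i < c then t1 else t2) * ?P i) = (\<Sum>i<c. t1 * (s1 ^ (c - 1) * s2 ^ d))"
    by (intro sum.cong refl) (simp add: 1)
  also have "(\<Sum>i\<in>{c..<c + d}. (if i < c then t1 else t2) * ?P i) = (\<Sum>i\<in>{c..<c + d}. t2 * (s1 ^ c * s2 ^ (d - 1)))"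
    by (intro sum.cong refl) (simp add: 2)
  finally show ?thesis by (simp add: mult_ac)
qed

lemma prod_two_valued:
  fixes s1 s2 :: complex
  shows "(\<Prod>j<c + d. if j < c then s1 else s2) = s1 ^ c * s2 ^ d"
proof -
  have split: "{..<c + d} = {..<c} \<union> {c..<c + d}" by auto
  have "(\<Prod>j<c + d. if j < c then s1 else s2) = (\<Prod>j<c. if j < c then s1 else s2) * (\<Prod>j\<in>{c..<c + d}. if j < c then s1 else s2)"
    unfolding split by (intro prod.union_disjoint) auto
  also have "\<dots> = (\<Prod>j<c. s1) * (\<Prod>j\<in>{c..<c + d}. s2)"
    by (intro arg_cong2[of _ _ _ _ "(*)"] prod.cong) auto
  finally show ?thesis by simp
qed

text \<open>A single function \<open>g\<close>, obtained from the connection on \<open>L\<close>,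
  serves all powers, since sections of the \<open>N\<close>-th power are gauged by
  \<open>g ^ N\<close>.\<close>

locale gauged = hermitian_conn R N D for R N D +
  fixes nabla :: connection and g :: "real^3 \<Rightarrow> complex"
  assumes N_pos: "N \<ge> 1"
    and induced: "induced_connection R nabla N D"
    and g_smooth: "smooth_in (- {0}) g" and g_norm: "\<And>y. cmod (g y) = 1"
    and g1: "\<And>p u. p \<in> S3 \<Longrightarrow> nabla (\<lambda>q. g (hopf R q) * c1 q) p (cross3 u (hopf R p)) = g (hopf R p) * std1 u p"
    and g2: "\<And>p u. p \<in> S3 \<Longrightarrow> nabla (\<lambda>q. g (hopf R q) * c2 q) p (cross3 u (hopf R p)) = g (hopf R p) * std2 u p"
begin

lemma g_smooth_on: "smooth_on (sphere 0 R) g"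
  by (rule smooth_onI[OF _ _ g_smooth]) (use R_pos in auto)

text \<open>\<open>Q a b c d\<close> is the gauged section given by the monomial with these exponents in
  \<open>p\<^sub>1, p\<^sub>2\<close> and their conjugates; it is set to \<open>0\<close> if the monomial does not have the
  equivariance required of a section of \<open>L\<^sup>N\<close>.\<close>

definition Q :: "nat \<Rightarrow> nat \<Rightarrow> nat \<Rightarrow> nat \<Rightarrow> bundle_section" where
  "Q a b c d q = (if q \<in> S3 \<and> c + d = N + a + b
     then g (hopf R q) ^ N * (fst q ^ a * snd q ^ b * cnj (fst q) ^ c * cnj (snd q) ^ d) else 0)"

lemma Q_S3: "q \<in> S3 \<Longrightarrow> c + d = N + a + b \<Longrightarrow>
    Q a b c d q = g (hopf R q) ^ N * (fst q ^ a * snd q ^ b * cnj (fst q) ^ c * cnj (snd q) ^ d)"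
  by (simp add: Q_def del: mem_sphere mem_sphere_0)

lemma Q_off: "q \<notin> S3 \<Longrightarrow> Q a b c d q = 0"
  by (simp add: Q_def del: mem_sphere mem_sphere_0)

lemma Q_wrong: "c + d \<noteq> N + a + b \<Longrightarrow> Q a b c d = (\<lambda>q. 0)"
  by (rule ext) (simp only: Q_def simp_thms if_False)

lemma Q_section: "Q a b c d \<in> sections N"
proof (cases "c + d = N + a + b")
  case False
  then show ?thesis by (simp add: Q_wrong sections_zero)
next
  case True
  show ?thesis
  proof (rule sectionsI)
    have "smooth_on S3 (\<lambda>q. g (hopf R q) ^ N * (fst q ^ a * snd q ^ b * cnj (fst q) ^ c * cnj (snd q) ^ d))"
      by (intro smooth_on_mult smooth_on_power smooth_on_hopf_compose[OF R_pos g_smooth_on]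
          smooth_on_fst smooth_on_snd smooth_on_cnj)
    then show "smooth_on S3 (Q a b c d)"
      using smooth_on_cong[of S3 "Q a b c d", OF Q_S3[OF _ True]] by simp
    show "Q a b c d p = 0" if "p \<notin> S3" for p using that by (rule Q_off)
    fix p and u :: complex assume p: "p \<in> S3" and u: "cmod u = 1"
    have uc: "u * cnj u = 1" using u by (simp add: complex_norm_square[symmetric])
    have "u ^ a * u ^ b * cnj u ^ c * cnj u ^ d = (u ^ (a + b) * cnj u ^ (a + b)) * cnj u ^ N"
      using True by (simp flip: power_add) (simp add: mult.assoc add_ac flip: power_add)
    also have "\<dots> = inverse (u ^ N)"
      unfolding power_mult_distrib[symmetric] uc by (simp add: inverse_unit[OF u] flip: power_inverse)
    finally have "u ^ a * u ^ b * cnj u ^ c * cnj u ^ d = inverse (u ^ N)" .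
    then show "Q a b c d (circle_act p u) = inverse (u ^ N) * Q a b c d p"
      unfolding Q_S3[OF p True] Q_S3[OF circle_act_S3[OF p u] True] hopf_circle_act[OF p u]
      by (simp add: circle_act_def power_mult_distrib mult_ac)
  qed
qed

text \<open>The derivative of the monomial along the horizontal part of \<open>lift u\<close>. The
  first four summands differentiate along \<open>lift u\<close> itself; the last one removes the
  vertical part, along which equivariance makes the monomial an eigenfunction with a factor
  proportional to \<open>N\<close>.\<close>

definition E :: "real^3 \<Rightarrow> nat \<Rightarrow> nat \<Rightarrow> nat \<Rightarrow> nat \<Rightarrow> complex \<times> complex \<Rightarrow> complex" where
  "E u a b c d p = (let x = fst p; y = snd p; X = cnj x; Y = cnj y; w = fst (lift u p); z = snd (lift u p) in
      w * (of_nat a * x ^ (a - 1)) * y ^ b * X ^ c * Y ^ d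
    + z * (of_nat b * y ^ (b - 1)) * x ^ a * X ^ c * Y ^ d
    + cnj w * (of_nat c * X ^ (c - 1)) * x ^ a * y ^ b * Y ^ d
    + cnj z * (of_nat d * Y ^ (d - 1)) * x ^ a * y ^ b * X ^ c
    + \<i> / 2 * of_nat N * of_real (u \<bullet> hopf 1 p) * (x ^ a * y ^ b * X ^ c * Y ^ d))"

lemma D_leibniz_affine2:
  assumes "s \<in> sections N" "p \<in> S3" "v \<in> tangent_space (hopf R p)"
  shows "D (\<lambda>q. (k + l * complex_of_real (hopf R q $ i) + m * complex_of_real (hopf R q $ j)) * s q) p v
      = (l * of_real (v$i) + m * of_real (v$j)) * s p
        + (k + l * complex_of_real (hopf R p $ i) + m * complex_of_real (hopf R p $ j)) * D s p v"
proof -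
  have d: "((\<lambda>x::real^3. (k + l * complex_of_real (x$i)) + (0 + m * complex_of_real (x$j))) has_derivative (\<lambda>v. l * of_real (v$i) + m * of_real (v$j))) F" for F
    by (rule has_derivative_add[OF has_derivative_affine has_derivative_affine])
  then have "sphere_deriv (\<lambda>x. k + l * complex_of_real (x$i) + m * complex_of_real (x$j)) (hopf R p) v = l * of_real (v$i) + m * of_real (v$j)"
    by (intro sphere_deriv_eq[OF hopf_nonzero[OF R_pos assms(2)]])
       (use assms(3) in \<open>simp_all add: tangent_space_def\<close>)
  moreover have "smooth_on (sphere 0 R) (\<lambda>x::real^3. (k + l * complex_of_real (x$i)) + (0 + m * complex_of_real (x$j)))"
    by (intro smooth_on_add[OF smooth_on_affine smooth_on_affine])
  ultimately show ?thesis
    using D_leibniz[OF assms(1) _ assms(2,3), of "\<lambda>x. k + l * complex_of_real (x$i) + m * complex_of_real (x$j)"] by simp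
qed

text \<open>Induction on the number of unconjugated factors. With none left, the monomial is a
  product of \<open>N\<close> sections of \<open>L\<close>, where the induced connection is
  prescribed. Otherwise a product of an unconjugated and a conjugated coordinate is split off; it is
  an affine function of the base point, so the Leibniz rule applies.\<close>

lemma D_Q:
  assumes p: "p \<in> S3" and w: "c + d = N + a + b"
  shows "D (Q a b c d) p (cross3 u (hopf R p)) = g (hopf R p) ^ N * E u a b c d p"
  using w
proof (induction "a + b" arbitrary: a b c d)
  case 0
  then have ab: "a = 0" "b = 0" and cd: "c + d = N" by auto
  define s where "s i = (\<lambda>q. g (hopf R q) * (if i < c then c1 else c2) q)" for i
  have s1: "s i \<in> sections 1" for i
    unfolding s_def using sections_hopf_mult[OF R_pos g_smooth_on c12_sections(1)]
      sections_hopf_mult[OF R_pos g_smooth_on c12_sections(2)] by auto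
  have Q: "Q a b c d = (\<lambda>q. \<Prod>i<N. s i q)"
  proof
    fix q
    show "Q a b c d q = (\<Prod>i<N. s i q)"
    proof (cases "q \<in> S3")
      case True
      have "(\<Prod>i<N. s i q) = (\<Prod>i<c + d. if i < c then g (hopf R q) * cnj (fst q) else g (hopf R q) * cnj (snd q))"
        unfolding cd s_def using c12_S3[OF True] by (intro prod.cong) auto
      then show ?thesis
        unfolding prod_two_valued using Q_S3[OF True, of c d a b] ab
        by (simp add: power_mult_distrib power_add flip: cd)
    next
      \<comment> \<open>Off the 3-sphere the product vanishes because it has at least one factor;
        here \<open>N \<ge> 1\<close> enters.\<close>
      case False
      then show ?thesis using N_pos by (auto simp: Q_off s_def c1_def c2_def prod_zero_iff lessThan_empty_iff intro!: exI[of _ 0] simp del: mem_sphere mem_sphere_0)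
    qed
  qed
  let ?G = "g (hopf R p)"
  have "D (Q a b c d) p (cross3 u (hopf R p))
      = (\<Sum>i<N. nabla (s i) p (cross3 u (hopf R p)) * (\<Prod>j\<in>{..<N} - {i}. s j p))"
    unfolding Q using induced s1 p cross_tangent unfolding induced_connection_def by blast
  also have "\<dots> = (\<Sum>i<c + d. (if i < c then ?G * std1 u p else ?G * std2 u p)
      * (\<Prod>j\<in>{..<c + d} - {i}. if j < c then ?G * cnj (fst p) else ?G * cnj (snd p)))"
    unfolding cd
  proof (intro sum.cong refl arg_cong2[of _ _ _ _ "(*)"] prod.cong)
    fix i
    show "nabla (s i) p (cross3 u (hopf R p)) = (if i < c then ?G * std1 u p else ?G * std2 u p)"
      using g1[OF p, of u] g2[OF p, of u] by (simp add: s_def)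
    show "s i p = (if i < c then ?G * cnj (fst p) else ?G * cnj (snd p))"
      using c12_S3[OF p] by (simp add: s_def)
  qed
  also have "\<dots> = ?G ^ N * E u a b c d p"
    unfolding sum_prod_two_valued
  proof -
    have e: "of_nat c * (?G * std1 u p) * (?G * cnj (fst p)) ^ (c - 1) * (?G * cnj (snd p)) ^ d
        = ?G ^ N * (of_nat c * std1 u p * cnj (fst p) ^ (c - 1) * cnj (snd p) ^ d)"
      by (cases c) (auto simp: power_mult_distrib power_add simp flip: cd)
    have e': "of_nat d * (?G * std2 u p) * (?G * cnj (fst p)) ^ c * (?G * cnj (snd p)) ^ (d - 1)
        = ?G ^ N * (of_nat d * std2 u p * cnj (fst p) ^ c * cnj (snd p) ^ (d - 1))"
      by (cases d) (auto simp: power_mult_distrib power_add simp flip: cd)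
    have f: "of_nat c * std1 u p * cnj (fst p) ^ (c - 1) = cnj (fst (lift u p)) * (of_nat c * cnj (fst p) ^ (c - 1))
        + of_nat c * (\<i> / 2 * of_real (u \<bullet> hopf 1 p)) * cnj (fst p) ^ c"
      by (cases c) (auto simp: std1_def algebra_simps)
    have f': "of_nat d * std2 u p * cnj (snd p) ^ (d - 1) = cnj (snd (lift u p)) * (of_nat d * cnj (snd p) ^ (d - 1))
        + of_nat d * (\<i> / 2 * of_real (u \<bullet> hopf 1 p)) * cnj (snd p) ^ d"
      by (cases d) (auto simp: std2_def algebra_simps)
    have n: "complex_of_nat N = of_nat c + of_nat d" by (simp flip: cd)
    have "of_nat d * std2 u p * cnj (fst p) ^ c * cnj (snd p) ^ (d - 1) = (of_nat d * std2 u p * cnj (snd p) ^ (d - 1)) * cnj (fst p) ^ c"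
      by (simp only: mult_ac)
    then show "of_nat c * (?G * std1 u p) * (?G * cnj (fst p)) ^ (c - 1) * (?G * cnj (snd p)) ^ d
       + of_nat d * (?G * std2 u p) * (?G * cnj (fst p)) ^ c * (?G * cnj (snd p)) ^ (d - 1) = ?G ^ N * E u a b c d p"
      unfolding e e' f
      by (simp only: f') (simp add: E_def Let_def ab n algebra_simps)
  qed
  finally show ?case .
next
  case (Suc k)
  define v where "v = cross3 u (hopf R p)"
  have vt: "v \<in> tangent_space (hopf R p)" by (simp add: v_def cross_tangent)
  let ?r = "complex_of_real (1 / (2 * R))"
  have hR: "?r * complex_of_real (hopf R q $ i) = complex_of_real (hopf 1 q $ i) / 2" for q i
    using R_pos by (simp add: hopf_scale[of R])
  define W where "W i = complex_of_real (cross3 u (hopf 1 p) $ i)" for i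
  have vR: "?r * complex_of_real (v $ i) = W i / 2" for i
    using R_pos by (simp add: v_def W_def hopf_scale[of R] cross_mult_right)
  define x y X Y where "x = fst p" "y = snd p" "X = cnj (fst p)" "Y = cnj (snd p)"
  have one: "x * X + y * Y = 1" using p unfolding S3_iff_complex by (simp add: x_y_X_Y_def)
  define w z w' z' where "w = fst (lift u p)" "z = snd (lift u p)" "w' = cnj (fst (lift u p))" "z' = cnj (snd (lift u p))"
  let ?G = "g (hopf R p) ^ N"
  have i: "\<i> * \<i> = -1" by simp
  have step: "D (Q a b c d) p v = ?G * ((l * W i + m * W j) / 2 * (x ^ a' * y ^ b' * X ^ c' * Y ^ d') + e * E u a' b' c' d' p)"
    if "a' + b' = k" "c' + d' = N + a' + b'"
      and e: "\<And>q. q \<in> S3 \<Longrightarrow> Q a b c d q = (n + l * (complex_of_real (hopf 1 q $ i) / 2) + m * (complex_of_real (hopf 1 q $ j) / 2)) * Q a' b' c' d' q"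
      and e': "e = n + l * (complex_of_real (hopf 1 p $ i) / 2) + m * (complex_of_real (hopf 1 p $ j) / 2)"
    for a' b' c' d' n l m i j e
  proof -
    have "Q a b c d = (\<lambda>q. (n + (l * ?r) * complex_of_real (hopf R q $ i) + (m * ?r) * complex_of_real (hopf R q $ j)) * Q a' b' c' d' q)"
    proof
      fix q
      show "Q a b c d q = (n + (l * ?r) * complex_of_real (hopf R q $ i) + (m * ?r) * complex_of_real (hopf R q $ j)) * Q a' b' c' d' q"
      proof (cases "q \<in> S3")
        case True
        then show ?thesis unfolding mult.assoc[of _ ?r] hR by (rule e)
      next
        case False
        show ?thesis unfolding Q_off[OF False] by simp
      qed
    qed
    then have "D (Q a b c d) p v = ((l * ?r) * of_real (v$i) + (m * ?r) * of_real (v$j)) * Q a' b' c' d' p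
        + (n + (l * ?r) * complex_of_real (hopf R p $ i) + (m * ?r) * complex_of_real (hopf R p $ j)) * D (Q a' b' c' d') p v"
      by (simp only: D_leibniz_affine2[OF Q_section p vt])
    also have "D (Q a' b' c' d') p v = ?G * E u a' b' c' d' p"
      unfolding v_def using Suc.hyps(1)[of a' b' c' d'] that by simp
    also have "Q a' b' c' d' p = ?G * (x ^ a' * y ^ b' * X ^ c' * Y ^ d')"
      using Q_S3[OF p that(2)] by (simp add: x_y_X_Y_def)
    finally show ?thesis unfolding mult.assoc[of _ ?r] hR vR e'[symmetric]
      by (simp add: algebra_simps add_divide_distrib)
  qed
  \<comment> \<open>These identities say that \<open>lift u\<close> projects to the rotation field:
    their right-hand sides come from the product rule for h3, for the squared norm and for h1 + \<i>
    h2 and h1 - \<i> h2, with h the Hopf coordinates.\<close>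
  have lf: "W 3 = w * X + x * w' - z * Y - y * z'" "w * X + x * w' + z * Y + y * z' = 0"
    "W 1 + \<i> * W 2 = 2 * (w * Y + x * z')" "W 1 - \<i> * W 2 = 2 * (z * X + y * w')"
  proof -
    define a1 a2 a3 where "a1 = complex_of_real (u$1)" "a2 = complex_of_real (u$2)" "a3 = complex_of_real (u$3)"
    have h: "complex_of_real (hopf 1 p $ 1) = x * Y + y * X" "complex_of_real (hopf 1 p $ 2) = - \<i> * (x * Y - y * X)"
      "complex_of_real (hopf 1 p $ 3) = x * X - y * Y"
      unfolding hopf_complex x_y_X_Y_def by simp_all
    have WW: "W 1 = a2 * (x * X - y * Y) - a3 * (- \<i> * (x * Y - y * X))" "W 2 = a3 * (x * Y + y * X) - a1 * (x * X - y * Y)"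
      "W 3 = a1 * (- \<i> * (x * Y - y * X)) - a2 * (x * Y + y * X)"
      unfolding W_def h[symmetric] a1_a2_a3_def by (simp_all add: cross3_def)
    have ww: "w = \<i> / 2 * (a3 * x + (a1 + \<i> * a2) * y)" "z = \<i> / 2 * ((a1 - \<i> * a2) * x - a3 * y)"
      "w' = - \<i> / 2 * (a3 * X + (a1 - \<i> * a2) * Y)" "z' = - \<i> / 2 * ((a1 + \<i> * a2) * X - a3 * Y)"
      by (simp_all add: w_z_w'_z'_def lift_def Complex_as_sum a1_a2_a3_def x_y_X_Y_def)
    show "W 3 = w * X + x * w' - z * Y - y * z'" "w * X + x * w' + z * Y + y * z' = 0"
      "W 1 + \<i> * W 2 = 2 * (w * Y + x * z')" "W 1 - \<i> * W 2 = 2 * (z * X + y * w')"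
      unfolding WW ww by (simp_all add: field_simps i)
  qed
  have pw: "of_nat (Suc n) * t ^ (Suc n - 1) = t ^ n + t * (of_nat n * t ^ (n - 1))" for t :: complex and n
    by (cases n) (simp_all add: algebra_simps)
  have Eexp: "E u a b c d p = w * (of_nat a * x ^ (a - 1)) * y ^ b * X ^ c * Y ^ d
    + z * (of_nat b * y ^ (b - 1)) * x ^ a * X ^ c * Y ^ d
    + w' * (of_nat c * X ^ (c - 1)) * x ^ a * y ^ b * Y ^ d
    + z' * (of_nat d * Y ^ (d - 1)) * x ^ a * y ^ b * X ^ c
    + \<i> / 2 * of_nat N * of_real (u \<bullet> hopf 1 p) * (x ^ a * y ^ b * X ^ c * Y ^ d)" for a b c d
    by (simp add: E_def Let_def x_y_X_Y_def w_z_w'_z'_def)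
  have prods: "fst q * cnj (fst q) = 1 / 2 + 1 * (complex_of_real (hopf 1 q $ 3) / 2) + 0 * (complex_of_real (hopf 1 q $ 3) / 2)"
     "snd q * cnj (snd q) = 1 / 2 + (-1) * (complex_of_real (hopf 1 q $ 3) / 2) + 0 * (complex_of_real (hopf 1 q $ 3) / 2)"
     "fst q * cnj (snd q) = 0 + 1 * (complex_of_real (hopf 1 q $ 1) / 2) + \<i> * (complex_of_real (hopf 1 q $ 2) / 2)"
     "snd q * cnj (fst q) = 0 + 1 * (complex_of_real (hopf 1 q $ 1) / 2) + (-\<i>) * (complex_of_real (hopf 1 q $ 2) / 2)"
    if "q \<in> S3" for q
    unfolding hopf_complex using that[unfolded S3_iff_complex]
    by (simp_all add: field_simps)
  have dxX: "(1 * W 3 + 0 * W 3) / 2 = w * X + x * w'" "((-1) * W 3 + 0 * W 3) / 2 = z * Y + y * z'"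
    "(1 * W 1 + \<i> * W 2) / 2 = w * Y + x * z'" "(1 * W 1 + (-\<i>) * W 2) / 2 = z * X + y * w'"
    using lf by (simp_all add: field_simps) algebra+
  note unf = x_y_X_Y_def[symmetric]
  \<comment> \<open>The equivariance condition \<open>c + d = N + a + b\<close> guarantees a
    conjugated factor to pair with the unconjugated one.\<close>
  consider (1) a' c' where "a = Suc a'" "c = Suc c'" | (2) a' d' where "a = Suc a'" "d = Suc d'"
    | (3) b' c' where "b = Suc b'" "c = Suc c'" | (4) b' d' where "b = Suc b'" "d = Suc d'"
    using Suc.hyps(2) Suc.prems by (cases a; cases b; cases c; cases d) auto
  then show ?case
  proof cases
    case 1
    have q: "Q a b c d q = (1 / 2 + 1 * (complex_of_real (hopf 1 q $ 3) / 2) + 0 * (complex_of_real (hopf 1 q $ 3) / 2)) * Q a' b c' d q" if "q \<in> S3" for q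
      unfolding prods(1)[OF that, symmetric]
      using Q_S3[OF that] Suc.prems 1 by simp
    have "D (Q a b c d) p v = ?G * (((1 * W 3 + 0 * W 3) / 2) * (x ^ a' * y ^ b * X ^ c' * Y ^ d) + x * X * E u a' b c' d p)"
      by (rule step[OF _ _ q]) (use Suc.hyps(2) Suc.prems 1 prods(1)[OF p] in \<open>simp_all add: x_y_X_Y_def\<close>)
    also have "\<dots> = ?G * E u a b c d p"
      unfolding dxX Eexp 1 pw by (simp add: algebra_simps)
    finally show ?thesis by (simp add: v_def)
  next
    case 2
    have q: "Q a b c d q = (0 + 1 * (complex_of_real (hopf 1 q $ 1) / 2) + \<i> * (complex_of_real (hopf 1 q $ 2) / 2)) * Q a' b c d' q" if "q \<in> S3" for q
      unfolding prods(3)[OF that, symmetric]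
      using Q_S3[OF that] Suc.prems 2 by simp
    have "D (Q a b c d) p v = ?G * (((1 * W 1 + \<i> * W 2) / 2) * (x ^ a' * y ^ b * X ^ c * Y ^ d') + x * Y * E u a' b c d' p)"
      by (rule step[OF _ _ q]) (use Suc.hyps(2) Suc.prems 2 prods(3)[OF p] in \<open>simp_all add: x_y_X_Y_def\<close>)
    also have "\<dots> = ?G * E u a b c d p"
      unfolding dxX Eexp 2 pw by (simp add: algebra_simps)
    finally show ?thesis by (simp add: v_def)
  next
    case 3
    have q: "Q a b c d q = (0 + 1 * (complex_of_real (hopf 1 q $ 1) / 2) + (-\<i>) * (complex_of_real (hopf 1 q $ 2) / 2)) * Q a b' c' d q" if "q \<in> S3" for q
      unfolding prods(4)[OF that, symmetric]
      using Q_S3[OF that] Suc.prems 3 by simp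
    have "D (Q a b c d) p v = ?G * (((1 * W 1 + (-\<i>) * W 2) / 2) * (x ^ a * y ^ b' * X ^ c' * Y ^ d) + y * X * E u a b' c' d p)"
      by (rule step[OF _ _ q]) (use Suc.hyps(2) Suc.prems 3 prods(4)[OF p] in \<open>simp_all add: x_y_X_Y_def\<close>)
    also have "\<dots> = ?G * E u a b c d p"
      unfolding dxX Eexp 3 pw by (simp add: algebra_simps)
    finally show ?thesis by (simp add: v_def)
  next
    case 4
    have q: "Q a b c d q = (1 / 2 + (-1) * (complex_of_real (hopf 1 q $ 3) / 2) + 0 * (complex_of_real (hopf 1 q $ 3) / 2)) * Q a b' c d' q" if "q \<in> S3" for q
      unfolding prods(2)[OF that, symmetric]
      using Q_S3[OF that] Suc.prems 4 by simp
    have "D (Q a b c d) p v = ?G * ((((-1) * W 3 + 0 * W 3) / 2) * (x ^ a * y ^ b' * X ^ c * Y ^ d') + y * Y * E u a b' c d' p)"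
      by (rule step[OF _ _ q]) (use Suc.hyps(2) Suc.prems 4 prods(2)[OF p] in \<open>simp_all add: x_y_X_Y_def\<close>)
    also have "\<dots> = ?G * E u a b c d p"
      unfolding dxX Eexp 4 pw by (simp add: algebra_simps)
    finally show ?thesis by (simp add: v_def)
  qed
qed

end

section \<open>Ladder operators and the action of the Laplacian on monomials\<close>

context gauged
begin

lemma nab_zero: "nab u (\<lambda>q. 0) = (\<lambda>q. 0)"
  using nab_scale[OF sections_zero, of u 0] by simp

lemma nab_Q:
  assumes "q \<in> S3" "c + d = N + a + b"
  shows "nab u (Q a b c d) q = g (hopf R q) ^ N * E u a b c d q"
  using D_Q[OF assms] nab_apply[OF assms(1)] by simp

lemma nab_comb:
  assumes "s \<in> sections N" "t \<in> sections N" "r \<in> sections N"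
  shows "nab u (\<lambda>q. k * (x * s q - y * t q + z * r q)) = (\<lambda>q. k * (x * nab u s q - y * nab u t q + z * nab u r q))"
proof -
  note sec = sections_scale[OF assms(1)] sections_scale[OF assms(2)] sections_scale[OF assms(3)]
  have "(\<lambda>q. k * (x * s q - y * t q + z * r q)) = (\<lambda>q. (k * x) * s q + ((- k * y) * t q + (k * z) * r q))"
    by (simp add: algebra_simps)
  then show ?thesis
    by (simp only: nab_add[OF sec(1) sections_add[OF sec(2,3)]] nab_add[OF sec(2,3)] nab_scale assms)
       (simp add: algebra_simps)
qed

abbreviation "e\<^sub>1 \<equiv> axis 1 1 :: real^3"
abbreviation "e\<^sub>2 \<equiv> axis 2 1 :: real^3"
abbreviation "e\<^sub>3 \<equiv> axis 3 1 :: real^3"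

text \<open>This combination and \<open>lower\<close> shift the weight \<open>a - c\<close> of a
  monomial by +1 and -1, whereas \<open>nab e\<^sub>3\<close> preserves it. In each of them half of
  the derivative terms of \<open>E\<close> cancel, which keeps the later expansion short.\<close>

definition raise :: "bundle_section \<Rightarrow> bundle_section" where
  "raise s = (\<lambda>q. nab e\<^sub>1 s q + \<i> * nab e\<^sub>2 s q)"

definition lower :: "bundle_section \<Rightarrow> bundle_section" where
  "lower s = (\<lambda>q. nab e\<^sub>1 s q - \<i> * nab e\<^sub>2 s q)"

lemma axis_nth3: "e\<^sub>1 $ 1 = 1" "e\<^sub>1 $ 2 = 0" "e\<^sub>1 $ 3 = 0" "e\<^sub>2 $ 1 = 0" "e\<^sub>2 $ 2 = 1" "e\<^sub>2 $ 3 = 0"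
   "e\<^sub>3 $ 1 = 0" "e\<^sub>3 $ 2 = 0" "e\<^sub>3 $ 3 = 1"
  by (simp_all add: axis_def)

lemma E_axes:
  fixes q :: "complex \<times> complex"
  defines "x \<equiv> fst q" and "y \<equiv> snd q" and "X \<equiv> cnj (fst q)" and "Y \<equiv> cnj (snd q)"
  shows "E e\<^sub>1 a b c d q + \<i> * E e\<^sub>2 a b c d q = \<i> * ((of_nat b * y ^ (b - 1)) * x * x ^ a * X ^ c * Y ^ d
      - (of_nat c * X ^ (c - 1)) * Y * x ^ a * y ^ b * Y ^ d + of_nat N * (x * Y) * (x ^ a * y ^ b * X ^ c * Y ^ d))"
    and "E e\<^sub>1 a b c d q - \<i> * E e\<^sub>2 a b c d q = \<i> * ((of_nat a * x ^ (a - 1)) * y * y ^ b * X ^ c * Y ^ d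
      - (of_nat d * Y ^ (d - 1)) * X * x ^ a * y ^ b * X ^ c + of_nat N * (y * X) * (x ^ a * y ^ b * X ^ c * Y ^ d))"
    and "E e\<^sub>3 a b c d q = \<i> / 2 * ((of_nat a * x ^ (a - 1)) * x * y ^ b * X ^ c * Y ^ d
      - (of_nat b * y ^ (b - 1)) * y * x ^ a * X ^ c * Y ^ d - (of_nat c * X ^ (c - 1)) * X * x ^ a * y ^ b * Y ^ d
      + (of_nat d * Y ^ (d - 1)) * Y * x ^ a * y ^ b * X ^ c
      + of_nat N * (x * X - y * Y) * (x ^ a * y ^ b * X ^ c * Y ^ d))"
proof -
  have l: "lift e\<^sub>1 q = (\<i> / 2 * y, \<i> / 2 * x)" "lift e\<^sub>2 q = (- y / 2, x / 2)" "lift e\<^sub>3 q = (\<i> / 2 * x, - \<i> / 2 * y)"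
    by (simp_all add: lift_def axis_nth3 x_def y_def Complex_as_sum)
  have in1: "e\<^sub>1 \<bullet> hopf 1 q = hopf 1 q $ 1" "e\<^sub>2 \<bullet> hopf 1 q = hopf 1 q $ 2" "e\<^sub>3 \<bullet> hopf 1 q = hopf 1 q $ 3"
    by (simp_all add: inner_axis')
  have h: "complex_of_real (hopf 1 q $ 1) = x * Y + y * X" "complex_of_real (hopf 1 q $ 2) = - \<i> * (x * Y - y * X)"
    "complex_of_real (hopf 1 q $ 3) = x * X - y * Y"
    unfolding hopf_complex x_def y_def X_def Y_def by simp_all
  have i: "\<i> * \<i> = -1" "\<i> * (\<i> * z) = - z" for z by (simp_all flip: mult.assoc)
  have c: "cnj x = X" "cnj y = Y" by (simp_all add: x_def y_def X_def Y_def)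
  define Da Db Dc Dd where "Da = of_nat a * x ^ (a - 1)" "Db = of_nat b * y ^ (b - 1)"
    "Dc = of_nat c * X ^ (c - 1)" "Dd = of_nat d * Y ^ (d - 1)"
  note E = E_def Let_def x_def[symmetric] y_def[symmetric] l in1 fst_conv snd_conv h c complex_cnj_mult complex_cnj_divide complex_cnj_i complex_cnj_numeral complex_cnj_minus Da_Db_Dc_Dd_def[symmetric]
  show "E e\<^sub>1 a b c d q + \<i> * E e\<^sub>2 a b c d q = \<i> * ((of_nat b * y ^ (b - 1)) * x * x ^ a * X ^ c * Y ^ d
      - (of_nat c * X ^ (c - 1)) * Y * x ^ a * y ^ b * Y ^ d + of_nat N * (x * Y) * (x ^ a * y ^ b * X ^ c * Y ^ d))"
    unfolding E by (simp add: field_simps i)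
  show "E e\<^sub>1 a b c d q - \<i> * E e\<^sub>2 a b c d q = \<i> * ((of_nat a * x ^ (a - 1)) * y * y ^ b * X ^ c * Y ^ d
      - (of_nat d * Y ^ (d - 1)) * X * x ^ a * y ^ b * X ^ c + of_nat N * (y * X) * (x ^ a * y ^ b * X ^ c * Y ^ d))"
    unfolding E by (simp add: field_simps i)
  show "E e\<^sub>3 a b c d q = \<i> / 2 * ((of_nat a * x ^ (a - 1)) * x * y ^ b * X ^ c * Y ^ d
      - (of_nat b * y ^ (b - 1)) * y * x ^ a * X ^ c * Y ^ d - (of_nat c * X ^ (c - 1)) * X * x ^ a * y ^ b * Y ^ d
      + (of_nat d * Y ^ (d - 1)) * Y * x ^ a * y ^ b * X ^ c
      + of_nat N * (x * X - y * Y) * (x ^ a * y ^ b * X ^ c * Y ^ d))"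
    unfolding E by (simp add: field_simps i)
qed

text \<open>Valid for all exponents: where a subtraction truncates, its coefficient is 0, and where
  the equivariance condition fails, every term is 0.\<close>

lemma raise_Q: "raise (Q a b c d) = (\<lambda>q. \<i> * (of_nat b * Q (a + 1) (b - 1) c d q
    - of_nat c * Q a b (c - 1) (d + 1) q + of_nat N * Q (a + 1) b c (d + 1) q))"
  and lower_Q: "lower (Q a b c d) = (\<lambda>q. \<i> * (of_nat a * Q (a - 1) (b + 1) c d q
    - of_nat d * Q a b (c + 1) (d - 1) q + of_nat N * Q a (b + 1) (c + 1) d q))"
  and nab3_Q: "nab e\<^sub>3 (Q a b c d) = (\<lambda>q. \<i> / 2 * ((of_nat a - of_nat b - of_nat c + of_nat d) * Q a b c d q
    - of_nat N * Q a (b + 1) c (d + 1) q + of_nat N * Q (a + 1) b (c + 1) d q))"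
proof -
  have "raise (Q a b c d) q = \<i> * (of_nat b * Q (a + 1) (b - 1) c d q
      - of_nat c * Q a b (c - 1) (d + 1) q + of_nat N * Q (a + 1) b c (d + 1) q) \<and>
    lower (Q a b c d) q = \<i> * (of_nat a * Q (a - 1) (b + 1) c d q
      - of_nat d * Q a b (c + 1) (d - 1) q + of_nat N * Q a (b + 1) (c + 1) d q) \<and>
    nab e\<^sub>3 (Q a b c d) q = \<i> / 2 * ((of_nat a - of_nat b - of_nat c + of_nat d) * Q a b c d q
      - of_nat N * Q a (b + 1) c (d + 1) q + of_nat N * Q (a + 1) b (c + 1) d q)" for q
  proof (cases "q \<in> S3 \<and> c + d = N + a + b")
    case True
    then have q: "q \<in> S3" and w: "c + d = N + a + b" by auto
    define G where "G = g (hopf R q) ^ N"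
    have b: "of_nat b * Q (a + 1) (b - 1) c d q = G * ((of_nat b * snd q ^ (b - 1)) * fst q * fst q ^ a * cnj (fst q) ^ c * cnj (snd q) ^ d)"
      using w Q_S3[OF q] by (cases b) (auto simp: G_def)
    have c: "of_nat c * Q a b (c - 1) (d + 1) q = G * ((of_nat c * cnj (fst q) ^ (c - 1)) * cnj (snd q) * fst q ^ a * snd q ^ b * cnj (snd q) ^ d)"
      using w Q_S3[OF q] by (cases c) (auto simp: G_def)
    have a: "of_nat a * Q (a - 1) (b + 1) c d q = G * ((of_nat a * fst q ^ (a - 1)) * snd q * snd q ^ b * cnj (fst q) ^ c * cnj (snd q) ^ d)"
      using w Q_S3[OF q] by (cases a) (auto simp: G_def)
    have d: "of_nat d * Q a b (c + 1) (d - 1) q = G * ((of_nat d * cnj (snd q) ^ (d - 1)) * cnj (fst q) * fst q ^ a * snd q ^ b * cnj (fst q) ^ c)"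
      using w Q_S3[OF q] by (cases d) (auto simp: G_def)
    have o: "Q (a + 1) b c (d + 1) q = G * (fst q * cnj (snd q) * (fst q ^ a * snd q ^ b * cnj (fst q) ^ c * cnj (snd q) ^ d))"
      "Q a (b + 1) (c + 1) d q = G * (snd q * cnj (fst q) * (fst q ^ a * snd q ^ b * cnj (fst q) ^ c * cnj (snd q) ^ d))"
      "Q (a + 1) b (c + 1) d q = G * (fst q * cnj (fst q) * (fst q ^ a * snd q ^ b * cnj (fst q) ^ c * cnj (snd q) ^ d))"
      "Q a (b + 1) c (d + 1) q = G * (snd q * cnj (snd q) * (fst q ^ a * snd q ^ b * cnj (fst q) ^ c * cnj (snd q) ^ d))"
      "Q a b c d q = G * (fst q ^ a * snd q ^ b * cnj (fst q) ^ c * cnj (snd q) ^ d)"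
      using w Q_S3[OF q] by (auto simp: G_def)
    have t: "(of_nat n * z ^ (n - 1)) * z = of_nat n * z ^ n" for n and z :: complex by (cases n) auto
    have e1: "raise (Q a b c d) q = G * (E e\<^sub>1 a b c d q + \<i> * E e\<^sub>2 a b c d q)"
      and e2: "lower (Q a b c d) q = G * (E e\<^sub>1 a b c d q - \<i> * E e\<^sub>2 a b c d q)"
      and e3: "nab e\<^sub>3 (Q a b c d) q = G * E e\<^sub>3 a b c d q"
      unfolding raise_def lower_def nab_Q[OF q w] G_def by (simp_all add: algebra_simps)
    show ?thesis
      unfolding e1 e2 e3 E_axes t a b c d by (simp only: o) (simp add: algebra_simps)
  next
    case False
    then consider "q \<notin> S3" | "c + d \<noteq> N + a + b" by blast
    then show ?thesis
    proof cases
      case 1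
      then show ?thesis using nab_outside Q_off by (simp add: raise_def lower_def del: mem_sphere mem_sphere_0)
    next
      case 2
      have "of_nat b * Q (a + 1) (b - 1) c d q = 0" using 2 by (cases b) (auto simp: Q_wrong)
      moreover have "of_nat c * Q a b (c - 1) (d + 1) q = 0" using 2 by (cases c) (auto simp: Q_wrong)
      moreover have "of_nat a * Q (a - 1) (b + 1) c d q = 0" using 2 by (cases a) (auto simp: Q_wrong)
      moreover have "of_nat d * Q a b (c + 1) (d - 1) q = 0" using 2 by (cases d) (auto simp: Q_wrong)
      moreover have "Q a b c d = (\<lambda>q. 0)" using 2 by (rule Q_wrong)
      ultimately show ?thesis using 2 by (auto simp: raise_def lower_def nab_zero Q_wrong)
    qed
  qed
  then show "raise (Q a b c d) = (\<lambda>q. \<i> * (of_nat b * Q (a + 1) (b - 1) c d q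
      - of_nat c * Q a b (c - 1) (d + 1) q + of_nat N * Q (a + 1) b c (d + 1) q))"
    "lower (Q a b c d) = (\<lambda>q. \<i> * (of_nat a * Q (a - 1) (b + 1) c d q
      - of_nat d * Q a b (c + 1) (d - 1) q + of_nat N * Q a (b + 1) (c + 1) d q))"
    "nab e\<^sub>3 (Q a b c d) = (\<lambda>q. \<i> / 2 * ((of_nat a - of_nat b - of_nat c + of_nat d) * Q a b c d q
      - of_nat N * Q a (b + 1) c (d + 1) q + of_nat N * Q (a + 1) b (c + 1) d q))"
    by blast+
qed

lemma raise_comb:
  assumes "s \<in> sections N" "t \<in> sections N" "r \<in> sections N"
  shows "raise (\<lambda>q. k * (x * s q - y * t q + z * r q)) = (\<lambda>q. k * (x * raise s q - y * raise t q + z * raise r q))"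
    and lower_comb: "lower (\<lambda>q. k * (x * s q - y * t q + z * r q)) = (\<lambda>q. k * (x * lower s q - y * lower t q + z * lower r q))"
  unfolding raise_def lower_def nab_comb[OF assms] by (simp_all add: algebra_simps)

text \<open>Symmetrising the product of \<open>raise\<close> and \<open>lower\<close> cancels the
  commutator of the derivatives along the first two axes.\<close>

lemma sum_nab_nab:
  assumes s: "s \<in> sections N"
  shows "(\<Sum>i\<in>UNIV. nab (axis i 1) (nab (axis i 1) s) q)
    = (lower (raise s) q + raise (lower s) q) / 2 + nab e\<^sub>3 (nab e\<^sub>3 s) q"
proof -
  note c = nab_closed[OF s, of e\<^sub>1] nab_closed[OF s, of e\<^sub>2]
  have r: "nab u (raise s) = (\<lambda>q. nab u (nab e\<^sub>1 s) q + \<i> * nab u (nab e\<^sub>2 s) q)" for u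
    unfolding raise_def by (simp only: nab_add[OF c(1) sections_scale[OF c(2)]] nab_scale[OF c(2)])
  have l: "nab u (lower s) = (\<lambda>q. nab u (nab e\<^sub>1 s) q - \<i> * nab u (nab e\<^sub>2 s) q)" for u
  proof -
    have "lower s = (\<lambda>q. nab e\<^sub>1 s q + (- \<i>) * nab e\<^sub>2 s q)" by (simp add: lower_def)
    then show ?thesis by (simp only: nab_add[OF c(1) sections_scale[OF c(2)]] nab_scale[OF c(2)]) simp
  qed
  have i: "\<i> * (\<i> * z) = - z" for z by (simp flip: mult.assoc)
  show ?thesis
    unfolding sum_3 raise_def[of "lower s"] lower_def[of "raise s"] r l by (simp add: algebra_simps i)
qed

text \<open>Monomials of higher bidegree in the expansion are multiples of the given one by
  polynomials in \<open>t\<close>, the squared modulus of the first coordinate, because the other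
  squared modulus is \<open>1 - t\<close>. The dependence on \<open>t\<close> cancels, which leaves
  a diagonal term and two monomials of lower bidegree.\<close>

lemma sum_nab_nab_Q:
  "(\<Sum>i\<in>UNIV. nab (axis i 1) (nab (axis i 1) (Q a b c d)) q)
    = - ((of_nat (a + b) * (of_nat (a + b) + 1) + of_nat N * (2 * of_nat (a + b) + 1) / 2) * Q a b c d q)
      + of_nat a * of_nat c * Q (a - 1) b (c - 1) d q + of_nat b * of_nat d * Q a (b - 1) c (d - 1) q"
proof (cases "q \<in> S3 \<and> c + d = N + a + b")
  case False
  then consider "q \<notin> S3" | "c + d \<noteq> N + a + b" by blast
  then show ?thesis
  proof cases
    case 1
    then show ?thesis by (simp add: nab_outside Q_off del: mem_sphere mem_sphere_0)
  next
    case 2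
    have "of_nat a * of_nat c * Q (a - 1) b (c - 1) d q = 0"
      using 2 by (cases a; cases c) (auto simp: Q_wrong)
    moreover have "of_nat b * of_nat d * Q a (b - 1) c (d - 1) q = 0"
      using 2 by (cases b; cases d) (auto simp: Q_wrong)
    ultimately show ?thesis using 2 by (auto simp: nab_zero Q_wrong)
  qed
next
  case True
  then have q: "q \<in> S3" and w: "c + d = N + a + b" by auto
  define x y X Y where "x = fst q" "y = snd q" "X = cnj (fst q)" "Y = cnj (snd q)"
  have one: "x * X + y * Y = 1" using q unfolding S3_iff_complex by (simp add: x_y_X_Y_def)
  define G where "G = g (hopf R q) ^ N"
  have F: "Q a b c d q = G * (x ^ a * y ^ b * X ^ c * Y ^ d)" if "c + d = N + a + b" for a b c d
    using Q_S3[OF q that] by (simp add: G_def x_y_X_Y_def)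
  have wn: "of_nat c + of_nat d = (of_nat N + of_nat a + of_nat b :: complex)" using w by (metis of_nat_add)
  have S: "(\<Sum>i\<in>UNIV. nab (axis i 1) (nab (axis i 1) (Q a b c d)) q) = H" if "H =
     - ((of_nat b * (of_nat (a + 1) * Q a (b - 1 + 1) c d q - of_nat d * Q (a + 1) (b - 1) (c + 1) (d - 1) q + of_nat N * Q (a + 1) (b - 1 + 1) (c + 1) d q)
      - of_nat c * (of_nat a * Q (a - 1) (b + 1) (c - 1) (d + 1) q - of_nat (d + 1) * Q a b (c - 1 + 1) d q + of_nat N * Q a (b + 1) (c - 1 + 1) (d + 1) q)
      + of_nat N * (of_nat (a + 1) * Q a (b + 1) c (d + 1) q - of_nat (d + 1) * Q (a + 1) b (c + 1) d q + of_nat N * Q (a + 1) (b + 1) (c + 1) (d + 1) q))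
     + (of_nat a * (of_nat (b + 1) * Q (a - 1 + 1) b c d q - of_nat c * Q (a - 1) (b + 1) (c - 1) (d + 1) q + of_nat N * Q (a - 1 + 1) (b + 1) c (d + 1) q)
      - of_nat d * (of_nat b * Q (a + 1) (b - 1) (c + 1) (d - 1) q - of_nat (c + 1) * Q a b c (d - 1 + 1) q + of_nat N * Q (a + 1) b (c + 1) (d - 1 + 1) q)
      + of_nat N * (of_nat (b + 1) * Q (a + 1) b (c + 1) d q - of_nat (c + 1) * Q a (b + 1) c (d + 1) q + of_nat N * Q (a + 1) (b + 1) (c + 1) (d + 1) q))) / 2
     - ((of_nat a - of_nat b - of_nat c + of_nat d) * ((of_nat a - of_nat b - of_nat c + of_nat d) * Q a b c d q - of_nat N * Q a (b + 1) c (d + 1) q + of_nat N * Q (a + 1) b (c + 1) d q)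
      - of_nat N * ((of_nat a - of_nat b - of_nat c + of_nat d) * Q a (b + 1) c (d + 1) q - of_nat N * Q a (b + 1 + 1) c (d + 1 + 1) q + of_nat N * Q (a + 1) (b + 1) (c + 1) (d + 1) q)
      + of_nat N * ((of_nat a - of_nat b - of_nat c + of_nat d) * Q (a + 1) b (c + 1) d q - of_nat N * Q (a + 1) (b + 1) (c + 1) (d + 1) q + of_nat N * Q (a + 1 + 1) b (c + 1 + 1) d q)) / 4" for H
  proof -
    have ii: "\<i> * (x * (\<i> * p) - y * (\<i> * r) + z * (\<i> * s)) = - (x * p - y * r + z * s)"
      "\<i> / 2 * (x * (\<i> / 2 * p) - y * (\<i> / 2 * r) + z * (\<i> / 2 * s)) = - (x * p - y * r + z * s) / 4"
      for x y z p r s :: complex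
      by (simp_all add: field_simps)
    have kk: "(of_nat a - of_nat (b + 1) - of_nat c + of_nat (d + 1) :: complex) = of_nat a - of_nat b - of_nat c + of_nat d"
      "(of_nat (a + 1) - of_nat b - of_nat (c + 1) + of_nat d :: complex) = of_nat a - of_nat b - of_nat c + of_nat d"
      by simp_all
    show ?thesis
      unfolding sum_nab_nab[OF Q_section] raise_Q lower_Q nab3_Q raise_comb[OF Q_section Q_section Q_section]
        lower_comb[OF Q_section Q_section Q_section] nab_comb[OF Q_section Q_section Q_section] that
        ii kk add_diff_cancel_right'
      by (simp only: minus_add_distrib[symmetric] minus_divide_left[symmetric] diff_conv_add_uminus)
  qed
  define n where "n k = (of_nat k :: complex)" for k
  define P U V t where "P = Q a b c d q" "U = n a * n c * Q (a - 1) b (c - 1) d q"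
    "V = n b * n d * Q a (b - 1) c (d - 1) q" "t = x * X"
  have yY: "y * Y = 1 - t" using one by (simp add: P_U_V_t_def algebra_simps)
  have P: "P = G * (x ^ a * y ^ b * X ^ c * Y ^ d)" using F[OF w] by (simp add: P_U_V_t_def)
  have shift: "Q (a + 1) b (c + 1) d q = t * P" "Q a (b + 1) c (d + 1) q = (1 - t) * P"
    "Q (a + 1) (b + 1) (c + 1) (d + 1) q = t * (1 - t) * P"
    "Q (a + 1 + 1) b (c + 1 + 1) d q = t * t * P" "Q a (b + 1 + 1) c (d + 1 + 1) q = (1 - t) * (1 - t) * P"
    unfolding yY[symmetric] P using w by (simp_all add: F P_U_V_t_def power2_eq_square)
  have tV: "n b * n d * Q (a + 1) (b - 1) (c + 1) (d - 1) q = V - n b * n d * P"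
  proof (cases "b = 0 \<or> d = 0")
    case False
    then obtain b' d' where bd: "b = Suc b'" "d = Suc d'" by (metis not0_implies_Suc)
    have "V - n b * n d * P = n b * n d * (G * (x ^ a * y ^ b' * X ^ c * Y ^ d') * (1 - y * Y))"
      unfolding P using w bd by (simp add: F P_U_V_t_def algebra_simps)
    also have "1 - y * Y = x * X" using one by (simp add: algebra_simps)
    finally show ?thesis using w bd by (simp add: F mult_ac)
  qed (auto simp: n_def P_U_V_t_def)
  have tU: "n a * n c * Q (a - 1) (b + 1) (c - 1) (d + 1) q = U - n a * n c * P"
  proof (cases "a = 0 \<or> c = 0")
    case False
    then obtain a' c' where ac: "a = Suc a'" "c = Suc c'" by (metis not0_implies_Suc)
    have "U - n a * n c * P = n a * n c * (G * (x ^ a' * y ^ b * X ^ c' * Y ^ d) * (1 - x * X))"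
      unfolding P using w ac by (simp add: F P_U_V_t_def algebra_simps)
    also have "1 - x * X = y * Y" using one by (simp add: algebra_simps)
    finally show ?thesis using w ac by (simp add: F mult_ac)
  qed (auto simp: n_def P_U_V_t_def)
  have 1: "n b * (n (a + 1) * Q a (b - 1 + 1) c d q - n d * Q (a + 1) (b - 1) (c + 1) (d - 1) q + n N * Q (a + 1) (b - 1 + 1) (c + 1) d q)
      = n b * (n a + 1) * P + n b * n N * (t * P) - (V - n b * n d * P)"
    unfolding tV[symmetric] shift(1)[symmetric] by (cases b) (simp_all add: n_def P_U_V_t_def algebra_simps)
  have 2: "n c * (n a * Q (a - 1) (b + 1) (c - 1) (d + 1) q - n (d + 1) * Q a b (c - 1 + 1) d q + n N * Q a (b + 1) (c - 1 + 1) (d + 1) q)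
      = (U - n a * n c * P) - n c * (n d + 1) * P + n c * n N * ((1 - t) * P)"
    unfolding tU[symmetric] shift(2)[symmetric] by (cases c) (simp_all add: n_def P_U_V_t_def algebra_simps)
  have 3: "n a * (n (b + 1) * Q (a - 1 + 1) b c d q - n c * Q (a - 1) (b + 1) (c - 1) (d + 1) q + n N * Q (a - 1 + 1) (b + 1) c (d + 1) q)
      = n a * (n b + 1) * P - (U - n a * n c * P) + n a * n N * ((1 - t) * P)"
    unfolding tU[symmetric] shift(2)[symmetric] by (cases a) (simp_all add: n_def P_U_V_t_def algebra_simps)
  have 4: "n d * (n b * Q (a + 1) (b - 1) (c + 1) (d - 1) q - n (c + 1) * Q a b c (d - 1 + 1) q + n N * Q (a + 1) b (c + 1) (d - 1 + 1) q)
      = (V - n b * n d * P) - n d * (n c + 1) * P + n d * n N * (t * P)"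
    unfolding tV[symmetric] shift(1)[symmetric] by (cases d) (simp_all add: n_def P_U_V_t_def algebra_simps)
  \<comment> \<open>Eliminating \<open>N\<close> by the equivariance condition turns the remaining
    claim into a polynomial identity.\<close>
  have nn: "n N = n c + n d - n a - n b" "n (k + 1) = n k + 1" "n (a + b) = n a + n b" for k
    using wn by (simp_all add: n_def)
  show ?thesis
    unfolding S[OF refl] n_def[symmetric] 1 2 3 4 unfolding shift P_U_V_t_def(1)[symmetric] P_U_V_t_def(2)[symmetric] P_U_V_t_def(3)[symmetric] nn
    by (simp add: field_simps)
qed

end

section \<open>The spectrum\<close>

lemma ip_zero_imp:
  assumes "R > 0" "s \<in> sections N" "ip R s s = 0"
  shows "s = (\<lambda>q. 0)"
proof
  fix p
  \<comment> \<open>\<open>s\<close> composed with \<open>fibre_point\<close> need not be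
    continuous; the root of \<open>herm R s s\<close> is continuous and has the same
    modulus.\<close>
  define h where "h x = complex_of_real (sqrt (Re (herm R s s x)))" for x
  have hs: "herm R s s x = h x * cnj (h x)" for x
  proof -
    have "herm R s s x = complex_of_real ((cmod (s (fibre_point R x)))\<^sup>2)"
      unfolding herm_def by (rule complex_norm_square[symmetric])
    then show ?thesis by (simp add: h_def power2_eq_square flip: of_real_mult)
  qed
  have c: "continuous_on (sphere 0 R) h"
    unfolding h_def by (intro continuous_intros continuous_herm[OF assms(1,2,2)])
  have "sphere_integral R (\<lambda>x. h x * cnj (h x)) = 0"
    using assms(3) unfolding ip_def hs[abs_def] .
  note z = sphere_integral_zero_imp[OF assms(1) c this]
  show "s p = 0"
  proof (cases "p \<in> S3")
    case True
    have "s p * cnj (s p) = 0"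
      using herm_hopf[OF assms(1,2,2) True] hs z[OF hopf_in_sphere[OF assms(1) True]] by simp
    then show ?thesis by simp
  qed (rule sectionsD(2)[OF assms(2)])
qed

section \<open>The Laplacian as an operator on smooth sections\<close>

context hermitian_conn
begin

definition lap :: "bundle_section \<Rightarrow> bundle_section" where
  "lap s = (\<lambda>q. of_real (- 1 / R\<^sup>2) * (\<Sum>i\<in>UNIV. nab (axis i 1) (nab (axis i 1) s) q))"

lemma lap_laplacian: "s \<in> sections N \<Longrightarrow> magnetic_laplacian R N D s (lap s)"
  unfolding lap_def by (rule laplacian_nab)

lemma lap_closed: "s \<in> sections N \<Longrightarrow> lap s \<in> sections N"
  using lap_laplacian by (simp add: magnetic_laplacian_def)

text \<open>\<open>magnetic_laplacian\<close> is a weak formulation. Testing it with the section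
  \<open>w\<close>, the defect in the pointwise equation, shows that \<open>w\<close> is orthogonal
  to itself.\<close>

lemma eigenspace_iff: "s \<in> eigenspace R N D \<nu> \<longleftrightarrow> s \<in> sections N \<and> lap s = (\<lambda>q. of_real \<nu> * s q)"
proof
  assume "s \<in> eigenspace R N D \<nu>"
  then have e: "magnetic_laplacian R N D s (\<lambda>q. of_real \<nu> * s q)" by (simp add: eigenspace_def)
  then have s: "s \<in> sections N" by (simp add: magnetic_laplacian_def)
  define w where "w = (\<lambda>q. lap s q + (- of_real \<nu>) * s q)"
  have w: "w \<in> sections N" unfolding w_def by (intro sections_add sections_scale lap_closed s)
  have "ip R (\<lambda>q. of_real \<nu> * s q) w = ip R (lap s) w"
    using e lap_laplacian[OF s] w by (simp add: magnetic_laplacian_def ip_def)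
  then have "ip R w (\<lambda>q. of_real \<nu> * s q) = ip R w (lap s)"
    using ip_cnj[of R w] by simp
  moreover have "ip R w w = ip R w (lap s) + ip R w (\<lambda>q. (- of_real \<nu>) * s q)"
    using ip_add_right[OF R_pos w lap_closed[OF s] sections_scale[OF s, of "- of_real \<nu>"]] unfolding w_def[symmetric] .
  ultimately have "ip R w w = 0"
    unfolding ip_scale_right[OF R_pos w s] by simp
  from fun_cong[OF ip_zero_imp[OF R_pos w this]] have "lap s q = of_real \<nu> * s q" for q by (simp add: w_def)
  then show "s \<in> sections N \<and> lap s = (\<lambda>q. of_real \<nu> * s q)" using s by blast
next
  assume a: "s \<in> sections N \<and> lap s = (\<lambda>q. of_real \<nu> * s q)"
  then have "magnetic_laplacian R N D s (lap s)" by (blast intro: lap_laplacian)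
  with a show "s \<in> eigenspace R N D \<nu>" by (simp add: eigenspace_def)
qed

lemma nab_sum:
  assumes "finite I" "\<And>i. i \<in> I \<Longrightarrow> s i \<in> sections N"
  shows "nab u (\<lambda>q. \<Sum>i\<in>I. k i * s i q) = (\<lambda>q. \<Sum>i\<in>I. k i * nab u (s i) q)"
  using assms
proof (induction I rule: finite_induct)
  case empty
  show ?case using nab_scale[OF sections_zero, of u 0] by simp
next
  case (insert i I)
  have "(\<lambda>q. k i * s i q) \<in> sections N" using insert by (auto intro: sections_scale)
  moreover have "(\<lambda>q. \<Sum>i\<in>I. k i * s i q) \<in> sections N"
    by (rule sections_sum) (use insert in \<open>auto intro: sections_scale\<close>)
  ultimately have "nab u (\<lambda>q. k i * s i q + (\<Sum>i\<in>I. k i * s i q))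
      = (\<lambda>q. nab u (\<lambda>q. k i * s i q) q + nab u (\<lambda>q. \<Sum>i\<in>I. k i * s i q) q)"
    by (rule nab_add)
  then show ?case using insert by (simp add: nab_scale)
qed

lemma lap_sum:
  assumes "finite I" "\<And>i. i \<in> I \<Longrightarrow> s i \<in> sections N"
  shows "lap (\<lambda>q. \<Sum>i\<in>I. k i * s i q) = (\<lambda>q. \<Sum>i\<in>I. k i * lap (s i) q)"
proof -
  have "(\<Sum>j\<in>UNIV. \<Sum>i\<in>I. k i * nab (axis j 1) (nab (axis j 1) (s i)) q)
      = (\<Sum>i\<in>I. k i * (\<Sum>j\<in>UNIV. nab (axis j 1) (nab (axis j 1) (s i)) q))" for q
    by (subst sum.swap) (simp add: sum_distrib_left)
  moreover have "nab u (nab u (\<lambda>q. \<Sum>i\<in>I. k i * s i q)) = (\<lambda>q. \<Sum>i\<in>I. k i * nab u (nab u (s i)) q)" for u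
  proof -
    have "nab u (nab u (\<lambda>q. \<Sum>i\<in>I. k i * s i q)) = nab u (\<lambda>q. \<Sum>i\<in>I. k i * nab u (s i) q)"
      by (rule arg_cong[OF nab_sum[OF assms]])
    also have "\<dots> = (\<lambda>q. \<Sum>i\<in>I. k i * nab u (nab u (s i)) q)"
      by (rule nab_sum[OF assms(1) nab_closed[OF assms(2)]])
    finally show ?thesis .
  qed
  ultimately show ?thesis
    unfolding lap_def by (simp only: sum_distrib_left[symmetric]) (simp add: sum_distrib_left mult_ac)
qed

lemma lap_symmetric: "s \<in> sections N \<Longrightarrow> t \<in> sections N \<Longrightarrow> ip R (lap s) t = ip R s (lap t)"
  using laplacian_symmetric[OF lap_laplacian lap_laplacian] .

end

context gauged
begin

definition ev :: "nat \<Rightarrow> real" where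
  "ev m = (real m * (real m + 1) + real N * (2 * real m + 1) / 2) / R\<^sup>2"

lemma ev_strict_mono: "m < n \<Longrightarrow> ev m < ev n"
proof -
  assume "m < n"
  then have "real m * (real m + 1) < real n * (real n + 1)" "real N * (2 * real m + 1) \<le> real N * (2 * real n + 1)"
    by (auto intro!: mult_strict_mono mult_left_mono)
  then show ?thesis using R_pos by (simp add: ev_def divide_strict_right_mono)
qed

lemma ev_inj: "ev m = ev n \<longleftrightarrow> m = n"
  using ev_strict_mono by (metis linorder_neqE_nat order_less_irrefl)

lemma lap_Q: "lap (Q a b c d) = (\<lambda>q. of_real (ev (a + b)) * Q a b c d q
    + (of_real (- (real a * real c) / R\<^sup>2) * Q (a - 1) b (c - 1) d q
     + of_real (- (real b * real d) / R\<^sup>2) * Q a (b - 1) c (d - 1) q))"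
proof -
  have gen: "of_real (- 1 / r) * (- (of_real k * A) + of_real (x * y) * B + of_real (z * w) * C)
      = of_real (k / r) * A + (of_real (- (x * y) / r) * B + of_real (- (z * w) / r) * C)"
    for k r x y z w :: real and A B C :: complex
    by (simp add: algebra_simps add_divide_distrib diff_divide_distrib)
  have k: "of_nat (a + b) * (of_nat (a + b) + 1) + of_nat N * (2 * of_nat (a + b) + 1) / 2
      = complex_of_real (real (a + b) * (real (a + b) + 1) + real N * (2 * real (a + b) + 1) / 2)"
    and m: "of_nat x * of_nat y = complex_of_real (real x * real y)" for x y
    by simp_all
  show ?thesis unfolding lap_def sum_nab_nab_Q ev_def k m gen ..
qed

text \<open>Multiplication by 1, written as the sum of the two squared moduli. Each level of
  monomials thus contains the lower levels in its span, so the monomials are far from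
  independent.\<close>

lemma Q_split:
  assumes "c + d = N + a + b"
  shows "Q a b c d = (\<lambda>q. Q (a + 1) b (c + 1) d q + Q a (b + 1) c (d + 1) q)"
proof
  fix q
  show "Q a b c d q = Q (a + 1) b (c + 1) d q + Q a (b + 1) c (d + 1) q"
  proof (cases "q \<in> S3")
    case True
    have "Q (a + 1) b (c + 1) d q + Q a (b + 1) c (d + 1) q
        = (fst q * cnj (fst q) + snd q * cnj (snd q)) * Q a b c d q"
      using assms by (simp add: Q_S3[OF True] algebra_simps)
    then show ?thesis using True[unfolded S3_iff_complex] by simp
  qed (simp add: Q_off del: mem_sphere mem_sphere_0)
qed

section \<open>The span of the monomials and its density\<close>

inductive_set W :: "bundle_section set" where
  mon: "Q a b c d \<in> W"
| add: "r \<in> W \<Longrightarrow> t \<in> W \<Longrightarrow> (\<lambda>q. r q + t q) \<in> W"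
| scale: "r \<in> W \<Longrightarrow> (\<lambda>q. k * r q) \<in> W"

lemma W_coordinate: "r \<in> W \<Longrightarrow> (\<lambda>q. complex_of_real (hopf R q $ i) * r q) \<in> W"
proof (induction rule: W.induct)
  case (mon a b c d)
  have h: "complex_of_real (hopf R q $ j) = of_real R * complex_of_real (hopf 1 q $ j)" for q j
    by (simp add: hopf_scale[of R])
  have "(\<lambda>q. complex_of_real (hopf R q $ 1) * Q a b c d q)
      = (\<lambda>q. of_real R * (Q (a + 1) b c (d + 1) q + Q a (b + 1) (c + 1) d q))" (is "?l1 = ?r1")
    and "(\<lambda>q. complex_of_real (hopf R q $ 2) * Q a b c d q)
      = (\<lambda>q. (- \<i> * of_real R) * (Q (a + 1) b c (d + 1) q + (-1) * Q a (b + 1) (c + 1) d q))" (is "?l2 = ?r2")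
    and "(\<lambda>q. complex_of_real (hopf R q $ 3) * Q a b c d q)
      = (\<lambda>q. of_real R * (Q (a + 1) b (c + 1) d q + (-1) * Q a (b + 1) c (d + 1) q))" (is "?l3 = ?r3")
  proof -
    have "?l1 q = ?r1 q \<and> ?l2 q = ?r2 q \<and> ?l3 q = ?r3 q" for q
    proof (cases "q \<in> S3 \<and> c + d = N + a + b")
      case True
      then show ?thesis unfolding h hopf_complex by (simp add: Q_S3 algebra_simps del: mem_sphere mem_sphere_0)
    next
      case False
      then show ?thesis using Q_off[of q] Q_wrong by (cases "q \<in> S3") (simp_all del: mem_sphere mem_sphere_0)
    qed
    then show "?l1 = ?r1" "?l2 = ?r2" "?l3 = ?r3" by blast+
  qed
  moreover have "?r1 \<in> W" "?r2 \<in> W" "?r3 \<in> W" by (intro W.intros)+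
  ultimately have "?l1 \<in> W" "?l2 \<in> W" "?l3 \<in> W" by (simp_all only:)
  then show ?case
    using exhaust_3[of i] by (elim disjE) (simp_all only:)
next
  case (add r t)
  from W.add[OF add.IH] show ?case by (simp add: distrib_left)
next
  case (scale r k)
  from W.scale[OF scale.IH, of k] show ?case by (simp add: mult.left_commute)
qed

lemma W_polynomial:
  assumes "real_polynomial_function f"
  shows "r \<in> W \<Longrightarrow> (\<lambda>q. complex_of_real (f (hopf R q)) * r q) \<in> W"
  using assms
proof (induction f arbitrary: r rule: real_polynomial_function.induct)
  case (linear f)
  have lf: "linear f" using linear(1) by (simp add: linear_conv_bounded_linear)
  have "f x = x$1 * f (axis 1 1) + x$2 * f (axis 2 1) + x$3 * f (axis 3 1)" for x
  proof -
    have "x = (x$1) *\<^sub>R axis 1 1 + (x$2) *\<^sub>R axis 2 1 + (x$3) *\<^sub>R axis 3 1"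
      by (simp add: vec_eq_iff forall_3 axis_def)
    from arg_cong[OF this, of f] show ?thesis by (simp add: linear_add[OF lf] linear_scale[OF lf])
  qed
  note fx = this
  have "(\<lambda>q. complex_of_real (f (hopf R q)) * r q) = (\<lambda>q. (of_real (f (axis 1 1)) * (complex_of_real (hopf R q $ 1) * r q)
      + of_real (f (axis 2 1)) * (complex_of_real (hopf R q $ 2) * r q)) + of_real (f (axis 3 1)) * (complex_of_real (hopf R q $ 3) * r q))"
  proof
    fix q
    show "complex_of_real (f (hopf R q)) * r q = (of_real (f (axis 1 1)) * (complex_of_real (hopf R q $ 1) * r q)
      + of_real (f (axis 2 1)) * (complex_of_real (hopf R q $ 2) * r q)) + of_real (f (axis 3 1)) * (complex_of_real (hopf R q $ 3) * r q)"
      unfolding fx[of "hopf R q"] by (simp add: algebra_simps)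
  qed
  then show ?case by (auto intro!: W.add W.scale W_coordinate linear.prems)
next
  case (const c)
  then show ?case by (auto intro: W.scale)
next
  case (add f g)
  from W.add[OF add.IH(1)[OF add.prems] add.IH(2)[OF add.prems]] show ?case
    by (simp add: distrib_right)
next
  case (mult f g)
  from mult.IH(1)[OF mult.IH(2)[OF mult.prems]] show ?case by (simp add: mult.assoc)
qed

text \<open>The span of the monomials is stable under multiplication by polynomials in the base
  point. Hence the continuous function \<open>herm R s (Q 0 0 c d)\<close> is orthogonal to all
  polynomials, and it vanishes by Stone--Weierstrass. The two choices with \<open>c\<close> or
  \<open>d\<close> equal to \<open>N\<close> give gauged powers of the conjugate coordinates, which
  have no common zero.\<close>

lemma Q_total:
  assumes s: "s \<in> sections N" and z: "\<And>a b c d. ip R s (Q a b c d) = 0"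
  shows "s = (\<lambda>q. 0)"
proof -
  have W: "r \<in> sections N \<and> ip R s r = 0" if "r \<in> W" for r
    using that
    by (induction rule: W.induct)
       (auto simp: z Q_section sections_add sections_scale ip_add_right[OF R_pos s] ip_scale_right[OF R_pos s])
  have F0: "s p * cnj (Q 0 0 c d p) = 0" if p: "p \<in> S3" for c d p
  proof -
    let ?q = "Q 0 0 c d"
    define F where "F = herm R s ?q"
    have cF: "continuous_on (sphere 0 R) F" unfolding F_def by (rule continuous_herm[OF R_pos s Q_section])
    have poly: "sphere_integral R (\<lambda>x. of_real (f x) * F x) = 0" if f: "real_polynomial_function f" for f
    proof -
      have "sphere_integral R (\<lambda>x. of_real (f x) * F x) = ip R s (\<lambda>q. of_real (f (hopf R q)) * ?q q)"
        unfolding ip_def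
      proof (rule sphere_integral_cong[OF R_pos])
        fix x :: "real^3" assume "x \<in> sphere 0 R"
        from fibre_point(2)[OF R_pos this] show "of_real (f x) * F x = herm R s (\<lambda>q. of_real (f (hopf R q)) * ?q q) x"
          by (simp add: F_def herm_def)
      qed
      then show ?thesis using W[OF W_polynomial[OF f W.mon]] by simp
    qed
    obtain B where B: "B > 0" "\<And>x. x \<in> sphere 0 R \<Longrightarrow> norm (F x) \<le> B"
      using compact_imp_bounded[OF compact_continuous_image[OF cF compact_sphere]]
      unfolding bounded_pos by auto
    have "norm (sphere_integral R (\<lambda>x. F x * cnj (F x))) \<le> R\<^sup>2 * (B * e) * (2 * pi\<^sup>2)" if e: "e > 0" for e
    proof -
      obtain G where G: "polynomial_function G" "\<And>x. x \<in> sphere 0 R \<Longrightarrow> norm (F x - G x) < e"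
        using Stone_Weierstrass_polynomial_function[OF compact_sphere cF e] by blast
      have re: "real_polynomial_function (\<lambda>x. Re (G x))" and im: "real_polynomial_function (\<lambda>x. Im (G x))"
        using G(1) bounded_linear_Re bounded_linear_Im unfolding polynomial_function_def o_def by blast+
      have cG: "continuous_on (sphere 0 R) G"
        by (rule continuous_on_polymonial_function[OF G(1)])
      have "F x * cnj (F x) = F x * cnj (F x - G x) + (of_real (Re (G x)) * F x + (- \<i>) * (of_real (Im (G x)) * F x))" for x
      proof -
        have c: "cnj (G x) = of_real (Re (G x)) + (- \<i>) * of_real (Im (G x))" by (simp add: complex_eq_iff)
        have "F x * cnj (F x) = F x * cnj (F x - G x) + F x * cnj (G x)" by (simp add: algebra_simps)
        also have "F x * cnj (G x) = of_real (Re (G x)) * F x + (- \<i>) * (of_real (Im (G x)) * F x)"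
          unfolding c by (simp only: algebra_simps)
        finally show ?thesis .
      qed
      then have "sphere_integral R (\<lambda>x. F x * cnj (F x))
          = sphere_integral R (\<lambda>x. F x * cnj (F x - G x) + (of_real (Re (G x)) * F x + (- \<i>) * (of_real (Im (G x)) * F x)))"
        by simp
      also have "\<dots> = sphere_integral R (\<lambda>x. F x * cnj (F x - G x))
          + (sphere_integral R (\<lambda>x. of_real (Re (G x)) * F x) + (- \<i>) * sphere_integral R (\<lambda>x. of_real (Im (G x)) * F x))"
        by (subst sphere_integral_add[OF R_pos], (intro continuous_intros cF cG)+,
            subst sphere_integral_add[OF R_pos], (intro continuous_intros cF cG)+,
            subst sphere_integral_mult[OF R_pos], (intro continuous_intros cF cG)+) (rule refl)
      also have "\<dots> = sphere_integral R (\<lambda>x. F x * cnj (F x - G x))" by (simp add: poly[OF re] poly[OF im])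
      also have "norm \<dots> \<le> R\<^sup>2 * (B * e) * (2 * pi\<^sup>2)"
      proof (rule sphere_integral_bound[OF R_pos])
        show "norm (F x * cnj (F x - G x)) \<le> B * e" if "x \<in> sphere 0 R" for x
          unfolding norm_mult complex_mod_cnj using B G(2)[OF that] that by (intro mult_mono) auto
      qed (intro continuous_intros cF cG)
      finally show ?thesis .
    qed
    note bound = this
    have "norm (sphere_integral R (\<lambda>x. F x * cnj (F x))) \<le> e" if e: "e > 0" for e
    proof -
      define C where "C = R\<^sup>2 * B * (2 * pi\<^sup>2)"
      have C: "C > 0" using R_pos B(1) by (simp add: C_def)
      have "R\<^sup>2 * (B * (e / C)) * (2 * pi\<^sup>2) = C * (e / C)" unfolding C_def by (simp only: mult_ac)
      also have "\<dots> = e" using C by simp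
      finally have "R\<^sup>2 * (B * (e / C)) * (2 * pi\<^sup>2) = e" .
      with bound[of "e / C"] e C show ?thesis by simp
    qed
    then have "norm (sphere_integral R (\<lambda>x. F x * cnj (F x))) \<le> 0" by (rule field_le_epsilon) simp
    then have "sphere_integral R (\<lambda>x. F x * cnj (F x)) = 0" by simp
    from sphere_integral_zero_imp[OF R_pos cF this hopf_in_sphere[OF R_pos p]]
    show ?thesis by (simp add: F_def herm_hopf[OF R_pos s Q_section p])
  qed
  have "s p = 0" for p
  proof (cases "p \<in> S3")
    case True
    have g0: "g (hopf R p) \<noteq> 0" using g_norm[of "hopf R p"] by auto
    have "fst p \<noteq> 0 \<or> snd p \<noteq> 0"
    proof (rule ccontr)
      assume "\<not> (fst p \<noteq> 0 \<or> snd p \<noteq> 0)"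
      then show False using True[unfolded S3_iff] by simp
    qed
    then show ?thesis using F0[OF True, of N 0] F0[OF True, of 0 N] g0 by (auto simp: Q_S3[OF True])
  qed (rule sectionsD(2)[OF s])
  then show ?thesis by blast
qed

text \<open>Symmetry moves the Laplacian from the eigensection to the monomial, where it is
  triangular.\<close>

lemma Q_recurrence:
  assumes "s \<in> eigenspace R N D \<nu>"
  shows "of_real (R\<^sup>2 * (ev (a + b) - \<nu>)) * ip R s (Q a b c d)
    = of_nat a * of_nat c * ip R s (Q (a - 1) b (c - 1) d) + of_nat b * of_nat d * ip R s (Q a (b - 1) c (d - 1))"
proof -
  have s: "s \<in> sections N" and e: "lap s = (\<lambda>q. of_real \<nu> * s q)" using assms by (simp_all add: eigenspace_iff)
  note sc = sections_scale[OF Q_section]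
  have "of_real \<nu> * ip R s (Q a b c d) = ip R s (lap (Q a b c d))"
    using lap_symmetric[OF s Q_section, of a b c d] unfolding e ip_scale_left[OF R_pos s Q_section] .
  also have "\<dots> = of_real (ev (a + b)) * ip R s (Q a b c d) + (of_real (- (real a * real c) / R\<^sup>2) * ip R s (Q (a - 1) b (c - 1) d)
      + of_real (- (real b * real d) / R\<^sup>2) * ip R s (Q a (b - 1) c (d - 1)))"
    unfolding lap_Q ip_add_right[OF R_pos s sc sections_add[OF sc sc]] ip_add_right[OF R_pos s sc sc]
      ip_scale_right[OF R_pos s Q_section] by simp
  finally show ?thesis using R_pos by (simp add: field_simps)
qed

text \<open>Below the first level where the factor \<open>ev (a + b) - \<nu>\<close> can vanish, the
  recurrence starts from 0 and stays there.\<close>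

lemma ip_Q_low:
  assumes s: "s \<in> eigenspace R N D \<nu>" and n: "\<And>m. m < n \<Longrightarrow> ev m \<noteq> \<nu>"
  shows "a + b < n \<Longrightarrow> ip R s (Q a b c d) = 0"
proof (induction "a + b" arbitrary: a b c d rule: less_induct)
  case less
  have "of_nat a * of_nat c * ip R s (Q (a - 1) b (c - 1) d) = 0"
    using less.hyps[of "a - 1" b "c - 1" d] less.prems by (cases a) auto
  moreover have "of_nat b * of_nat d * ip R s (Q a (b - 1) c (d - 1)) = 0"
    using less.hyps[of a "b - 1" c "d - 1"] less.prems by (cases b) auto
  ultimately have "of_real (R\<^sup>2 * (ev (a + b) - \<nu>)) * ip R s (Q a b c d) = 0"
    unfolding Q_recurrence[OF s] by (simp only: add_0_left)
  moreover have "R\<^sup>2 * (ev (a + b) - \<nu>) \<noteq> 0" using n[OF less.prems] R_pos by simp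
  ultimately show ?case by (metis mult_eq_0_iff of_real_eq_0_iff)
qed

text \<open>Above level \<open>j\<close> the factor \<open>ev (a + b) - ev j\<close> never vanishes
  again, so level \<open>j\<close> determines all higher ones.\<close>

lemma ip_Q_high:
  assumes s: "s \<in> eigenspace R N D (ev j)" and z: "\<And>a b c d. a + b \<le> j \<Longrightarrow> ip R s (Q a b c d) = 0"
  shows "ip R s (Q a b c d) = 0"
proof (induction "a + b" arbitrary: a b c d rule: less_induct)
  case less
  show ?case
  proof (cases "a + b \<le> j")
    case False
    have "of_nat a * of_nat c * ip R s (Q (a - 1) b (c - 1) d) = 0"
      using less.hyps[of "a - 1" b "c - 1" d] by (cases a) auto
    moreover have "of_nat b * of_nat d * ip R s (Q a (b - 1) c (d - 1)) = 0"
      using less.hyps[of a "b - 1" c "d - 1"] by (cases b) auto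
    ultimately have "of_real (R\<^sup>2 * (ev (a + b) - ev j)) * ip R s (Q a b c d) = 0"
      unfolding Q_recurrence[OF s] by (simp only: add_0_left)
    moreover have "R\<^sup>2 * (ev (a + b) - ev j) \<noteq> 0" using False R_pos ev_inj[of "a + b" j] by simp
    ultimately show ?thesis by (metis mult_eq_0_iff of_real_eq_0_iff)
  qed (rule z)
qed

lemma eigenvalue_ev:
  assumes "s \<in> eigenspace R N D \<nu>" "s \<noteq> (\<lambda>q. 0)"
  obtains j where "\<nu> = ev j"
proof -
  have s: "s \<in> sections N" using assms by (simp add: eigenspace_iff)
  have "\<exists>j. \<nu> = ev j"
  proof (rule ccontr)
    assume "\<nexists>j. \<nu> = ev j"
    then have "ip R s (Q a b c d) = 0" for a b c d
      by (intro ip_Q_low[OF assms(1), of "Suc (a + b)"]) auto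
    from Q_total[OF s this] assms(2) show False by simp
  qed
  then show ?thesis using that by blast
qed

subsection \<open>A basis of each eigenspace\<close>

text \<open>Up to sign, all monomials of bidegree \<open>(j, N + j)\<close> and a given weight agree modulo
  lower bidegree; \<open>harm j k\<close> is the harmonic combination of those whose weight
  is \<open>k - (N + j)\<close>.  In \<open>widx\<close> the truncated subtraction stands for
  \<open>max 0 (k - (N + j))\<close>; for \<open>a \<in> widx j k\<close> the other subtractions are exact.\<close>

definition widx :: "nat \<Rightarrow> nat \<Rightarrow> nat set" where
  "widx j k = {k - (N + j)..min j k}"

text \<open>Alternating reciprocals of the factorials of the four exponents in \<open>Qw\<close>.
  These are the coefficients of the polynomial annihilated by the sum of the mixed second
  derivatives with respect to each coordinate and its conjugate; by \<open>lap_Q\<close> that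
  operator is, up to a constant, the off-diagonal part of the Laplacian.\<close>

definition kap :: "nat \<Rightarrow> nat \<Rightarrow> nat \<Rightarrow> real" where
  "kap j k a = (-1) ^ a / (fact a * fact (j - a) * fact (a + N + j - k) * fact (k - a))"

definition Qw :: "nat \<Rightarrow> nat \<Rightarrow> nat \<Rightarrow> bundle_section" where
  "Qw j k a = Q a (j - a) (a + N + j - k) (k - a)"

definition harm :: "nat \<Rightarrow> nat \<Rightarrow> bundle_section" where
  "harm j k = (\<lambda>q. \<Sum>a\<in>widx j k. of_real (kap j k a) * Qw j k a q)"

lemma Qw_section: "Qw j k a \<in> sections N"
  by (simp add: Qw_def Q_section)

lemma harm_section: "harm j k \<in> sections N"
  unfolding harm_def by (intro sections_sum sections_scale Qw_section)

lemma finite_widx: "finite (widx j k)"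
  by (simp add: widx_def)

lemma widx_iff: "a \<in> widx j k \<longleftrightarrow> a \<le> j \<and> a \<le> k \<and> k \<le> a + N + j"
  by (auto simp: widx_def)

lemma kap_step:
  assumes "a \<in> widx j k" "Suc a \<in> widx j k"
  shows "kap j k (Suc a) * (real (Suc a) * real (Suc a + N + j - k)) = - kap j k a * (real (j - a) * real (k - a))"
proof -
  have ja: "j - a = Suc (j - Suc a)" and ka: "k - a = Suc (k - Suc a)" and c: "Suc a + N + j - k = Suc (a + N + j - k)"
    using assms by (auto simp: widx_iff)
  have f: "fact (Suc n) = real (Suc n) * fact n" for n by simp
  show ?thesis
    unfolding kap_def ja ka c f
    by (simp add: divide_simps del: of_nat_Suc fact_Suc)
qed

text \<open>The off-diagonal terms telescope: by \<open>kap_step\<close> the first one at index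
  \<open>a\<close> cancels the second one at index \<open>a - 1\<close>. At both ends of the index
  range one of the exponents is 0, and its coefficient removes the boundary term.\<close>

lemma lap_harm:
  assumes k: "k \<le> N + 2 * j"
  shows "lap (harm j k) = (\<lambda>q. of_real (ev j) * harm j k q)"
proof
  fix q
  define a0 a1 where "a0 = k - (N + j)" "a1 = min j k"
  have I: "widx j k = {a0..a1}" by (simp add: widx_def a0_a1_def)
  have le: "a0 \<le> a1" using k by (auto simp: a0_a1_def)
  define T2 where "T2 a = of_real (kap j k a) * (of_nat (j - a) * of_nat (k - a) * Q a (j - a - 1) (a + N + j - k) (k - a - 1) q)" for a
  define T1 where "T1 a = of_real (kap j k a) * (of_nat a * of_nat (a + N + j - k) * Q (a - 1) (j - a) (a + N + j - k - 1) (k - a) q)" for a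
  \<comment> \<open>The case distinction encodes that nothing precedes the first index, where
    \<open>a - 1\<close> could truncate.\<close>
  define V where "V a = (if a \<le> a0 then 0 else T2 (a - 1))" for a
  have 1: "T1 a = - V a" if a: "a \<in> {a0..a1}" for a
  proof (cases "a = a0")
    case True
    then have "a = 0 \<or> a + N + j - k = 0" by (auto simp: a0_a1_def)
    then show ?thesis using True by (auto simp: T1_def V_def)
  next
    case False
    then obtain b where b: "a = Suc b" using a by (cases a) auto
    have w: "b \<in> widx j k" "Suc b \<in> widx j k" using a b False unfolding I by auto
    have "j - b - 1 = j - a" "k - b - 1 = k - a" "a + N + j - k - 1 = b + N + j - k"
      using w b by (auto simp: widx_iff)
    then have "T1 a + T2 b = of_real (kap j k (Suc b) * (real (Suc b) * real (Suc b + N + j - k)) + kap j k b * (real (j - b) * real (k - b)))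
        * Q b (j - a) (b + N + j - k) (k - a) q"
      unfolding T1_def T2_def b by (simp add: algebra_simps)
    then have "T1 a + T2 b = 0" unfolding kap_step[OF w] by simp
    then show ?thesis using False a b by (simp add: V_def eq_neg_iff_add_eq_0)
  qed
  have 2: "T2 a = V (Suc a)" if "a \<in> {a0..a1}" for a using that by (simp add: V_def)
  have "(\<Sum>a\<in>{a0..a1}. T1 a + T2 a) = (\<Sum>a=a0..a1. V (Suc a) - V a)"
    by (intro sum.cong refl) (simp only: 1 2, simp)
  also have "\<dots> = V (Suc a1) - V a0" using le by (intro sum_Suc_diff) simp
  also have "\<dots> = T2 a1" using le by (simp add: V_def)
  also have "\<dots> = 0"
  proof -
    have "j - a1 = 0 \<or> k - a1 = 0" by (auto simp: a0_a1_def)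
    then show ?thesis by (auto simp: T2_def)
  qed
  finally have zero: "(\<Sum>a\<in>widx j k. T1 a + T2 a) = 0" by (simp add: I)
  have "lap (harm j k) q = (\<Sum>a\<in>widx j k. of_real (kap j k a) * lap (Qw j k a) q)"
    unfolding harm_def lap_sum[OF finite_widx Qw_section] ..
  also have "\<dots> = (\<Sum>a\<in>widx j k. of_real (ev j) * (of_real (kap j k a) * Qw j k a q) - of_real (1 / R\<^sup>2) * (T1 a + T2 a))"
  proof (intro sum.cong refl)
    fix a assume "a \<in> widx j k"
    then have "a + (j - a) = j" by (simp add: widx_iff)
    then show "of_real (kap j k a) * lap (Qw j k a) q
        = of_real (ev j) * (of_real (kap j k a) * Qw j k a q) - of_real (1 / R\<^sup>2) * (T1 a + T2 a)"
      unfolding Qw_def lap_Q T1_def T2_def by (simp add: algebra_simps add_divide_distrib diff_divide_distrib)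
  qed
  also have "\<dots> = of_real (ev j) * harm j k q - of_real (1 / R\<^sup>2) * (\<Sum>a\<in>widx j k. T1 a + T2 a)"
    unfolding harm_def by (simp only: sum_subtractf sum_distrib_left)
  finally show "lap (harm j k) q = of_real (ev j) * harm j k q" by (simp add: zero)
qed

lemma harm_eigen: "k \<le> N + 2 * j \<Longrightarrow> harm j k \<in> eigenspace R N D (ev j)"
  by (simp add: eigenspace_iff harm_section lap_harm)

lemma hopf_spherical:
  defines "p \<equiv> \<lambda>\<theta> \<phi>. (complex_of_real (cos (\<theta> / 2)) * cis \<phi>, complex_of_real (sin (\<theta> / 2)))"
  shows "p \<theta> \<phi> \<in> S3" "hopf R (p \<theta> \<phi>) = spherical R \<theta> \<phi>"
proof -
  show "p \<theta> \<phi> \<in> S3" unfolding S3_iff by (simp add: p_def norm_mult)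
  have "sin \<theta> = 2 * sin (\<theta> / 2) * cos (\<theta> / 2)" "cos \<theta> = (cos (\<theta> / 2))\<^sup>2 - (sin (\<theta> / 2))\<^sup>2"
    using sin_double[of "\<theta> / 2"] cos_double[of "\<theta> / 2"] by simp_all
  then show "hopf R (p \<theta> \<phi>) = spherical R \<theta> \<phi>"
    by (simp add: vec_eq_iff forall_3 hopf_nth spherical_def p_def norm_mult)
qed

text \<open>If the azimuth is put into the phase of the first coordinate, it enters the integrand
  only through an exponential whose frequency is the difference of the weights.\<close>

lemma ip_Q_weight:
  assumes "int a - int c \<noteq> int a' - int c'"
  shows "ip R (Q a b c d) (Q a' b' c' d') = 0"
proof (cases "c + d = N + a + b \<and> c' + d' = N + a' + b'")
  case False
  then show ?thesis
    using ip_zero_right[of R] ip_cnj[of R "\<lambda>q. 0"] by (auto simp: Q_wrong)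
next
  case True
  let ?p = "\<lambda>\<theta> \<phi>. (complex_of_real (cos (\<theta> / 2)) * cis \<phi>, complex_of_real (sin (\<theta> / 2)))"
  let ?k = "int a - int c - (int a' - int c')"
  show ?thesis
    unfolding ip_def
  proof (rule sphere_integral_weight[OF R_pos continuous_herm[OF R_pos Q_section Q_section], of ?k])
    show "?k \<noteq> 0" using assms by simp
    fix \<theta> \<phi> :: real
    have cg: "g x ^ N * cnj (g x ^ N) = 1" for x
      unfolding complex_norm_square[symmetric] by (simp add: norm_power g_norm)
    have "exp (\<i> * of_int ?k * complex_of_real \<phi>) = cis (of_int ?k * \<phi>)"
      by (simp add: cis_conv_exp mult_ac)
    also have "\<dots> = cis \<phi> ^ a * cis (- \<phi>) ^ c * cis (- \<phi>) ^ a' * cis \<phi> ^ c'"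
      by (simp add: Complex.DeMoivre cis_mult algebra_simps)
    finally have ex: "exp (\<i> * of_int ?k * complex_of_real \<phi>) = cis \<phi> ^ a * cis (- \<phi>) ^ c * cis (- \<phi>) ^ a' * cis \<phi> ^ c'" .
    show "herm R (Q a b c d) (Q a' b' c' d') (spherical R \<theta> \<phi>) =
        complex_of_real (cos (\<theta> / 2) ^ (a + c + a' + c') * sin (\<theta> / 2) ^ (b + d + b' + d')) * exp (\<i> * of_int ?k * complex_of_real \<phi>)"
      unfolding hopf_spherical(2)[symmetric] herm_hopf[OF R_pos Q_section Q_section hopf_spherical(1)] ex
      using Q_S3[OF hopf_spherical(1)[of \<theta> \<phi>]] True cg[of "hopf R (?p \<theta> \<phi>)"]
      by (simp add: power_add power_mult_distrib cis_cnj)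
  qed
qed

lemma harm_orthogonal:
  assumes "k \<noteq> l"
  shows "ip R (harm j k) (harm j l) = 0"
proof -
  have Qw: "ip R (Qw j k a) (Qw j l b) = 0" if "a \<in> widx j k" "b \<in> widx j l" for a b
    unfolding Qw_def by (rule ip_Q_weight) (use that assms in \<open>auto simp: widx_iff of_nat_diff\<close>)
  have r: "ip R s (harm j l) = (\<Sum>b\<in>widx j l. of_real (kap j l b) * ip R s (Qw j l b))" if "s \<in> sections N" for s l
    unfolding harm_def
    by (subst ip_sum_right[OF R_pos that sections_scale[OF Qw_section]]) (simp add: ip_scale_right[OF R_pos that Qw_section])
  have "ip R (Qw j l b) (harm j k) = 0" if "b \<in> widx j l" for b
    unfolding r[OF Qw_section] using Qw[OF _ that] ip_cnj[of R "Qw j l b"] by (simp add: sum.neutral)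
  then have "ip R (harm j k) (Qw j l b) = 0" if "b \<in> widx j l" for b
    using ip_cnj[of R "harm j k" "Qw j l b"] that by simp
  then show ?thesis unfolding r[OF harm_section] by simp
qed

text \<open>An eigensection for \<open>ev j\<close> is orthogonal to the levels below
  \<open>j\<close>, so by \<open>Q_split\<close> its products with neighbouring monomials of one
  weight differ by a sign. These signs match those of \<open>kap\<close>; the product with
  \<open>harm j k\<close> is therefore a positive multiple of a single one, up to sign, and its
  vanishing clears level \<open>j\<close>.\<close>

lemma harm_total:
  assumes s: "s \<in> eigenspace R N D (ev j)" and z: "\<And>k. k \<le> N + 2 * j \<Longrightarrow> ip R s (harm j k) = 0"
  shows "s = (\<lambda>q. 0)"
proof -
  have ss: "s \<in> sections N" using s by (simp add: eigenspace_iff)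
  have low: "ip R s (Q a b c d) = 0" if "a + b < j" for a b c d
    by (rule ip_Q_low[OF s _ that]) (use ev_inj in auto)
  have level: "ip R s (Q a b c d) = 0" if ab: "a + b = j" and cd: "c + d = N + a + b" for a b c d
  proof -
    \<comment> \<open>Solves \<open>k - (N + j) = a - c\<close> by means of
      \<open>c + d = N + j\<close>.\<close>
    define k where "k = a + d"
    have k: "k \<le> N + 2 * j" using ab cd by (simp add: k_def)
    have aw: "a \<in> widx j k" using ab cd by (auto simp: widx_iff k_def)
    have alt: "(-1) ^ a' * ip R s (Qw j k a') = (-1) ^ a0 * ip R s (Qw j k a0)" if "a' \<in> widx j k" "a0 = k - (N + j)" for a' a0
      using that
    proof (induction a')
      case 0
      then show ?case by (simp add: widx_def)
    next
      case (Suc b)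
      show ?case
      proof (cases "Suc b = a0")
        case False
        then have bw: "b \<in> widx j k" using Suc.prems by (auto simp: widx_def)
        have e: "j - b = (j - Suc b) + 1" "k - b = (k - Suc b) + 1" "Suc b + N + j - k = (b + N + j - k) + 1"
          using Suc.prems(1) bw by (auto simp: widx_iff)
        have w: "b + N + j - k + (k - Suc b) = N + b + (j - Suc b)" "b + (j - Suc b) < j"
          using Suc.prems(1) bw by (auto simp: widx_iff)
        have "ip R s (Q b (j - Suc b) (b + N + j - k) (k - Suc b)) = ip R s (Qw j k (Suc b)) + ip R s (Qw j k b)"
          unfolding Qw_def e
          by (subst Q_split[OF w(1)]) (simp add: ip_add_right[OF R_pos ss Q_section Q_section])
        then have "ip R s (Qw j k (Suc b)) = - ip R s (Qw j k b)" using low[OF w(2)] by (simp add: eq_neg_iff_add_eq_0)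
        then show ?thesis using Suc.IH[OF bw Suc.prems(2)] by simp
      qed simp
    qed
    define a0 where "a0 = k - (N + j)"
    \<comment> \<open>The sum of the moduli of the coefficients: no cancellation can occur after the
      signs have been matched.\<close>
    define S where "S = (\<Sum>a\<in>widx j k. 1 / (fact a * fact (j - a) * fact (a + N + j - k) * fact (k - a)) :: real)"
    have S: "S > 0" unfolding S_def using aw by (intro sum_pos finite_widx) auto
    have "0 = ip R s (harm j k)" using z[OF k] by simp
    also have "\<dots> = (\<Sum>a\<in>widx j k. of_real (kap j k a) * ip R s (Qw j k a))"
      unfolding harm_def
      by (subst ip_sum_right[OF R_pos ss sections_scale[OF Qw_section]]) (simp add: ip_scale_right[OF R_pos ss Qw_section])
    also have "\<dots> = (\<Sum>a\<in>widx j k. of_real (1 / (fact a * fact (j - a) * fact (a + N + j - k) * fact (k - a))) * ((-1) ^ a0 * ip R s (Qw j k a0)))"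
    proof (intro sum.cong refl)
      fix b assume "b \<in> widx j k"
      from alt[OF this a0_def, symmetric]
      show "of_real (kap j k b) * ip R s (Qw j k b)
        = of_real (1 / (fact b * fact (j - b) * fact (b + N + j - k) * fact (k - b))) * ((-1) ^ a0 * ip R s (Qw j k a0))"
        by (simp add: kap_def)
    qed
    also have "\<dots> = of_real S * ((-1) ^ a0 * ip R s (Qw j k a0))"
      by (simp only: S_def sum_distrib_right of_real_sum)
    finally have "ip R s (Qw j k a0) = 0" using S by simp
    then have "ip R s (Qw j k a) = 0" using alt[OF aw a0_def] by simp
    moreover have "j - a = b" "a + N + j - k = c" "k - a = d" using ab cd by (auto simp: k_def)
    ultimately show ?thesis by (simp add: Qw_def)
  qed
  have "ip R s (Q a b c d) = 0" if "a + b \<le> j" for a b c d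
  proof (cases "c + d = N + a + b")
    case True
    then show ?thesis using low level that by (cases "a + b = j") auto
  qed (simp add: Q_wrong ip_zero_right)
  from Q_total[OF ss ip_Q_high[OF s this]] show ?thesis .
qed

text \<open>At the points with real coordinates \<open>r / s\<close> and \<open>1 / s\<close> the
  section is a nonvanishing factor times a polynomial \<open>f r\<close>, whose constant term is the
  nonzero coefficient at the smallest index.\<close>

lemma harm_nonzero:
  assumes k: "k \<le> N + 2 * j"
  shows "harm j k \<noteq> (\<lambda>q. 0)"
proof
  assume h: "harm j k = (\<lambda>q. 0)"
  define a0 where "a0 = k - (N + j)"
  have a0: "a0 \<in> widx j k" using k by (auto simp: a0_def widx_iff)
  define f where "f r = (\<Sum>a\<in>widx j k. kap j k a * r ^ (2 * (a - a0)))" for r :: real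
  have f0: "f r = 0" if r: "r > 0" for r
  proof -
    define s where "s = sqrt (1 + r\<^sup>2)"
    have s: "s > 0" "s\<^sup>2 = 1 + r\<^sup>2" by (auto simp: s_def intro: add_pos_nonneg)
    define p where "p = (complex_of_real (r / s), complex_of_real (1 / s))"
    have "1 + r\<^sup>2 \<noteq> 0" using s by (metis power_not_zero less_irrefl)
    then have p: "p \<in> S3" unfolding S3_iff using s by (simp add: p_def power_divide norm_divide add_divide_distrib[symmetric] add.commute)
    define m where "m = 2 * a0 + (N + j) - k"
    have "Qw j k a p = g (hopf R p) ^ N * of_real (r ^ m / s ^ (N + 2 * j) * r ^ (2 * (a - a0)))" if a: "a \<in> widx j k" for a
    proof -
      have w: "a + N + j - k + (k - a) = N + a + (j - a)" using a by (auto simp: widx_iff)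
      have e1: "a + (a + N + j - k) = m + 2 * (a - a0)" "a + (a + N + j - k) + ((j - a) + (k - a)) = N + 2 * j"
        using a by (auto simp: widx_def m_def a0_def)
      have "Qw j k a p = g (hopf R p) ^ N * of_real ((r / s) ^ a * (1 / s) ^ (j - a) * (r / s) ^ (a + N + j - k) * (1 / s) ^ (k - a))"
        unfolding Qw_def Q_S3[OF p w] by (simp add: p_def)
      also have "(r / s) ^ a * (1 / s) ^ (j - a) * (r / s) ^ (a + N + j - k) * (1 / s) ^ (k - a)
          = r ^ (a + (a + N + j - k)) * (1 / s) ^ (a + (a + N + j - k) + ((j - a) + (k - a)))"
        by (simp only: power_add power_divide power_one divide_inverse power_mult_distrib mult_1_left mult_ac)
      also have "\<dots> = r ^ m / s ^ (N + 2 * j) * r ^ (2 * (a - a0))"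
        unfolding e1(2) unfolding e1(1) by (simp add: power_add power_divide)
      finally show ?thesis .
    qed
    then have "harm j k p = (\<Sum>a\<in>widx j k. of_real (kap j k a) * (g (hopf R p) ^ N * of_real (r ^ m / s ^ (N + 2 * j) * r ^ (2 * (a - a0)))))"
      unfolding harm_def by (intro sum.cong) auto
    also have "\<dots> = g (hopf R p) ^ N * of_real (r ^ m / s ^ (N + 2 * j)) * of_real (f r)"
      by (simp add: f_def sum_distrib_left mult_ac)
    finally have "g (hopf R p) ^ N * of_real (r ^ m / s ^ (N + 2 * j)) * of_real (f r) = 0" using h by simp
    moreover have "g (hopf R p) \<noteq> 0" using g_norm[of "hopf R p"] by auto
    ultimately show ?thesis using r s by auto
  qed
  \<comment> \<open>The factor \<open>r ^ m\<close> may vanish at 0, so the constant term is reached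
    as a limit.\<close>
  have "(f \<longlongrightarrow> f 0) (at_right 0)"
    unfolding f_def by (intro tendsto_intros)
  moreover have "(f \<longlongrightarrow> 0) (at_right 0)"
    by (rule tendsto_eventually) (auto simp: eventually_at_right_field f0 intro!: exI[of _ 1])
  ultimately have "f 0 = 0" by (intro tendsto_unique[of "at_right (0::real)" f]) auto
  moreover have "f 0 = kap j k a0"
  proof -
    have "f 0 = (\<Sum>a\<in>widx j k. if a = a0 then kap j k a else 0)"
      unfolding f_def by (intro sum.cong refl) (auto simp: widx_def a0_def power_0_left)
    then show ?thesis using a0 by (simp add: finite_widx)
  qed
  ultimately show False by (simp add: kap_def)
qed

lemma harm_norm: "k \<le> N + 2 * j \<Longrightarrow> ip R (harm j k) (harm j k) \<noteq> 0"
  using harm_nonzero ip_zero_imp[OF R_pos harm_section] by blast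

lemma eigenvalues_eq: "eigenvalues R N D = range ev"
proof (intro equalityI subsetI)
  fix \<nu> assume "\<nu> \<in> eigenvalues R N D"
  then obtain s where "s \<in> eigenspace R N D \<nu>" "s \<noteq> (\<lambda>q. 0)"
    unfolding eigenvalues_def by (auto simp: zero_fun_def)
  from eigenvalue_ev[OF this] show "\<nu> \<in> range ev" by blast
next
  fix \<nu> assume "\<nu> \<in> range ev"
  then obtain j where "\<nu> = ev j" by auto
  then show "\<nu> \<in> eigenvalues R N D"
    using harm_eigen[of 0 j] harm_nonzero[of 0 j] unfolding eigenvalues_def by (auto simp: zero_fun_def)
qed

lemma sum_fun_apply: "(\<Sum>i\<in>I. f i) q = (\<Sum>i\<in>I. f i q :: complex)"
  by (induction I rule: infinite_finite_induct) auto

text \<open>Subtracting from an eigensection its orthogonal projection \<open>P\<close> onto the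
  span of the \<open>harm j k\<close> leaves an eigensection orthogonal to all of them, which is 0
  by \<open>harm_total\<close>.\<close>

lemma eigen_multiplicity_eq: "eigen_multiplicity R N D (ev j) = N + 2 * j + 1"
proof -
  interpret cvs: vector_space "\<lambda>(c::complex) (s::bundle_section) p. c * s p"
    by unfold_locales (auto simp: fun_eq_iff algebra_simps)
  let ?K = "{..N + 2 * j}"
  let ?B = "harm j ` ?K"
  have inj: "inj_on (harm j) ?K"
  proof (rule inj_onI)
    fix k l assume "k \<in> ?K" "l \<in> ?K" "harm j k = harm j l"
    then show "k = l" using harm_orthogonal[of k l j] harm_norm[of k j] by (cases "k = l") auto
  qed
  have ipsum: "ip R (\<lambda>q. \<Sum>k\<in>?K. u k * harm j k q) (harm j l) = u l * ip R (harm j l) (harm j l)" if "l \<in> ?K" for u l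
  proof -
    have "ip R (harm j l) (\<lambda>q. \<Sum>k\<in>?K. u k * harm j k q) = (\<Sum>k\<in>?K. cnj (u k) * ip R (harm j l) (harm j k))"
      by (subst ip_sum_right[OF R_pos harm_section sections_scale[OF harm_section]])
         (simp add: ip_scale_right[OF R_pos harm_section harm_section])
    also have "\<dots> = (\<Sum>k\<in>?K. if k = l then cnj (u l) * ip R (harm j l) (harm j l) else 0)"
      by (intro sum.cong refl) (simp add: harm_orthogonal)
    also have "\<dots> = cnj (u l) * ip R (harm j l) (harm j l)" using that by simp
    finally show ?thesis
      using ip_cnj[of R "\<lambda>q. \<Sum>k\<in>?K. u k * harm j k q" "harm j l"] ip_cnj[of R "harm j l" "harm j l"] by simp
  qed
  have "cvs.independent ?B"
  proof (rule cvs.independent_if_scalars_zero)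
    fix f x assume f: "(\<Sum>x\<in>?B. (\<lambda>p. f x * x p)) = 0" and x: "x \<in> ?B"
    then obtain l where l: "l \<in> ?K" "x = harm j l" by auto
    have "(\<Sum>x\<in>?B. (\<lambda>p. f x * x p)) = (\<lambda>q. \<Sum>k\<in>?K. f (harm j k) * harm j k q)"
      by (simp add: sum.reindex[OF inj] fun_eq_iff sum_fun_apply o_def)
    then have "(\<lambda>q. \<Sum>k\<in>?K. f (harm j k) * harm j k q) = (\<lambda>q. 0)" using f by (simp add: zero_fun_def)
    then have "f x * ip R (harm j l) (harm j l) = ip R (\<lambda>q. 0) (harm j l)"
      using ipsum[OF l(1), of "\<lambda>k. f (harm j k)"] l(2) by simp
    also have "\<dots> = 0" using ip_cnj[of R "\<lambda>q. 0"] by (simp add: ip_zero_right)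
    finally show "f x = 0" using harm_norm[of l j] l(1) by simp
  qed simp
  moreover have "?B \<subseteq> eigenspace R N D (ev j)" using harm_eigen by auto
  moreover have "eigenspace R N D (ev j) \<subseteq> cvs.span ?B"
  proof
    fix s assume s: "s \<in> eigenspace R N D (ev j)"
    then have ss: "s \<in> sections N" and ls: "lap s = (\<lambda>q. of_real (ev j) * s q)" by (simp_all add: eigenspace_iff)
    define u where "u k = ip R s (harm j k) / ip R (harm j k) (harm j k)" for k
    define P where "P = (\<lambda>q. \<Sum>k\<in>?K. u k * harm j k q)"
    have P: "P \<in> sections N" unfolding P_def by (intro sections_sum sections_scale harm_section)
    have lP: "lap P = (\<lambda>q. of_real (ev j) * P q)"
      unfolding P_def lap_sum[OF finite_atMost harm_section] by (auto simp: lap_harm sum_distrib_left mult_ac intro!: sum.cong)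
    \<comment> \<open>The difference \<open>s - P\<close>, written as a sum over two indices so that
      \<open>lap_sum\<close> applies.\<close>
    define t where "t = (\<lambda>q. \<Sum>i\<in>{0::nat, 1}. (if i = 0 then 1 else -1) * (if i = 0 then s else P) q)"
    have t_eq: "t = (\<lambda>q. s q + (-1) * P q)" by (simp add: t_def)
    have ts: "t \<in> sections N" unfolding t_eq by (intro sections_add sections_scale ss P)
    have "lap t = (\<lambda>q. \<Sum>i\<in>{0::nat, 1}. (if i = 0 then 1 else -1) * lap (if i = 0 then s else P) q)"
      unfolding t_def by (rule lap_sum) (auto simp: ss P)
    then have "lap t = (\<lambda>q. of_real (ev j) * t q)" by (simp add: t_eq ls lP algebra_simps)
    then have te: "t \<in> eigenspace R N D (ev j)" using ts by (simp add: eigenspace_iff)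
    have "ip R t (harm j k) = 0" if k: "k \<le> N + 2 * j" for k
    proof -
      have "ip R (harm j k) t = ip R (harm j k) s - ip R (harm j k) P"
        unfolding t_eq ip_add_right[OF R_pos harm_section ss sections_scale[OF P]] ip_scale_right[OF R_pos harm_section P] by simp
      moreover have "ip R P (harm j k) = ip R s (harm j k)"
        unfolding P_def using ipsum[of k u] k harm_norm[OF k] by (simp add: u_def)
      ultimately show ?thesis
        using ip_cnj[of R "harm j k" t] ip_cnj[of R "harm j k" s] ip_cnj[of R "harm j k" P] by simp
    qed
    from harm_total[OF te this] have "s = P" unfolding t_eq by (auto simp: fun_eq_iff)
    moreover have "P \<in> cvs.span ?B"
    proof -
      have Ps: "P = (\<Sum>k\<in>?K. (\<lambda>q. u k * harm j k q))" by (simp add: P_def fun_eq_iff sum_fun_apply)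
      have "(\<lambda>q. u k * harm j k q) \<in> cvs.span ?B" if "k \<in> ?K" for k
        by (rule cvs.span_scale[OF cvs.span_base]) (use that in auto)
      then show ?thesis unfolding Ps by (rule cvs.span_sum)
    qed
    ultimately show "s \<in> cvs.span ?B" by simp
  qed
  ultimately have "cvs.dim (eigenspace R N D (ev j)) = card ?B" by (intro cvs.dim_unique) auto
  then show ?thesis by (simp add: eigen_multiplicity_def card_image[OF inj])
qed

lemma trace_Y_eq:
  "trace_Y R N D \<phi> = (\<Sum>\<^sub>\<infinity>j. of_nat (N + 2 * j + 1) * \<phi> (ev j / real N))"
proof -
  have "inj ev" by (rule injI) (simp add: ev_inj)
  then have "trace_Y R N D \<phi> = (\<Sum>\<^sub>\<infinity>j\<in>UNIV. of_nat (eigen_multiplicity R N D (ev j)) * \<phi> (ev j / real N))"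
    unfolding trace_Y_def eigenvalues_eq by (subst infsum_reindex) (auto simp: o_def)
  then show ?thesis by (simp only: eigen_multiplicity_eq)
qed

end

section \<open>Schwartz functions and Fourier inversion\<close>

lemma schwartz_derivative:
  assumes "schwartz f"
  shows "((vderiv ^^ n) f has_vector_derivative (vderiv ^^ Suc n) f t) (at t)"
proof -
  have "((vderiv ^^ n) f has_vector_derivative vector_derivative ((vderiv ^^ n) f) (at t)) (at t)"
    using assms unfolding schwartz_def by (simp add: vector_derivative_works[symmetric])
  then show ?thesis by (simp add: vderiv_def[of "(vderiv ^^ n) f"])
qed

lemma schwartz_decay:
  assumes "schwartz f"
  obtains C where "C \<ge> 0" "\<And>t. \<bar>t\<bar> ^ m * norm ((vderiv ^^ n) f t) \<le> C"
proof -
  have "bounded (range (\<lambda>t. t ^ m *\<^sub>R (vderiv ^^ n) f t))" using assms by (simp add: schwartz_def)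
  then obtain C where "\<forall>x\<in>range (\<lambda>t. t ^ m *\<^sub>R (vderiv ^^ n) f t). norm x \<le> C" unfolding bounded_iff by blast
  then have C: "norm (t ^ m *\<^sub>R (vderiv ^^ n) f t) \<le> C" for t by blast
  have "C \<ge> 0" using C[of 0] norm_ge_zero order_trans by blast
  then show ?thesis using C by (intro that[of C]) (auto simp: power_abs)
qed

text \<open>Exhibiting the whole sequence of derivatives at once replaces the computation of
  iterated \<open>vderiv\<close>.\<close>

lemma schwartzI:
  assumes "F 0 = f" and d: "\<And>n t. (F n has_vector_derivative F (Suc n) t) (at t)"
    and b: "\<And>m n. \<exists>C. \<forall>t. \<bar>t\<bar> ^ m * norm (F n t) \<le> C"
  shows "schwartz f" "(vderiv ^^ n) f = F n"
proof -
  have F: "(vderiv ^^ n) f = F n" for n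
  proof (induction n)
    case (Suc n)
    have "vderiv (F n) = F (Suc n)" using vector_derivative_at[OF d[of n]] by (simp add: vderiv_def[of "F n"])
    then show ?case by (simp add: Suc)
  qed (simp add: assms(1))
  then show "(vderiv ^^ n) f = F n" .
  have "bounded (range (\<lambda>t. t ^ m *\<^sub>R F n t))" for m n
    using b[of m n] unfolding bounded_iff by (auto simp: power_abs)
  then show "schwartz f"
    unfolding schwartz_def F using differentiableI_vector[OF d] by blast
qed

lemma schwartz_vderiv: "schwartz f \<Longrightarrow> schwartz (vderiv f)"
proof -
  have "(vderiv ^^ n) (vderiv f) = (vderiv ^^ Suc n) f" for n by (simp add: funpow_swap1)
  then show "schwartz f \<Longrightarrow> schwartz (vderiv f)" unfolding schwartz_def by presburger
qed

lemma schwartz_scale: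
  assumes "schwartz f" shows "schwartz (\<lambda>x. c * f x)"
proof (rule schwartzI(1))
  fix n t
  show "((\<lambda>x. c * (vderiv ^^ n) f x) has_vector_derivative c * (vderiv ^^ Suc n) f t) (at t)"
    by (rule has_vector_derivative_mult_right[OF schwartz_derivative[OF assms]])
next
  fix m n
  obtain C where "\<And>t. \<bar>t\<bar> ^ m * norm ((vderiv ^^ n) f t) \<le> C" using schwartz_decay[OF assms] by metis
  then have "\<bar>t\<bar> ^ m * norm (c * (vderiv ^^ n) f t) \<le> norm c * C" for t
    using mult_left_mono[of "\<bar>t\<bar> ^ m * norm ((vderiv ^^ n) f t)" C "norm c"] by (simp add: norm_mult mult_ac)
  then show "\<exists>C. \<forall>t. \<bar>t\<bar> ^ m * norm (c * (vderiv ^^ n) f t) \<le> C" by blast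
qed simp

lemma schwartz_mult_id:
  assumes f: "schwartz f" shows "schwartz (\<lambda>x. of_real x * f x)"
proof (rule schwartzI(1))
  fix n t
  \<comment> \<open>The Leibniz rule for \<open>x f\<close>; for \<open>n = 0\<close> the truncated
    index \<open>n - 1\<close> carries the coefficient 0.\<close>
  let ?F = "\<lambda>n x. of_real x * (vderiv ^^ n) f x + of_nat n * (vderiv ^^ (n - 1)) f x"
  have 1: "((\<lambda>x. of_real x * (vderiv ^^ n) f x) has_vector_derivative
      of_real t * (vderiv ^^ Suc n) f t + 1 * (vderiv ^^ n) f t) (at t)"
    by (intro has_vector_derivative_mult schwartz_derivative[OF f])
       (auto intro!: derivative_eq_intros has_vector_derivative_of_real)
  have 2: "((\<lambda>x. of_nat n * (vderiv ^^ (n - 1)) f x) has_vector_derivative of_nat n * (vderiv ^^ n) f t) (at t)"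
  proof (cases n)
    case (Suc k)
    then show ?thesis using has_vector_derivative_mult_right[OF schwartz_derivative[OF f, of k t]] by simp
  qed simp
  show "(?F n has_vector_derivative ?F (Suc n) t) (at t)"
    using has_vector_derivative_add[OF 1 2] by (simp add: algebra_simps)
next
  fix m n
  obtain C where C: "\<And>t. \<bar>t\<bar> ^ Suc m * norm ((vderiv ^^ n) f t) \<le> C" using schwartz_decay[OF f] by metis
  obtain C' where C': "\<And>t. \<bar>t\<bar> ^ m * norm ((vderiv ^^ (n - 1)) f t) \<le> C'" using schwartz_decay[OF f] by metis
  have "\<bar>t\<bar> ^ m * norm (of_real t * (vderiv ^^ n) f t + of_nat n * (vderiv ^^ (n - 1)) f t) \<le> C + real n * C'" for t
  proof -
    have "\<bar>t\<bar> ^ m * norm (of_real t * (vderiv ^^ n) f t + of_nat n * (vderiv ^^ (n - 1)) f t)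
       \<le> \<bar>t\<bar> ^ m * (norm (of_real t * (vderiv ^^ n) f t) + norm (of_nat n * (vderiv ^^ (n - 1)) f t))"
      by (intro mult_left_mono norm_triangle_ineq) auto
    also have "\<dots> = \<bar>t\<bar> ^ Suc m * norm ((vderiv ^^ n) f t) + real n * (\<bar>t\<bar> ^ m * norm ((vderiv ^^ (n - 1)) f t))"
      by (simp add: norm_mult algebra_simps)
    also have "\<dots> \<le> C + real n * C'" by (intro add_mono mult_left_mono C C') auto
    finally show ?thesis .
  qed
  then show "\<exists>C. \<forall>t. \<bar>t\<bar> ^ m * norm (of_real t * (vderiv ^^ n) f t + of_nat n * (vderiv ^^ (n - 1)) f t) \<le> C" by blast
qed simp

lemma schwartz_bound:
  assumes "schwartz f"
  obtains C where "C > 0" "\<And>t. norm (f t) \<le> C * inverse (1 + t\<^sup>2)"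
proof -
  obtain A where A: "A \<ge> 0" "\<And>t. \<bar>t\<bar> ^ 0 * norm ((vderiv ^^ 0) f t) \<le> A" using schwartz_decay[OF assms] by metis
  obtain B where B: "B \<ge> 0" "\<And>t. \<bar>t\<bar> ^ 2 * norm ((vderiv ^^ 0) f t) \<le> B" using schwartz_decay[OF assms] by metis
  have "norm (f t) \<le> (A + B + 1) * inverse (1 + t\<^sup>2)" for t
  proof -
    have "(1 + t\<^sup>2) * norm (f t) \<le> A + B + 1" using A(2)[of t] B(2)[of t] by (simp add: distrib_right)
    moreover have "1 + t\<^sup>2 > 0" by (intro add_pos_nonneg) auto
    ultimately show ?thesis by (simp add: field_simps)
  qed
  then show ?thesis using A(1) B(1) by (intro that[of "A + B + 1"]) auto
qed

lemma schwartz_continuous: "schwartz f \<Longrightarrow> continuous_on S f"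
  using schwartz_derivative[of f 0] by (auto intro!: continuous_at_imp_continuous_on has_vector_derivative_continuous)

lemma integrable_bound_square:
  fixes f :: "real \<Rightarrow> complex"
  assumes "continuous_on UNIV f" "\<And>t. norm (f t) \<le> C * inverse (1 + t\<^sup>2)"
  shows "integrable lborel f"
proof (rule Bochner_Integration.integrable_bound)
  show "integrable lborel (\<lambda>t. C * inverse (1 + t\<^sup>2))"
    using integrable_inverse_1_plus_square by (simp add: set_integrable_def)
  show "f \<in> borel_measurable lborel" using borel_measurable_continuous_onI[OF assms(1)] by simp
  show "AE t in lborel. norm (f t) \<le> norm (C * inverse (1 + t\<^sup>2))"
    using assms(2) by (intro always_eventually allI) (metis abs_ge_self order_trans real_norm_def)
qed

lemma schwartz_integrable: "schwartz f \<Longrightarrow> integrable lborel f"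
  using schwartz_bound integrable_bound_square schwartz_continuous by metis

lemma integrable_mult_bounded:
  fixes f h :: "real \<Rightarrow> complex"
  assumes "integrable lborel f" "continuous_on UNIV h" "\<And>t. norm (h t) \<le> B"
  shows "integrable lborel (\<lambda>t. f t * h t)"
proof (rule Bochner_Integration.integrable_bound[of _ "\<lambda>t. of_real B * f t"])
  show "integrable lborel (\<lambda>t. of_real B * f t)" using assms(1) by simp
  have "h \<in> borel_measurable borel" by (rule borel_measurable_continuous_onI[OF assms(2)])
  then show "(\<lambda>t. f t * h t) \<in> borel_measurable lborel"
    using borel_measurable_integrable[OF assms(1)] by auto
  have "norm (f t * h t) \<le> norm (of_real B * f t)" for t
  proof -
    have "norm (f t) * norm (h t) \<le> norm (f t) * \<bar>B\<bar>"
      using assms(3)[of t] by (intro mult_left_mono) auto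
    then show ?thesis by (simp add: norm_mult mult.commute)
  qed
  then show "AE t in lborel. norm (f t * h t) \<le> norm (of_real B * f t)" by simp
qed

section \<open>The Fourier transform of Schwartz functions\<close>

lemma fourier_iexp: "fourier f k = (CLINT x|lborel. f x * iexp (- (k * x)))"
  by (simp add: fourier_def mult.assoc)

lemma norm_iexp: "norm (iexp x) = 1"
  by simp

lemma integrable_fourier:
  assumes "integrable lborel f" shows "integrable lborel (\<lambda>x. f x * iexp (a * x))"
  by (rule integrable_mult_bounded[OF assms, of _ 1]) (auto intro!: continuous_intros)

text \<open>Lets the derivative of a Fourier transform be read off from a remainder estimate,
  instead of differentiating under the integral sign.\<close>

lemma has_vector_derivative_quadratic:
  fixes f :: "real \<Rightarrow> complex"
  assumes "\<And>h. norm (f (k + h) - f k - of_real h * d) \<le> C * h\<^sup>2"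
  shows "(f has_vector_derivative d) (at k)"
  unfolding has_vector_derivative_def has_derivative_at
proof
  show "bounded_linear (\<lambda>x. x *\<^sub>R d)" by (rule bounded_linear_scaleR_left)
  show "(\<lambda>h. norm (f (k + h) - f k - h *\<^sub>R d) / norm h) \<midarrow>0\<rightarrow> 0"
  proof (rule Lim_null_comparison[of _ "\<lambda>h. C * \<bar>h\<bar>"])
    have "norm (norm (f (k + h) - f k - h *\<^sub>R d) / norm h) \<le> C * \<bar>h\<bar>" for h
    proof (cases "h = 0")
      case False
      then show ?thesis using assms[of h] by (simp add: scaleR_conv_of_real divide_le_eq power2_eq_square)
    qed simp
    then show "\<forall>\<^sub>F h in at 0. norm (norm (f (k + h) - f k - h *\<^sub>R d) / norm h) \<le> C * \<bar>h\<bar>" by simp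
    have "((\<lambda>h. C * \<bar>h\<bar>) \<longlongrightarrow> C * \<bar>0\<bar>) (at 0)" by (intro tendsto_intros)
    then show "((\<lambda>h. C * \<bar>h\<bar>) \<longlongrightarrow> 0) (at 0)" by simp
  qed
qed

text \<open>The first-order Taylor remainder of the exponential is at most half the square of its
  argument, so the second moment of \<open>f\<close> controls the error.\<close>

lemma fourier_has_derivative:
  assumes f: "schwartz f"
  shows "(fourier f has_vector_derivative fourier (\<lambda>x. - \<i> * (of_real x * f x)) k) (at k)"
proof -
  let ?f1 = "\<lambda>x. - \<i> * (of_real x * f x)"
  let ?f2 = "\<lambda>x. of_real x * (of_real x * f x)"
  have f1: "schwartz ?f1" and f2: "schwartz ?f2" by (intro schwartz_scale schwartz_mult_id f)+
  define C where "C = (LINT x|lborel. norm (?f2 x)) / 2"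
  have "norm (fourier f (k + h) - fourier f k - of_real h * fourier ?f1 k) \<le> C * h\<^sup>2" for h
  proof -
    note i = schwartz_integrable[OF f] schwartz_integrable[OF f1] schwartz_integrable[OF f2]
    have e: "iexp (- ((k + h) * x)) = iexp (- (k * x)) * iexp (- (h * x))" for x
      by (simp add: exp_add[symmetric] algebra_simps)
    let ?g = "\<lambda>x. f x * iexp (- (k * x)) * (iexp (- (h * x)) - (1 + \<i> * of_real (- (h * x))))"
    have fi: "integrable lborel (\<lambda>x. f x * iexp (- (a * x)))" for a using integrable_fourier[OF i(1), of "- a"] by simp
    have fi1: "integrable lborel (\<lambda>x. ?f1 x * iexp (- (k * x)))" using integrable_fourier[OF i(2), of "- k"] by simp
    have "fourier f (k + h) - fourier f k - of_real h * fourier ?f1 k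
        = (CLINT x|lborel. f x * iexp (- ((k + h) * x)) - f x * iexp (- (k * x)) - of_real h * (?f1 x * iexp (- (k * x))))"
    proof -
      have "(CLINT x|lborel. A x - B x - d * C x) = (CLINT x|lborel. A x) - (CLINT x|lborel. B x) - d * (CLINT x|lborel. C x)"
        if "integrable lborel A" "integrable lborel B" "integrable lborel C" for A B C :: "real \<Rightarrow> complex" and d
        using that by simp
      from this[OF fi fi fi1] show ?thesis unfolding fourier_iexp by (rule sym)
    qed
    also have "\<dots> = (CLINT x|lborel. ?g x)"
      unfolding e by (intro Bochner_Integration.integral_cong refl) (simp add: algebra_simps)
    also have "norm \<dots> \<le> (LINT x|lborel. norm (?g x))" by (rule integral_norm_bound)
    also have "\<dots> \<le> (LINT x|lborel. h\<^sup>2 / 2 * norm (?f2 x))"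
    proof (rule integral_mono_AE')
      show "integrable lborel (\<lambda>x. h\<^sup>2 / 2 * norm (?f2 x))" using integrable_norm[OF i(3)] by simp
      have "norm (?g x) \<le> h\<^sup>2 / 2 * norm (?f2 x)" for x
      proof -
        have "norm (iexp (- (h * x)) - (1 + \<i> * of_real (- (h * x)))) \<le> \<bar>h * x\<bar> ^ 2 / 2"
          using iexp_approx1[of "- (h * x)" 1] by (simp add: numeral_2_eq_2)
        then have "norm (?g x) \<le> norm (f x) * (\<bar>h * x\<bar> ^ 2 / 2)"
          unfolding norm_mult norm_iexp mult_1_right by (intro mult_left_mono) auto
        then show ?thesis by (simp add: norm_mult power_mult_distrib power2_eq_square mult_ac)
      qed
      then show "AE x in lborel. norm (?g x) \<le> h\<^sup>2 / 2 * norm (?f2 x)" by simp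
    qed simp
    also have "\<dots> = C * h\<^sup>2" by (simp add: C_def)
    finally show ?thesis .
  qed
  then show ?thesis by (rule has_vector_derivative_quadratic)
qed

lemma vderiv_fourier: "schwartz f \<Longrightarrow> vderiv (fourier f) = fourier (\<lambda>x. - \<i> * (of_real x * f x))"
  using vector_derivative_at[OF fourier_has_derivative] by (simp add: vderiv_def fun_eq_iff)

lemma fourier_vderiv:
  assumes f: "schwartz f"
  shows "fourier (vderiv f) k = \<i> * of_real k * fourier f k"
proof -
  let ?F = "\<lambda>x. f x * iexp (- (k * x))"
  let ?G = "\<lambda>x. f x * (- \<i> * of_real k * iexp (- (k * x))) + vderiv f x * iexp (- (k * x))"
  have vf: "schwartz (vderiv f)" by (rule schwartz_vderiv[OF f])
  have e: "((\<lambda>x. iexp (- (k * x))) has_vector_derivative - \<i> * of_real k * iexp (- (k * x))) (at x)" for x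
    by (auto intro!: derivative_eq_intros has_vector_derivative_real_field simp: algebra_simps)
  have d: "(?F has_vector_derivative ?G x) (at x)" for x
    using has_vector_derivative_mult[OF schwartz_derivative[OF f, of 0 x] e[of x]] by simp
  have i1: "integrable lborel (\<lambda>x. f x * iexp (- (k * x)))"
    and i2: "integrable lborel (\<lambda>x. vderiv f x * iexp (- (k * x)))"
    using integrable_fourier[OF schwartz_integrable[OF f], of "- k"] integrable_fourier[OF schwartz_integrable[OF vf], of "- k"] by simp_all
  have G: "?G x = (- \<i> * of_real k) * (f x * iexp (- (k * x))) + vderiv f x * iexp (- (k * x))" for x
    by (simp add: algebra_simps)
  have iG: "integrable lborel ?G" unfolding G using i1 i2 by (intro Bochner_Integration.integrable_add integrable_mult_right) auto
  have lim: "(?F \<longlongrightarrow> 0) at_top" "(?F \<longlongrightarrow> 0) at_bot"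
  proof -
    obtain C where C: "\<And>t. \<bar>t\<bar> ^ 1 * norm ((vderiv ^^ 0) f t) \<le> C" using schwartz_decay[OF f] by metis
    have n: "norm (?F t) \<le> C * (1 / \<bar>t\<bar>)" if "t \<noteq> 0" for t
      using C[of t] that by (simp add: norm_mult field_simps)
    have LIM: "((\<lambda>t. C * (1 / \<bar>t\<bar>)) \<longlongrightarrow> C * 0) at_top"
      by (intro tendsto_mult tendsto_const tendsto_divide_0[OF tendsto_const] filterlim_at_top_imp_at_infinity filterlim_abs_real)
    show "(?F \<longlongrightarrow> 0) at_top"
      by (intro Lim_null_comparison[of ?F "\<lambda>t. C * (1 / \<bar>t\<bar>)"]) (rule eventually_mono[OF eventually_gt_at_top[of 0]], rule n, simp, use LIM in simp)
    have "filterlim (\<lambda>t::real. \<bar>t\<bar>) at_top at_bot"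
      unfolding filterlim_at_bot_mirror abs_minus_cancel by (rule filterlim_abs_real)
    then have LIM: "((\<lambda>t. C * (1 / \<bar>t\<bar>)) \<longlongrightarrow> C * 0) at_bot"
      by (intro tendsto_mult tendsto_const tendsto_divide_0[OF tendsto_const] filterlim_at_top_imp_at_infinity)
    show "(?F \<longlongrightarrow> 0) at_bot"
      by (intro Lim_null_comparison[of ?F "\<lambda>t. C * (1 / \<bar>t\<bar>)"]) (rule eventually_mono[OF eventually_le_at_bot[of "-1"]], rule n, simp, use LIM in simp)
  qed
  have "isCont ?G x" for x
    using schwartz_continuous[OF f, of UNIV] schwartz_continuous[OF vf, of UNIV]
    by (intro continuous_intros) (auto simp: continuous_on_eq_continuous_at)
  then have "(LBINT x=-\<infinity>..\<infinity>. ?G x) = 0 - 0"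
    using d iG lim
    by (intro interval_integral_FTC_integrable[where F="?F"]) (auto simp: set_integrable_def ereal_tendsto_simps)
  then have "(CLINT x|lborel. ?G x) = 0"
    by (simp add: interval_lebesgue_integral_def set_lebesgue_integral_def)
  moreover have "(CLINT x|lborel. ?G x) = (- \<i> * of_real k) * fourier f k + fourier (vderiv f) k"
    unfolding G fourier_iexp using i1 i2
    by (subst Bochner_Integration.integral_add) auto
  ultimately show ?thesis by (simp add: add_eq_0_iff)
qed

text \<open>Two integrations by parts yield quadratic decay, which suffices for
  integrability.\<close>

lemma fourier_bound:
  assumes f: "schwartz f"
  obtains C where "C > 0" "\<And>k. norm (fourier f k) \<le> C * inverse (1 + k\<^sup>2)"
proof -
  have b: "norm (fourier h k) \<le> (LINT x|lborel. norm (h x))" for h k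
    unfolding fourier_iexp by (rule order_trans[OF integral_norm_bound]) (simp add: norm_mult)
  define A B where "A = (LINT x|lborel. norm (f x))" "B = (LINT x|lborel. norm (vderiv (vderiv f) x))"
  have AB: "A \<ge> 0" "B \<ge> 0" by (simp_all add: A_B_def)
  have "norm (fourier f k) \<le> (A + B + 1) * inverse (1 + k\<^sup>2)" for k
  proof -
    have "fourier (vderiv (vderiv f)) k = - of_real (k\<^sup>2) * fourier f k"
    proof -
      have "\<i> * of_real k * (\<i> * of_real k * z) = - of_real (k\<^sup>2) * z" for z
      proof -
        have "\<i> * \<i> = -1" by simp
        then show ?thesis unfolding of_real_power by algebra
      qed
      then show ?thesis unfolding fourier_vderiv[OF schwartz_vderiv[OF f]] fourier_vderiv[OF f] by simp
    qed
    then have "k\<^sup>2 * norm (fourier f k) = norm (fourier (vderiv (vderiv f)) k)" by (simp add: norm_mult norm_power)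
    also have "\<dots> \<le> B" unfolding A_B_def by (rule b)
    finally have "(1 + k\<^sup>2) * norm (fourier f k) \<le> A + B + 1" using b[of f k] by (simp add: distrib_right A_B_def)
    moreover have "1 + k\<^sup>2 > 0" by (intro add_pos_nonneg) auto
    ultimately show ?thesis by (simp add: field_simps)
  qed
  then show ?thesis using AB by (intro that[of "A + B + 1"]) auto
qed

lemma fourier_continuous: "schwartz f \<Longrightarrow> continuous_on S (fourier f)"
  using fourier_has_derivative by (auto intro!: continuous_at_imp_continuous_on has_vector_derivative_continuous)

lemma fourier_integrable: "schwartz f \<Longrightarrow> integrable lborel (fourier f)"
proof -
  assume f: "schwartz f"
  obtain C where "\<And>k. norm (fourier f k) \<le> C * inverse (1 + k\<^sup>2)" using fourier_bound[OF f] by metis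
  from integrable_bound_square[OF fourier_continuous[OF f] this] show ?thesis .
qed

text \<open>Gaussian regularisation: both sides are computed from \<open>f\<close> by Fubini, and the regularising
  parameter tends to 0 by dominated convergence.\<close>

lemma fourier_gaussian:
  fixes f :: "real \<Rightarrow> complex"
  assumes f: "schwartz f" and e: "e > 0"
  shows "(CLINT t|lborel. fourier f t * iexp (x * t) * of_real (exp (- (e * t)\<^sup>2 / 2)))
    = 2 * pi * (CLINT u|lborel. f (x + e * u) * of_real (std_normal_density u))"
proof -
  let ?s = "std_normal_density"
  let ?g = "\<lambda>t. complex_of_real (exp (- (e * t)\<^sup>2 / 2))"
  have g: "exp (- (e * t)\<^sup>2 / 2) = sqrt (2 * pi) * ?s (e * t)" for t
    by (simp add: std_normal_density_def)
  \<comment> \<open>The Fourier transform of the Gaussian, taken from the characteristic function of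
    the standard normal distribution.\<close>
  have char: "(CLINT v|lborel. iexp (y * v) * of_real (?s v)) = of_real (exp (- y\<^sup>2 / 2))" for y
  proof -
    have "char std_normal_distribution y = (CLINT v|lborel. ?s v *\<^sub>R iexp (y * v))"
      unfolding char_def by (rule integral_density) auto
    then show ?thesis using char_std_normal_distribution by (simp add: scaleR_conv_of_real mult.commute)
  qed
  have ist: "integrable lborel (\<lambda>t. complex_of_real (?s t))"
    using integrable_std_normal_moment[of 0] by (simp add: integrable_of_real)
  have ig: "integrable lborel ?g"
  proof -
    have "integrable lborel (\<lambda>t. complex_of_real (?s (0 + e * t)))"
      using lborel_integrable_real_affine[OF ist, of e 0] e by simp
    then show ?thesis unfolding g by simp
  qed
  have inner: "(CLINT t|lborel. iexp ((x - y) * t) * ?g t) = 2 * pi / e * ?s ((y - x) / e)" for y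
  proof -
    have "(CLINT t|lborel. iexp ((x - y) * t) * ?g t)
       = \<bar>1 / e\<bar> *\<^sub>R (CLINT v|lborel. iexp ((x - y) * (0 + 1 / e * v)) * ?g (0 + 1 / e * v))"
      by (rule lborel_integral_real_affine) (use e in simp)
    also have "\<dots> = (1 / e) *\<^sub>R (CLINT v|lborel. complex_of_real (sqrt (2 * pi)) * (iexp (((x - y) / e) * v) * of_real (?s v)))"
      unfolding g using e by (simp add: mult_ac)
    also have "\<dots> = (1 / e) *\<^sub>R (complex_of_real (sqrt (2 * pi)) * of_real (exp (- ((x - y) / e)\<^sup>2 / 2)))"
      using char[of "(x - y) / e"] by (simp add: scaleR_conv_of_real)
    also have "exp (- ((x - y) / e)\<^sup>2 / 2) = sqrt (2 * pi) * ?s ((y - x) / e)"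
      by (simp add: std_normal_density_def power_divide power2_commute)
    also have "(1 / e) *\<^sub>R (complex_of_real (sqrt (2 * pi)) * of_real (sqrt (2 * pi) * ?s ((y - x) / e)))
       = of_real (1 / e * (sqrt (2 * pi) * sqrt (2 * pi)) * ?s ((y - x) / e))"
    proof -
      have "(1 / e) *\<^sub>R (complex_of_real k * of_real (k * m)) = of_real (1 / e * (k * k) * m)" for k m
        by (simp add: scaleR_conv_of_real mult.assoc)
      then show ?thesis .
    qed
    also have "sqrt (2 * pi) * sqrt (2 * pi) = 2 * pi" by simp
    finally show ?thesis by (simp del: of_real_mult add: of_real_mult[symmetric])
  qed
  let ?h = "\<lambda>t y. f y * (iexp ((x - y) * t) * ?g t)"
  have m[measurable]: "f \<in> borel_measurable borel" by (rule borel_measurable_continuous_onI[OF schwartz_continuous[OF f]])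
  have "integrable (lborel \<Otimes>\<^sub>M lborel) (case_prod ?h)"
  proof (rule lborel_pair.Fubini_integrable)
    show "case_prod ?h \<in> borel_measurable (lborel \<Otimes>\<^sub>M lborel)" by measurable
    have "(\<lambda>t. LINT y|lborel. norm (case (t, y) of (t, y) \<Rightarrow> ?h t y)) = (\<lambda>t. norm (?g t) * (LINT y|lborel. norm (f y)))"
      by (simp add: norm_mult mult.commute)
    then show "integrable lborel (\<lambda>t. LINT y|lborel. norm (case (t, y) of (t, y) \<Rightarrow> ?h t y))"
      using integrable_norm[OF ig] by simp
    have "integrable lborel (\<lambda>y. ?h t y)" for t
      by (rule integrable_mult_bounded[OF schwartz_integrable[OF f], of _ 1])
         (auto intro!: continuous_intros simp: norm_mult)
    then show "AE t in lborel. integrable lborel (\<lambda>y. case (t, y) of (t, y) \<Rightarrow> ?h t y)" by simp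
  qed
  from lborel_pair.Fubini_integral[OF this]
  have "(CLINT t|lborel. CLINT y|lborel. ?h t y) = (CLINT y|lborel. CLINT t|lborel. ?h t y)" by simp
  also have "(CLINT t|lborel. CLINT y|lborel. ?h t y) = (CLINT t|lborel. fourier f t * iexp (x * t) * ?g t)"
  proof (rule Bochner_Integration.integral_cong[OF refl])
    fix t
    have "(CLINT y|lborel. ?h t y) = (CLINT y|lborel. (f y * iexp (- (t * y))) * (iexp (x * t) * ?g t))"
      by (intro Bochner_Integration.integral_cong refl) (simp add: algebra_simps exp_add[symmetric] exp_diff exp_minus divide_simps)
    then show "(CLINT y|lborel. ?h t y) = fourier f t * iexp (x * t) * ?g t"
      unfolding integral_mult_left_zero fourier_iexp by (simp only: mult.assoc)
  qed
  also have "(CLINT y|lborel. CLINT t|lborel. ?h t y) = (CLINT y|lborel. f y * (2 * pi / e * ?s ((y - x) / e)))"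
    by (intro Bochner_Integration.integral_cong refl) (simp only: integral_mult_right_zero inner)
  also have "\<dots> = \<bar>e\<bar> *\<^sub>R (CLINT u|lborel. f (x + e * u) * (2 * pi / e * ?s ((x + e * u - x) / e)))"
    by (rule lborel_integral_real_affine) (use e in simp)
  also have "\<dots> = e *\<^sub>R (CLINT u|lborel. (2 * pi / e) * (f (x + e * u) * of_real (?s u)))"
    using e by (simp add: mult_ac)
  also have "\<dots> = 2 * pi * (CLINT u|lborel. f (x + e * u) * of_real (?s u))"
    using e by (simp add: scaleR_conv_of_real)
  finally show ?thesis .
qed

lemma fourier_inversion:
  fixes f :: "real \<Rightarrow> complex"
  assumes f: "schwartz f"
  shows "(CLINT t|lborel. fourier f t * iexp (x * t)) = 2 * pi * f x"
proof (rule LIMSEQ_unique)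
  \<comment> \<open>The regularising parameter runs through a sequence, to which dominated
    convergence applies.\<close>
  let ?e = "\<lambda>n. inverse (real (Suc n))"
  have e0: "?e \<longlonglongrightarrow> 0" by (rule LIMSEQ_inverse_real_of_nat)
  have mf[measurable]: "f \<in> borel_measurable borel" by (rule borel_measurable_continuous_onI[OF schwartz_continuous[OF f]])
  have mF[measurable]: "fourier f \<in> borel_measurable borel" by (rule borel_measurable_continuous_onI[OF fourier_continuous[OF f]])
  have ist: "integrable lborel (\<lambda>t. complex_of_real (std_normal_density t))"
    using integrable_std_normal_moment[of 0] by (simp add: integrable_of_real)
  show "(\<lambda>n. CLINT t|lborel. fourier f t * iexp (x * t) * of_real (exp (- (?e n * t)\<^sup>2 / 2)))
      \<longlonglongrightarrow> (CLINT t|lborel. fourier f t * iexp (x * t))"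
  proof (rule integral_dominated_convergence[where w="\<lambda>t. norm (fourier f t)"])
    show "integrable lborel (\<lambda>t. norm (fourier f t))" using fourier_integrable[OF f] by simp
    have "(\<lambda>n. fourier f t * iexp (x * t) * complex_of_real (exp (- (?e n * t)\<^sup>2 / 2)))
        \<longlonglongrightarrow> fourier f t * iexp (x * t) * complex_of_real (exp (- (0 * t)\<^sup>2 / 2))" for t
      by (intro tendsto_intros e0) auto
    then show "AE t in lborel. (\<lambda>n. fourier f t * iexp (x * t) * complex_of_real (exp (- (?e n * t)\<^sup>2 / 2)))
        \<longlonglongrightarrow> fourier f t * iexp (x * t)" by simp
    show "AE t in lborel. norm (fourier f t * iexp (x * t) * complex_of_real (exp (- (?e n * t)\<^sup>2 / 2))) \<le> norm (fourier f t)" for n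
      by (intro always_eventually allI) (simp add: norm_mult mult_left_le)
  qed measurable
  obtain C where C: "\<And>t. \<bar>t\<bar> ^ 0 * norm ((vderiv ^^ 0) f t) \<le> C" using schwartz_decay[OF f] by metis
  have "(\<lambda>n. 2 * pi * (CLINT u|lborel. f (x + ?e n * u) * of_real (std_normal_density u)))
      \<longlonglongrightarrow> 2 * pi * (CLINT u|lborel. f x * of_real (std_normal_density u))"
  proof (intro tendsto_mult tendsto_const integral_dominated_convergence[where w="\<lambda>u. C * std_normal_density u"])
    show "integrable lborel (\<lambda>u. C * std_normal_density u)" by simp
    have "isCont f x" using schwartz_continuous[OF f, of UNIV] by (simp add: continuous_on_eq_continuous_at)
    then have "(\<lambda>n. f (x + ?e n * u)) \<longlonglongrightarrow> f x" for u
      by (rule isCont_tendsto_compose) (use tendsto_add[OF tendsto_const[of x] tendsto_mult_left_zero[OF e0, of u]] in simp)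
    then show "AE u in lborel. (\<lambda>n. f (x + ?e n * u) * complex_of_real (std_normal_density u)) \<longlonglongrightarrow> f x * complex_of_real (std_normal_density u)"
      by (intro always_eventually allI tendsto_mult tendsto_const)
    show "AE u in lborel. norm (f (x + ?e n * u) * complex_of_real (std_normal_density u)) \<le> C * std_normal_density u" for n
      using C by (intro always_eventually allI) (simp add: norm_mult mult_right_mono)
  qed measurable
  also have "(CLINT u|lborel. f x * of_real (std_normal_density u)) = f x"
    using integral_std_normal_moment_even[of 0] by simp
  finally show "(\<lambda>n. CLINT t|lborel. fourier f t * iexp (x * t) * of_real (exp (- (?e n * t)\<^sup>2 / 2))) \<longlonglongrightarrow> 2 * pi * f x"
    by (simp only: fourier_gaussian[OF f] inverse_positive_iff_positive of_nat_0_less_iff zero_less_Suc)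
qed

section \<open>The distribution \<open>1 / sin c(t + i0)\<close>\<close>

lemma summable_schwartz:
  assumes f: "schwartz f" and c: "c > 0"
  shows "summable (\<lambda>j. norm (f ((2 * real j + 1) * c)))"
proof -
  obtain C where C: "C > 0" "\<And>t. norm (f t) \<le> C * inverse (1 + t\<^sup>2)" using schwartz_bound[OF f] by metis
  have "norm (f ((2 * real j + 1) * c)) \<le> (C / c\<^sup>2) * inverse (real (Suc j) ^ 2)" for j
  proof -
    have "c\<^sup>2 * (real (Suc j))\<^sup>2 \<le> 1 + ((2 * real j + 1) * c)\<^sup>2"
    proof -
      have "(c * real (Suc j))\<^sup>2 \<le> ((2 * real j + 1) * c)\<^sup>2" using c by (intro power_mono) auto
      then show ?thesis unfolding power_mult_distrib by simp
    qed
    then have "inverse (1 + ((2 * real j + 1) * c)\<^sup>2) \<le> inverse (c\<^sup>2 * (real (Suc j))\<^sup>2)"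
      using c by (intro le_imp_inverse_le) auto
    then have "C * inverse (1 + ((2 * real j + 1) * c)\<^sup>2) \<le> C * inverse (c\<^sup>2 * (real (Suc j))\<^sup>2)"
      using C(1) by (intro mult_left_mono) auto
    with C(2)[of "(2 * real j + 1) * c"] show ?thesis by (simp add: divide_inverse mult.assoc)
  qed
  moreover have "summable (\<lambda>j. (C / c\<^sup>2) * inverse (real (Suc j) ^ 2))"
  proof (intro summable_mult)
    have "summable (\<lambda>n. inverse (real n ^ 2))" by (rule inverse_power_summable) simp
    then show "summable (\<lambda>j. inverse (real (Suc j) ^ 2))" by (rule summable_Suc_iff[THEN iffD2])
  qed
  ultimately show ?thesis
    using summable_comparison_test'[of "\<lambda>j. (C / c\<^sup>2) * inverse (real (Suc j) ^ 2)" 0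
        "\<lambda>j. norm (f ((2 * real j + 1) * c))"] by simp
qed

text \<open>For \<open>w = exp (\<i> * z)\<close> one has
  \<open>1 / sin z = - 2 * \<i> * w / (1 - w\<^sup>2)\<close>. The shift into the upper half plane
  makes the modulus of \<open>w\<close> less than 1, and the geometric series in
  \<open>w\<^sup>2\<close> produces the odd powers.\<close>

lemma inv_sin_series:
  assumes "c > 0" "e > 0"
  shows "(\<lambda>j. - 2 * \<i> * (of_real (exp (- ((2 * real j + 1) * c * e))) * iexp ((2 * real j + 1) * c * t)))
    sums (1 / sin (of_real c * (of_real t + \<i> * of_real e)))"
proof -
  define z where "z = of_real c * (of_real t + \<i> * of_real e)"
  define w where "w = exp (\<i> * z)"
  have nw: "norm w = exp (- (c * e))" by (simp add: w_def z_def)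
  have w1: "norm w < 1" unfolding nw using assms by simp
  have w0: "w \<noteq> 0" by (simp add: w_def)
  have "norm (w\<^sup>2) < 1" using w1 by (simp add: norm_power power_less_one_iff)
  from sums_mult[OF geometric_sums[OF this], of "- 2 * \<i> * w"]
  have s: "(\<lambda>j. - 2 * \<i> * w * (w\<^sup>2) ^ j) sums (- 2 * \<i> * w * (1 / (1 - w\<^sup>2)))" .
  have "- 2 * \<i> * w * (1 / (1 - w\<^sup>2)) = 1 / sin z"
  proof -
    have "sin z = (w - inverse w) / (2 * \<i>)" by (simp add: sin_exp_eq w_def exp_minus)
    moreover have "w - inverse w = (w\<^sup>2 - 1) / w" using w0 by (simp add: field_simps power2_eq_square)
    ultimately have sz: "sin z = (w\<^sup>2 - 1) / w / (2 * \<i>)" by simp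
    have "w\<^sup>2 \<noteq> 1" using \<open>norm (w\<^sup>2) < 1\<close> by (metis norm_one less_irrefl)
    then show ?thesis unfolding sz using w0 by (simp add: divide_simps)
  qed
  moreover have "- 2 * \<i> * w * (w\<^sup>2) ^ j = - 2 * \<i> * (of_real (exp (- ((2 * real j + 1) * c * e))) * iexp ((2 * real j + 1) * c * t))" for j
  proof -
    have "w * (w\<^sup>2) ^ j = w ^ (2 * j + 1)" by (simp add: power_mult[symmetric] mult.commute)
    also have "\<dots> = exp (of_nat (2 * j + 1) * (\<i> * z))" unfolding w_def by (rule exp_of_nat_mult[symmetric])
    also have "of_nat (2 * j + 1) * (\<i> * z) = of_real (- ((2 * real j + 1) * c * e)) + \<i> * of_real ((2 * real j + 1) * c * t)"
      by (simp add: z_def algebra_simps)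
    finally show ?thesis by (simp only: exp_add exp_of_real mult.assoc)
  qed
  ultimately show ?thesis using s by (simp only: z_def)
qed

text \<open>For positive \<open>e\<close> the series converges absolutely, uniformly in
  \<open>t\<close>, and is integrated termwise; Fourier inversion evaluates each term, and its
  factor \<open>2 * pi\<close> turns \<open>- 2 * \<i>\<close> into \<open>- 4 * pi * \<i>\<close>.
  As \<open>e\<close> tends to 0, Tannery's theorem applies with the dominating series given by the
  decay of \<open>f\<close>.\<close>

lemma inv_sin_dist_fourier:
  fixes f :: "real \<Rightarrow> complex"
  assumes f: "schwartz f" and c: "c > 0"
  shows "inv_sin_dist c (fourier f) = - 4 * pi * \<i> * (\<Sum>j. f ((2 * real j + 1) * c))"
proof -
  let ?l = "\<lambda>j. (2 * real j + 1) * c"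
  note sf = summable_schwartz[OF f c]
  have val: "(CLINT t|lborel. fourier f t / sin (of_real c * (of_real t + \<i> * of_real e)))
      = (\<Sum>j. - 4 * pi * \<i> * (of_real (exp (- (?l j * e))) * f (?l j)))" if e: "e > 0" for e
  proof -
    let ?g = "\<lambda>j t. fourier f t * (- 2 * \<i> * (of_real (exp (- (?l j * e))) * iexp (?l j * t)))"
    have geo: "summable (\<lambda>j. exp (- (?l j * e)))"
    proof -
      have "summable (\<lambda>j. exp (- (c * e)) * exp (- (2 * c * e)) ^ j)"
        using c e by (intro summable_mult summable_geometric) auto
      moreover have "exp (- (c * e)) * exp (- (2 * c * e)) ^ j = exp (- (?l j * e))" for j
        by (simp add: exp_of_nat_mult[symmetric] exp_add[symmetric] algebra_simps)
      ultimately show ?thesis by simp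
    qed
    have n: "norm (?g j t) = 2 * exp (- (?l j * e)) * norm (fourier f t)" for j t
      by (simp add: norm_mult)
    have ig: "integrable lborel (?g j)" for j
    proof -
      have "integrable lborel (\<lambda>t. (- 2 * \<i> * of_real (exp (- (?l j * e)))) * (fourier f t * iexp (?l j * t)))"
        by (intro integrable_mult_right integrable_fourier fourier_integrable[OF f])
      then show ?thesis by (simp add: mult_ac)
    qed
    have "(CLINT t|lborel. fourier f t / sin (of_real c * (of_real t + \<i> * of_real e))) = (CLINT t|lborel. (\<Sum>j. ?g j t))"
    proof (rule Bochner_Integration.integral_cong[OF refl])
      show "fourier f t / sin (of_real c * (of_real t + \<i> * of_real e)) = (\<Sum>j. ?g j t)" for t
        using sums_unique[OF sums_mult[OF inv_sin_series[OF c e, of t], of "fourier f t"]]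
        by (simp only: times_divide_eq_right mult_1_right)
    qed
    also have "\<dots> = (\<Sum>j. CLINT t|lborel. ?g j t)"
    proof (rule integral_suminf[OF ig])
      show "AE t in lborel. summable (\<lambda>j. norm (?g j t))"
        unfolding n by (intro always_eventually allI summable_mult2 summable_mult geo)
      show "summable (\<lambda>j. LINT t|lborel. norm (?g j t))"
        unfolding n by (simp add: summable_mult2 summable_mult geo)
    qed
    also have "(\<lambda>j. CLINT t|lborel. ?g j t) = (\<lambda>j. - 4 * pi * \<i> * (of_real (exp (- (?l j * e))) * f (?l j)))"
    proof
      fix j
      have "(CLINT t|lborel. ?g j t) = (CLINT t|lborel. (- 2 * \<i> * of_real (exp (- (?l j * e)))) * (fourier f t * iexp (?l j * t)))"
        by (simp add: mult_ac)
      also have "\<dots> = (- 2 * \<i> * of_real (exp (- (?l j * e)))) * (2 * pi * f (?l j))"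
        by (simp only: integral_mult_right_zero fourier_inversion[OF f])
      finally show "(CLINT t|lborel. ?g j t) = - 4 * pi * \<i> * (of_real (exp (- (?l j * e))) * f (?l j))" by simp
    qed
    finally show ?thesis .
  qed
  have "((\<lambda>e. \<Sum>j. - 4 * pi * \<i> * (of_real (exp (- (?l j * e))) * f (?l j))) \<longlongrightarrow> (\<Sum>j. - 4 * pi * \<i> * (of_real (exp (- (?l j * 0))) * f (?l j)))) (at_right 0)"
  proof (rule tannerys_theorem[THEN conjunct2, THEN conjunct2])
    show "((\<lambda>e. - 4 * pi * \<i> * (of_real (exp (- (?l j * e))) * f (?l j))) \<longlongrightarrow> - 4 * pi * \<i> * (of_real (exp (- (?l j * 0))) * f (?l j))) (at_right 0)" for j
      by (intro tendsto_intros)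
    show "summable (\<lambda>j. 4 * pi * norm (f (?l j)))" by (intro summable_mult sf)
    have "\<forall>\<^sub>F e in at_right (0::real). e > 0" by (rule eventually_at_right_less)
    then have "\<forall>\<^sub>F (j, e) in (at_top :: nat filter) \<times>\<^sub>F at_right (0::real). e > 0"
      using eventually_prod2[of "at_top :: nat filter" "\<lambda>e. e > (0::real)" "at_right 0"] by (simp add: case_prod_beta)
    then show "\<forall>\<^sub>F (j, e) in at_top \<times>\<^sub>F at_right 0. norm (- 4 * pi * \<i> * (of_real (exp (- (?l j * e))) * f (?l j))) \<le> 4 * pi * norm (f (?l j))"
    proof (rule eventually_mono)
      fix q :: "nat \<times> real" assume q: "case q of (j, e) \<Rightarrow> e > 0"
      have "exp (- (?l (fst q) * snd q)) \<le> 1" using q c by (cases q) simp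
      then show "case q of (j, e) \<Rightarrow> norm (- 4 * pi * \<i> * (of_real (exp (- (?l j * e))) * f (?l j))) \<le> 4 * pi * norm (f (?l j))"
        by (cases q) (simp add: norm_mult mult_left_le_one_le)
    qed
  qed simp
  moreover have "(\<Sum>j. - 4 * pi * \<i> * (of_real (exp (- (?l j * 0))) * f (?l j))) = - 4 * pi * \<i> * (\<Sum>j. f (?l j))"
    using suminf_mult[OF summable_norm_cancel[OF sf], of "- 4 * pi * \<i>"] by simp
  ultimately have "((\<lambda>e. CLINT t|lborel. fourier f t / sin (of_real c * (of_real t + \<i> * of_real e))) \<longlongrightarrow> - 4 * pi * \<i> * (\<Sum>j. f (?l j))) (at_right 0)"
    by (subst tendsto_cong[OF eventually_mono[OF eventually_at_right_less[of 0] val]]) simp_all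
  then show ?thesis unfolding inv_sin_dist_def by (intro tendsto_Lim) auto
qed

section \<open>Asymptotic expansion of the explicit sum\<close>

text \<open>For a nonnegative increment the remainder integral involves only points to the right of
  \<open>x\<close>, where the derivative is bounded by a constant times any negative power of
  \<open>x\<close>. The bound therefore holds for increments of any size.\<close>

lemma schwartz_taylor_remainder:
  assumes f: "schwartz f"
  obtains C where "C \<ge> 0" "\<And>x h. 0 < x \<Longrightarrow> 0 \<le> h \<Longrightarrow>
    norm (f (x + h) - (\<Sum>k<n. of_real (h ^ k / fact k) * (vderiv ^^ k) f x)) \<le> C * h ^ n / x ^ m"
proof -
  obtain C where C: "C \<ge> 0" "\<And>t. \<bar>t\<bar> ^ m * norm ((vderiv ^^ n) f t) \<le> C" using schwartz_decay[OF f] by metis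
  have b: "norm ((vderiv ^^ n) f s) \<le> C / x ^ m" if "0 < x" "x \<le> s" for s x
  proof -
    have "x ^ m * norm ((vderiv ^^ n) f s) \<le> \<bar>s\<bar> ^ m * norm ((vderiv ^^ n) f s)"
      using that by (intro mult_right_mono power_mono) auto
    also have "\<dots> \<le> C" by (rule C)
    finally show ?thesis using that by (simp add: field_simps)
  qed
  have "norm (f (x + h) - (\<Sum>k<n. of_real (h ^ k / fact k) * (vderiv ^^ k) f x)) \<le> C * h ^ n / x ^ m"
    if x: "0 < x" and h: "0 \<le> h" for x h
  proof (cases "n = 0")
    \<comment> \<open>Taylor's formula with integral remainder requires \<open>0 < n\<close>; for
      \<open>n = 0\<close> the claim is the decay bound itself.\<close>
    case True
    then show ?thesis using b[OF x, of "x + h"] h by simp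
  next
    case False
    let ?i = "\<lambda>s. ((x + h - s) ^ (n - 1) / fact (n - 1)) *\<^sub>R (vderiv ^^ n) f s"
    have t: "(?i has_integral f (x + h) - (\<Sum>k<n. ((x + h - x) ^ k / fact k) *\<^sub>R (vderiv ^^ k) f x)) {x..x + h}"
    proof (rule Taylor_has_integral)
      show "0 < n" "x \<le> x + h" "(vderiv ^^ 0) f = f" using False h by auto
    qed (rule has_vector_derivative_at_within[OF schwartz_derivative[OF f]])
    have "norm (f (x + h) - (\<Sum>k<n. ((x + h - x) ^ k / fact k) *\<^sub>R (vderiv ^^ k) f x))
        \<le> (h ^ (n - 1) * (C / x ^ m)) * measure lborel (cbox x (x + h))"
    proof (rule has_integral_bound)
      show "0 \<le> h ^ (n - 1) * (C / x ^ m)" using C(1) x h by simp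
      show "(?i has_integral f (x + h) - (\<Sum>k<n. ((x + h - x) ^ k / fact k) *\<^sub>R (vderiv ^^ k) f x)) (cbox x (x + h))"
        using t by simp
      fix s assume s: "s \<in> cbox x (x + h)"
      have "(x + h - s) ^ (n - 1) / fact (n - 1) \<le> h ^ (n - 1) / 1"
        using s by (intro frac_le power_mono) (auto simp: fact_ge_1)
      moreover have "norm ((vderiv ^^ n) f s) \<le> C / x ^ m" using b[OF x] s by auto
      ultimately show "norm (?i s) \<le> h ^ (n - 1) * (C / x ^ m)"
        unfolding norm_scaleR using s h by (intro mult_mono) auto
    qed
    also have "\<dots> = C * h ^ n / x ^ m"
      using False h by (cases n) (auto simp: field_simps)
    finally show ?thesis by (simp add: scaleR_conv_of_real)
  qed
  with C(1) show ?thesis by (rule that)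
qed

section \<open>Taylor expansion of the trace in powers of 1/N\<close>

context
  fixes R :: real
  assumes R: "R > 0"
begin

text \<open>\<open>lam j\<close> is the Landau level of the constant field
  \<open>1 / (2 * R\<^sup>2)\<close>, and \<open>mu j / N\<close> the correction due to the
  curvature of the sphere.\<close>

definition lam :: "nat \<Rightarrow> real" where "lam j = (2 * real j + 1) * (1 / (2 * R\<^sup>2))"
definition mu :: "nat \<Rightarrow> real" where "mu j = real j * (real j + 1) / R\<^sup>2"

definition coef :: "nat \<Rightarrow> (real \<Rightarrow> complex) \<Rightarrow> nat \<Rightarrow> complex" where
  "coef k \<phi> j = of_real (mu j ^ k / fact k) * (vderiv ^^ k) \<phi> (lam j)"

text \<open>The multiplicity is \<open>N\<close> plus \<open>2 * j + 1\<close>, so the power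
  \<open>1 - k\<close> of \<open>N\<close> receives the Taylor term \<open>k\<close> from the first
  summand and the term \<open>k - 1\<close> from the second.\<close>

definition expansion :: "nat \<Rightarrow> (real \<Rightarrow> complex) \<Rightarrow> complex" where
  "expansion k \<phi> = (\<Sum>j. coef k \<phi> j + (if k = 0 then 0 else of_real (2 * real j + 1) * coef (k - 1) \<phi> j))"

lemma lam_pos: "lam j > 0"
  using R by (simp add: lam_def)

lemma mu_le: "0 \<le> mu j" "mu j \<le> R\<^sup>2 * lam j ^ 2"
proof -
  show "0 \<le> mu j" by (simp add: mu_def)
  have "R\<^sup>2 * lam j ^ 2 = (2 * real j + 1)\<^sup>2 / (4 * R\<^sup>2)" using R by (simp add: lam_def power_mult_distrib power_divide field_simps power2_eq_square)
  moreover have "mu j = (4 * (real j * (real j + 1))) / (4 * R\<^sup>2)" by (simp add: mu_def)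
  moreover have "4 * (real j * (real j + 1)) / (4 * R\<^sup>2) \<le> (2 * real j + 1)\<^sup>2 / (4 * R\<^sup>2)"
    by (rule divide_right_mono) (simp_all add: power2_eq_square algebra_simps)
  ultimately show "mu j \<le> R\<^sup>2 * lam j ^ 2" by metis
qed

abbreviation "sq j \<equiv> inverse (real (Suc j) ^ 2)"

lemma summable_sq: "summable sq"
proof -
  have "summable (\<lambda>n. inverse (real n ^ 2))" by (rule inverse_power_summable) simp
  then show ?thesis by (rule summable_Suc_iff[THEN iffD2])
qed

text \<open>Of the \<open>2 * n + 3\<close> powers of \<open>lam j\<close> in the denominator,
  \<open>2 * n\<close> absorb \<open>mu j ^ n\<close>, one absorbs the weight
  \<open>2 * j + 1\<close>, and two remain for convergence.\<close>

lemma weight_bound: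
  assumes C: "C \<ge> 0"
  obtains B where "B \<ge> 0" "\<And>j. (2 * real j + 1) * (C * mu j ^ n / lam j ^ (2 * n + 3)) \<le> B * sq j"
proof -
  define B where "B = 2 * R\<^sup>2 * C * (R\<^sup>2) ^ n * (2 * R\<^sup>2)\<^sup>2"
  have "(2 * real j + 1) * (C * mu j ^ n / lam j ^ (2 * n + 3)) \<le> B * sq j" for j
  proof -
    have l: "lam j > 0" by (rule lam_pos)
    have w: "2 * real j + 1 = 2 * R\<^sup>2 * lam j" using R by (simp add: lam_def)
    have "mu j ^ n \<le> (R\<^sup>2 * lam j ^ 2) ^ n" using mu_le by (intro power_mono) auto
    then have "(2 * real j + 1) * (C * mu j ^ n / lam j ^ (2 * n + 3)) \<le> (2 * real j + 1) * (C * (R\<^sup>2 * lam j ^ 2) ^ n / lam j ^ (2 * n + 3))"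
      using l C by (intro mult_left_mono divide_right_mono) auto
    also have "\<dots> = 2 * R\<^sup>2 * C * (R\<^sup>2) ^ n * inverse (lam j ^ 2)"
      unfolding w using l by (simp add: power_mult_distrib power_mult[symmetric] power_add divide_simps eval_nat_numeral)
    also have "inverse (lam j ^ 2) \<le> (2 * R\<^sup>2)\<^sup>2 * sq j"
    proof -
      have "(real (Suc j) * (1 / (2 * R\<^sup>2)))\<^sup>2 \<le> lam j ^ 2"
        unfolding lam_def using R by (intro power_mono mult_right_mono) auto
      then have "inverse (lam j ^ 2) \<le> inverse ((real (Suc j) * (1 / (2 * R\<^sup>2)))\<^sup>2)"
        using R by (intro le_imp_inverse_le) auto
      also have "\<dots> = (2 * R\<^sup>2)\<^sup>2 * sq j" by (simp add: power_mult_distrib power_divide field_simps)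
      finally show ?thesis .
    qed
    finally show ?thesis using C by (simp add: B_def mult_left_mono mult.assoc)
  qed
  moreover have "B \<ge> 0" using C by (simp add: B_def)
  ultimately show ?thesis using that by blast
qed

definition rem :: "nat \<Rightarrow> (real \<Rightarrow> complex) \<Rightarrow> nat \<Rightarrow> nat \<Rightarrow> complex" where
  "rem n \<phi> N j = \<phi> (lam j + mu j / real N) - (\<Sum>k<n. coef k \<phi> j / of_nat N ^ k)"

lemma rem_bound:
  assumes f: "schwartz \<phi>"
  obtains B where "B \<ge> 0" "\<And>N j. N \<ge> 1 \<Longrightarrow> (2 * real j + 1) * norm (rem n \<phi> N j) \<le> B * sq j / real N ^ n"
proof -
  obtain C where C: "C \<ge> 0" "\<And>x h. 0 < x \<Longrightarrow> 0 \<le> h \<Longrightarrow>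
    norm (\<phi> (x + h) - (\<Sum>k<n. of_real (h ^ k / fact k) * (vderiv ^^ k) \<phi> x)) \<le> C * h ^ n / x ^ (2 * n + 3)"
    by (rule schwartz_taylor_remainder[OF f, of n "2 * n + 3"]) blast
  obtain B where B: "B \<ge> 0" "\<And>j. (2 * real j + 1) * (C * mu j ^ n / lam j ^ (2 * n + 3)) \<le> B * sq j"
    using weight_bound[OF C(1)] by metis
  have "(2 * real j + 1) * norm (rem n \<phi> N j) \<le> B * sq j / real N ^ n" if N: "N \<ge> 1" for N j
  proof -
    have "rem n \<phi> N j = \<phi> (lam j + mu j / real N) - (\<Sum>k<n. of_real ((mu j / real N) ^ k / fact k) * (vderiv ^^ k) \<phi> (lam j))"
      by (simp add: rem_def coef_def power_divide mult.commute)
    then have "norm (rem n \<phi> N j) \<le> C * (mu j / real N) ^ n / lam j ^ (2 * n + 3)"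
      using C(2)[OF lam_pos, of "mu j / real N" j] mu_le(1)[of j] by simp
    then have "(2 * real j + 1) * norm (rem n \<phi> N j) \<le> (2 * real j + 1) * (C * (mu j / real N) ^ n / lam j ^ (2 * n + 3))"
      by (intro mult_left_mono) auto
    also have "\<dots> = ((2 * real j + 1) * (C * mu j ^ n / lam j ^ (2 * n + 3))) / real N ^ n"
      by (simp add: power_divide)
    also have "\<dots> \<le> B * sq j / real N ^ n" using B(2) by (intro divide_right_mono) auto
    finally show ?thesis .
  qed
  with B(1) show ?thesis by (rule that)
qed

lemma norm_le_weighted: "norm z \<le> (2 * real j + 1) * norm z"
  using mult_right_mono[of 1 "2 * real j + 1" "norm z"] by simp

lemma summable_rem:
  assumes "schwartz \<phi>" "N \<ge> 1"
  shows "summable (\<lambda>j. norm (of_real (2 * real j + 1) * rem n \<phi> N j))" "summable (\<lambda>j. norm (rem n \<phi> N j))"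
proof -
  obtain B where B: "B \<ge> 0" "\<And>N j. N \<ge> 1 \<Longrightarrow> (2 * real j + 1) * norm (rem n \<phi> N j) \<le> B * sq j / real N ^ n"
    using rem_bound[OF assms(1)] by metis
  have s: "summable (\<lambda>j. B / real N ^ n * sq j)" by (intro summable_mult summable_sq)
  have n: "norm (complex_of_real (2 * real j + 1) * rem n \<phi> N j) = (2 * real j + 1) * norm (rem n \<phi> N j)" for j
    unfolding norm_mult norm_of_real by simp
  show "summable (\<lambda>j. norm (of_real (2 * real j + 1) * rem n \<phi> N j))"
    by (rule summable_comparison_test'[OF s, of 0]) (unfold n, use B(2)[OF assms(2)] in simp)
  show "summable (\<lambda>j. norm (rem n \<phi> N j))"
    by (rule summable_comparison_test'[OF s, of 0])
       (use B(2)[OF assms(2)] norm_le_weighted order_trans in \<open>fastforce\<close>)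
qed

text \<open>Each Taylor term is the difference of two consecutive remainders at
  \<open>N = 1\<close>, so summability is inherited from theirs.\<close>

lemma summable_coef:
  assumes f: "schwartz \<phi>"
  shows "summable (\<lambda>j. of_real (2 * real j + 1) * coef k \<phi> j)" "summable (coef k \<phi>)"
proof -
  have "rem k \<phi> 1 j - rem (Suc k) \<phi> 1 j = coef k \<phi> j" for j by (simp add: rem_def)
  then have e: "of_real (2 * real j + 1) * coef k \<phi> j = of_real (2 * real j + 1) * rem k \<phi> 1 j - of_real (2 * real j + 1) * rem (Suc k) \<phi> 1 j"
    "coef k \<phi> j = rem k \<phi> 1 j - rem (Suc k) \<phi> 1 j" for j
    by (simp_all only: right_diff_distrib[symmetric])
  show "summable (\<lambda>j. of_real (2 * real j + 1) * coef k \<phi> j)"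
    unfolding e(1) by (intro summable_diff summable_norm_cancel[OF summable_rem(1)[OF f]]) auto
  have "summable (\<lambda>j. rem k \<phi> 1 j - rem (Suc k) \<phi> 1 j)"
    by (intro summable_diff summable_norm_cancel[OF summable_rem(2)[OF f]]) auto
  then show "summable (coef k \<phi>)" unfolding e(2)[symmetric] .
qed

text \<open>The part of the multiplicity proportional to \<open>N\<close> is expanded one order
  further than the part \<open>2 * j + 1\<close>, so that both remainders are of the same order in
  \<open>N\<close>.\<close>

lemma trace_sum_remainder:
  assumes f: "schwartz \<phi>" and N: "N \<ge> 1" and K: "K \<ge> 1"
  shows "(\<Sum>\<^sub>\<infinity>j. of_nat (N + 2 * j + 1) * \<phi> (lam j + mu j / real N)) - (\<Sum>k<K. expansion k \<phi> * of_nat N powi (1 - int k))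
    = (\<Sum>j. of_nat N * rem K \<phi> N j + of_real (2 * real j + 1) * rem (K - 1) \<phi> N j)"
proof -
  let ?n = "of_nat N :: complex"
  have n0: "?n \<noteq> 0" using N by simp
  have pw: "?n powi (1 - int k) = ?n / ?n ^ k" for k
    using n0 by (simp add: power_int_diff)
  let ?Y = "\<lambda>j. of_nat (N + 2 * j + 1) * \<phi> (lam j + mu j / real N)"
  have Y: "?Y j = ?n * rem 0 \<phi> N j + of_real (2 * real j + 1) * rem 0 \<phi> N j" for j
    by (simp add: rem_def algebra_simps)
  have sY: "summable (\<lambda>j. norm (?Y j))"
  proof (rule summable_comparison_test'[of _ 0])
    show "summable (\<lambda>j. real N * norm (rem 0 \<phi> N j) + norm (of_real (2 * real j + 1) * rem 0 \<phi> N j))"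
      by (intro summable_add summable_mult summable_rem[OF f N])
    show "norm (norm (?Y j)) \<le> real N * norm (rem 0 \<phi> N j) + norm (of_real (2 * real j + 1) * rem 0 \<phi> N j)" for j
      unfolding Y real_norm_def abs_norm_cancel by (rule order_trans[OF norm_triangle_ineq]) (simp add: norm_mult)
  qed
  have "(\<Sum>\<^sub>\<infinity>j. ?Y j) = (\<Sum>j. ?Y j)"
    using norm_summable_imp_has_sum[OF sY summable_sums[OF summable_norm_cancel[OF sY]]] by (rule infsumI)
  define T where "T k j = (coef k \<phi> j + (if k = 0 then 0 else of_real (2 * real j + 1) * coef (k - 1) \<phi> j)) * (?n / ?n ^ k)" for k j
  have sT: "summable (T k)" for k
    unfolding T_def using summable_coef[OF f]
    by (cases k) (auto intro!: summable_mult2 summable_add)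
  have "expansion k \<phi> * ?n powi (1 - int k) = (\<Sum>j. T k j)" for k
    unfolding expansion_def pw T_def using summable_coef[OF f]
    by (intro suminf_mult2 summable_add; cases k; simp del: of_real_add of_real_mult)
  then have "(\<Sum>k<K. expansion k \<phi> * ?n powi (1 - int k)) = (\<Sum>j. \<Sum>k<K. T k j)"
    using suminf_sum[of "{..<K}" T] sT by simp
  then have "(\<Sum>\<^sub>\<infinity>j. ?Y j) - (\<Sum>k<K. expansion k \<phi> * ?n powi (1 - int k)) = (\<Sum>j. ?Y j - (\<Sum>k<K. T k j))"
    using suminf_diff[OF summable_norm_cancel[OF sY] summable_sum[OF sT]] \<open>(\<Sum>\<^sub>\<infinity>j. ?Y j) = (\<Sum>j. ?Y j)\<close> by simp
  also have "(\<lambda>j. ?Y j - (\<Sum>k<K. T k j)) = (\<lambda>j. ?n * rem K \<phi> N j + of_real (2 * real j + 1) * rem (K - 1) \<phi> N j)"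
  proof
    fix j
    obtain L where L: "K = Suc L" using K by (cases K) auto
    have "(\<Sum>k<K. T k j) = (\<Sum>k<K. ?n * (coef k \<phi> j / ?n ^ k)) + (\<Sum>k<K. (if k = 0 then 0 else of_real (2 * real j + 1) * coef (k - 1) \<phi> j) * (?n / ?n ^ k))"
      unfolding T_def sum.distrib[symmetric] by (intro sum.cong refl) (simp add: algebra_simps)
    also have "(\<Sum>k<K. (if k = 0 then 0 else of_real (2 * real j + 1) * coef (k - 1) \<phi> j) * (?n / ?n ^ k))
        = (\<Sum>k<L. of_real (2 * real j + 1) * (coef k \<phi> j / ?n ^ k))"
      unfolding L sum.lessThan_Suc_shift using n0 by simp
    finally show "?Y j - (\<Sum>k<K. T k j) = ?n * rem K \<phi> N j + of_real (2 * real j + 1) * rem (K - 1) \<phi> N j"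
      by (simp add: L rem_def algebra_simps sum_distrib_left)
  qed
  finally show ?thesis .
qed

lemma trace_sum_expansion:
  assumes f: "schwartz \<phi>" and K: "K \<ge> 1"
  shows "(\<lambda>N. (\<Sum>\<^sub>\<infinity>j. of_nat (N + 2 * j + 1) * \<phi> (lam j + mu j / real N)) - (\<Sum>k<K. expansion k \<phi> * of_nat N powi (1 - int k)))
    \<in> O(\<lambda>N. of_nat N powi (1 - int K) :: complex)"
proof -
  obtain B1 where B1: "B1 \<ge> 0" "\<And>N j. N \<ge> 1 \<Longrightarrow> (2 * real j + 1) * norm (rem K \<phi> N j) \<le> B1 * sq j / real N ^ K"
    using rem_bound[OF f] by metis
  obtain B2 where B2: "B2 \<ge> 0" "\<And>N j. N \<ge> 1 \<Longrightarrow> (2 * real j + 1) * norm (rem (K - 1) \<phi> N j) \<le> B2 * sq j / real N ^ (K - 1)"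
    using rem_bound[OF f] by metis
  have "norm (\<Sum>j. of_nat N * rem K \<phi> N j + of_real (2 * real j + 1) * rem (K - 1) \<phi> N j)
      \<le> ((B1 + B2) * (\<Sum>j. sq j)) * norm (of_nat N powi (1 - int K) :: complex)" if N: "N \<ge> 1" for N
  proof -
    have nK: "real N ^ K = real N * real N ^ (K - 1)" using K by (cases K) auto
    have "norm (of_nat N * rem K \<phi> N j + of_real (2 * real j + 1) * rem (K - 1) \<phi> N j) \<le> (B1 + B2) / real N ^ (K - 1) * sq j" for j
    proof -
      have n: "norm (complex_of_real (2 * real j + 1) * rem (K - 1) \<phi> N j) = (2 * real j + 1) * norm (rem (K - 1) \<phi> N j)"
        unfolding norm_mult norm_of_real by simp
      have "norm (of_nat N * rem K \<phi> N j + of_real (2 * real j + 1) * rem (K - 1) \<phi> N j)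
        \<le> real N * norm (rem K \<phi> N j) + (2 * real j + 1) * norm (rem (K - 1) \<phi> N j)"
        unfolding n[symmetric] by (rule order_trans[OF norm_triangle_ineq]) (simp add: norm_mult)
      also have "real N * norm (rem K \<phi> N j) \<le> real N * (B1 * sq j / real N ^ K)"
        using order_trans[OF norm_le_weighted B1(2)[OF N]] by (intro mult_left_mono) auto
      also have "real N * (B1 * sq j / real N ^ K) = B1 * sq j / real N ^ (K - 1)" using N by (simp add: nK)
      also note B2(2)[OF N, of j]
      finally show ?thesis by (simp add: add_divide_distrib distrib_right)
    qed
    then have "norm (\<Sum>j. of_nat N * rem K \<phi> N j + of_real (2 * real j + 1) * rem (K - 1) \<phi> N j)
        \<le> (\<Sum>j. (B1 + B2) / real N ^ (K - 1) * sq j)"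
      by (rule norm_suminf_le) (intro summable_mult summable_sq)
    also have "\<dots> = (B1 + B2) / real N ^ (K - 1) * (\<Sum>j. sq j)" by (rule suminf_mult[OF summable_sq])
    also have "\<dots> = ((B1 + B2) * (\<Sum>j. sq j)) * norm (of_nat N powi (1 - int K) :: complex)"
    proof -
      have "norm (of_nat N powi (1 - int K) :: complex) = 1 / real N ^ (K - 1)"
        using N nK by (simp add: power_int_diff norm_divide norm_power)
      then show ?thesis by simp
    qed
    finally show ?thesis .
  qed
  then show ?thesis
    using trace_sum_remainder[OF f _ K]
    by (intro bigoI[of _ "(B1 + B2) * (\<Sum>j. sq j)"] eventually_mono[OF eventually_ge_at_top[of 1]]) simp
qed

lemma expansion_0:
  assumes f: "schwartz \<phi>"
  shows "expansion 0 \<phi> = \<i> / (4 * of_real pi) * inv_sin_dist (1 / (2 * R\<^sup>2)) (fourier \<phi>)"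
proof -
  have "inv_sin_dist (1 / (2 * R\<^sup>2)) (fourier \<phi>) = - 4 * pi * \<i> * (\<Sum>j. \<phi> (lam j))"
    unfolding lam_def by (rule inv_sin_dist_fourier[OF f]) (use R in simp)
  then show ?thesis by (simp add: expansion_def coef_def)
qed

text \<open>On Fourier transforms, multiplication by \<open>t\<close> becomes a derivative and two
  derivatives become multiplication by \<open>- x\<^sup>2\<close>. Hence \<open>T\<close> yields the
  sum of \<open>- 4 * pi * vderiv \<phi> (lam j)\<close>, and its second derivative yields
  \<open>4 * pi\<close> times the sum of the derivatives of \<open>x\<^sup>2 * \<phi> x\<close> at
  \<open>lam j\<close>. The constants of the operator come from
  \<open>mu j = R\<^sup>2 * (lam j)\<^sup>2 - 1 / (4 * R\<^sup>2)\<close> and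
  \<open>2 * j + 1 = 2 * R\<^sup>2 * lam j\<close>.\<close>

lemma expansion_1:
  assumes f: "schwartz \<phi>"
  defines "T \<equiv> dist_mult of_real (inv_sin_dist (1 / (2 * R\<^sup>2)))"
  shows "expansion 1 \<phi> = 1 / (4 * of_real pi) *
      (of_real (R\<^sup>2) * dist_deriv (dist_deriv T) (fourier \<phi>) + of_real (1 / (4 * R\<^sup>2)) * T (fourier \<phi>))"
proof -
  have T: "T (fourier \<psi>) = - 4 * pi * (\<Sum>j. vderiv \<psi> (lam j))" and sm: "summable (\<lambda>j. vderiv \<psi> (lam j))"
    if \<psi>: "schwartz \<psi>" for \<psi>
  proof -
    have v: "schwartz (vderiv \<psi>)" "schwartz (\<lambda>x. - \<i> * vderiv \<psi> x)"
      by (intro schwartz_scale schwartz_vderiv \<psi>)+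
    show s: "summable (\<lambda>j. vderiv \<psi> (lam j))"
      unfolding lam_def by (rule summable_norm_cancel[OF summable_schwartz[OF v(1)]]) (use R in simp)
    have "of_real t * fourier \<psi> t = fourier (\<lambda>x. - \<i> * vderiv \<psi> x) t" for t
    proof -
      have "fourier (\<lambda>x. - \<i> * vderiv \<psi> x) t = - \<i> * fourier (vderiv \<psi>) t"
        unfolding fourier_def by (simp only: mult.assoc integral_mult_right_zero)
      then show ?thesis unfolding fourier_vderiv[OF \<psi>] by (simp add: mult.assoc[symmetric])
    qed
    then have "T (fourier \<psi>) = inv_sin_dist (1 / (2 * R\<^sup>2)) (fourier (\<lambda>x. - \<i> * vderiv \<psi> x))"
      by (simp add: T_def dist_mult_def)
    also have "\<dots> = - 4 * pi * \<i> * (\<Sum>j. - \<i> * vderiv \<psi> (lam j))"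
      unfolding lam_def by (rule inv_sin_dist_fourier[OF v(2)]) (use R in simp)
    also have "(\<Sum>j. - \<i> * vderiv \<psi> (lam j)) = - \<i> * (\<Sum>j. vderiv \<psi> (lam j))" by (rule suminf_mult[OF s])
    finally have "T (fourier \<psi>) = - 4 * pi * \<i> * (- \<i> * (\<Sum>j. vderiv \<psi> (lam j)))" .
    moreover have "w * \<i> * (- \<i> * z) = w * z" for w z
    proof -
      have "w * \<i> * (- \<i> * z) = - (\<i> * \<i>) * (w * z)" by algebra
      then show ?thesis by simp
    qed
    ultimately show "T (fourier \<psi>) = - 4 * pi * (\<Sum>j. vderiv \<psi> (lam j))" by (simp only:)
  qed
  let ?\<xi> = "\<lambda>x. - \<i> * (of_real x * \<phi> x)"
  let ?\<chi> = "\<lambda>x. - \<i> * (of_real x * ?\<xi> x)"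
  have \<chi>: "schwartz ?\<xi>" "schwartz ?\<chi>" by (intro schwartz_scale schwartz_mult_id f)+
  have "dist_deriv (dist_deriv T) (fourier \<phi>) = T (vderiv (vderiv (fourier \<phi>)))" by (simp add: dist_deriv_def)
  also have "vderiv (vderiv (fourier \<phi>)) = fourier ?\<chi>" unfolding vderiv_fourier[OF f] vderiv_fourier[OF \<chi>(1)] by (rule refl)
  finally have dd: "dist_deriv (dist_deriv T) (fourier \<phi>) = - 4 * pi * (\<Sum>j. vderiv ?\<chi> (lam j))" by (simp only: T[OF \<chi>(2)])
  have vc: "vderiv ?\<chi> x = - (2 * of_real x * \<phi> x + of_real (x\<^sup>2) * vderiv \<phi> x)" for x
  proof -
    have d: "(\<phi> has_vector_derivative vderiv \<phi> x) (at x)" using schwartz_derivative[OF f, of 0 x] by simp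
    have x2: "((\<lambda>x. complex_of_real (- (x\<^sup>2))) has_vector_derivative complex_of_real (- (2 * x))) (at x)"
      by (rule has_vector_derivative_of_real) (auto intro!: derivative_eq_intros)
    have "?\<chi> = (\<lambda>x. complex_of_real (- (x\<^sup>2)) * \<phi> x)"
    proof
      fix x :: real
      have "\<i> * \<i> = -1" by simp
      then show "?\<chi> x = complex_of_real (- (x\<^sup>2)) * \<phi> x" unfolding of_real_minus of_real_power by algebra
    qed
    then have "(?\<chi> has_vector_derivative complex_of_real (- (x\<^sup>2)) * vderiv \<phi> x + complex_of_real (- (2 * x)) * \<phi> x) (at x)"
      using has_vector_derivative_mult[OF x2 d] by simp
    from vector_derivative_at[OF this] show ?thesis unfolding vderiv_def[of ?\<chi>] by (simp add: algebra_simps)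
  qed
  have "expansion 1 \<phi> = (\<Sum>j. - of_real (R\<^sup>2) * vderiv ?\<chi> (lam j) + - of_real (1 / (4 * R\<^sup>2)) * vderiv \<phi> (lam j))"
  proof -
    have "coef 1 \<phi> j + of_real (2 * real j + 1) * coef 0 \<phi> j
        = - of_real (R\<^sup>2) * vderiv ?\<chi> (lam j) + - of_real (1 / (4 * R\<^sup>2)) * vderiv \<phi> (lam j)" for j
    proof -
      have 1: "2 * real j + 1 = 2 * R\<^sup>2 * lam j" using R by (simp add: lam_def)
      have 2: "mu j = R\<^sup>2 * (lam j)\<^sup>2 - 1 / (4 * R\<^sup>2)"
        using R by (simp add: lam_def mu_def power_mult_distrib power_divide divide_simps) (simp add: eval_nat_numeral algebra_simps)
      show ?thesis unfolding vc 1 coef_def 2 by (simp add: algebra_simps)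
    qed
    then show ?thesis by (simp add: expansion_def)
  qed
  also have "\<dots> = - of_real (R\<^sup>2) * (\<Sum>j. vderiv ?\<chi> (lam j)) + - of_real (1 / (4 * R\<^sup>2)) * (\<Sum>j. vderiv \<phi> (lam j))"
    using sm[OF f] sm[OF \<chi>(2)] by (simp only: suminf_add[symmetric] suminf_mult[symmetric] summable_mult)
  finally show ?thesis unfolding dd T[OF f] by (simp add: algebra_simps)
qed

end

theorem theorem10:
  fixes R :: real and nabla :: connection and nablaN :: "nat \<Rightarrow> connection"
  assumes "R > 0"
    and "hermitian_connection R 1 nabla"
    and "has_magnetic_curvature R nabla"
    and "\<And>N. N \<ge> 1 \<Longrightarrow> induced_connection R nabla N (nablaN N)"
  shows "\<exists>f :: nat \<Rightarrow> (real \<Rightarrow> complex) \<Rightarrow> complex. \<forall>\<phi>. schwartz \<phi> \<longrightarrow>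
      f 0 \<phi> = \<i> / (4 * of_real pi) * inv_sin_dist (1 / (2 * R\<^sup>2)) (fourier \<phi>) \<and>
      f 1 \<phi> = 1 / (4 * of_real pi) *
        (let T = dist_mult of_real (inv_sin_dist (1 / (2 * R\<^sup>2)))
         in of_real (R\<^sup>2) * dist_deriv (dist_deriv T) (fourier \<phi>)
            + of_real (1 / (4 * R\<^sup>2)) * T (fourier \<phi>)) \<and>
      (\<forall>K\<ge>1. (\<lambda>N. trace_Y R N (nablaN N) \<phi> - (\<Sum>j<K. f j \<phi> * of_nat N powi (1 - int j)))
               \<in> O(\<lambda>N. of_nat N powi (1 - int K)))"
proof -
  interpret L: degree_one R nabla by unfold_locales (fact assms)+
  obtain g where g: "smooth_in (- {0}) g" "\<And>y. cmod (g y) = 1"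
    "\<And>p u. p \<in> S3 \<Longrightarrow> L.nab u (\<lambda>q. g (hopf R q) * c1 q) p = g (hopf R p) * std1 u p"
    "\<And>p u. p \<in> S3 \<Longrightarrow> L.nab u (\<lambda>q. g (hopf R q) * c2 q) p = g (hopf R p) * std2 u p"
    by (rule L.gauge) blast
  have trace: "trace_Y R N (nablaN N) \<phi> = (\<Sum>\<^sub>\<infinity>j. of_nat (N + 2 * j + 1) * \<phi> (lam R j + mu R j / real N))"
    if N: "N \<ge> 1" for N \<phi>
  proof -
    have ind: "induced_connection R nabla N (nablaN N)" by (rule assms(4)[OF N])
    have "gauged R N (nablaN N) nabla g"
    proof unfold_locales
      show "hermitian_connection R N (nablaN N)" using ind by (simp only: induced_connection_def)
    qed (use g(3,4) in \<open>simp_all only: L.nab_apply assms(1) N ind g(1,2)\<close>)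
    then interpret LN: gauged R N "nablaN N" nabla g .
    have "LN.ev j / real N = lam R j + mu R j / real N" for j
      using N assms(1) by (simp add: LN.ev_def lam_def[OF assms(1)] mu_def[OF assms(1)] field_simps)
    then show ?thesis by (simp only: LN.trace_Y_eq)
  qed
  have expansion: "(\<lambda>N. trace_Y R N (nablaN N) \<phi> - (\<Sum>j<K. expansion R j \<phi> * of_nat N powi (1 - int j)))
      \<in> O(\<lambda>N. of_nat N powi (1 - int K))" if "schwartz \<phi>" "K \<ge> 1" for \<phi> K
    \<comment> \<open>The explicit trace formula is available for \<open>N \<ge> 1\<close> only,
      which is enough for a statement about large \<open>N\<close>.\<close>
    using trace_sum_expansion[OF assms(1) that]
    by (rule landau_o.big.in_cong[THEN iffD1, rotated])
       (use trace in \<open>auto intro!: eventually_mono[OF eventually_ge_at_top[of 1]]\<close>)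
  show ?thesis
    by (rule exI[of _ "expansion R"])
       (auto simp only: Let_def intro!: expansion expansion_0[OF assms(1)] expansion_1[OF assms(1)])
qed


end
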